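(* Let $n\geq 2$, $0<p,q<\infty$ and $s\ge 0$. Then for any $\epsilon>0$ the trace operator $\mathbb{T}: f(x)\mapsto f(\bar{x},0)$, $\bar{x}=(x_1,\dots,x_{n-1})$, is bounded $$\mathbb{T}:W^{p,q}_{s+\frac{1}{1\wedge q}-\frac1q+\epsilon}(\mathbb{R}^n)\to W^{p,q}_s(\mathbb{R}^{n-1}).$$
   Context: Notation: $a\wedge b=\min(a,b)$; $\langle k\rangle=(1+|k|^2)^{1/2}$; $\mathcal{S}$ denotes the Schwartz space and $\mathcal{S}'$ the tempered distributions; $\hat f(\xi)=\mathcal{F}f(\xi)=\int e^{-2\pi i x\cdot\xi}f(x)\,dx$. Frequency-uniform decomposition: let $\eta:\mathbb{R}\to[0,1]$ be a smooth function with $\eta(\xi)=1$ for $|\xi|\le 1$ and $\eta(\xi)=0$ for $|\xi|\ge 2$. In dimension $d$, for $k\in\mathbb{Z}^d$ and $\xi\in\mathbb{R}^d$ put $\phi_{k_i}(\xi_i)=\eta(2(\xi_i-k_i))$, $$\varphi_k(\xi)=\frac{\phi_{k_1}(\xi_1)\cdots\phi_{k_d}(\xi_d)}{\sum_{m\in\mathbb{Z}^d}\phi_{m_1}(\xi_1)\cdots\phi_{m_d}(\xi_d)},\qquad \square_k f=\mathcal{F}^{-1}(\varphi_k\hat f).$$ Wiener amalgam spaces: for $0<p,q\le\infty$ and $s\in\mathbb{R}$, $W^{p,q}_s(\mathbb{R}^d)$ is the space of all $f\in\mathcal{S}'(\mathbb{R}^d)$ with $$\|f\|_{W^{p,q}_s}=\Big\|\,\big\|\{\langle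 k\rangle^s\square_k f\}_{k\in\mathbb{Z}^d}\big\|_{\ell^q}\Big\|_{L^p(\mathbb{R}^d)}<\infty.$$ Trace: let $X$ and $Y$ be quasi-Banach function spaces on $\mathbb{R}^n$ and $\mathbb{R}^{n-1}$ respectively, with $\mathcal{S}(\mathbb{R}^n)$ dense in $X$. For $f\in\mathcal{S}(\mathbb{R}^n)$ let $\mathbb{T}f(\bar{x})=f(\bar{x},0)$. The assertion that $\mathbb{T}:X\to Y$ is bounded means that there is a constant $C>0$ with $\|\mathbb{T}f\|_Y\le C\|f\|_X$ for all $f\in\mathcal{S}(\mathbb{R}^n)$, so that $\mathbb{T}$ extends by density to $\mathbb{T}:X\to Y$. *)

theory Defs
  imports "HOL-Analysis.Analysis"
begin

text \<open>
  Everything is defined over an arbitrary Euclidean space, whose standard basis supplies the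
  coordinates \<open>\<xi> \<bullet> b\<close>.  The same definitions thus serve \<open>real ^ 'm\<close> and
  \<open>(real ^ 'm) \<times> real\<close>; the basis of the latter is the standard one of dimension
  \<open>CARD('m) + 1\<close>, the real component being the last coordinate.
\<close>

subsection \<open>Schwartz functions\<close>

primrec iter_partial ::
  "'a::euclidean_space list \<Rightarrow> ('a \<Rightarrow> 'b::real_normed_vector) \<Rightarrow> 'a \<Rightarrow> 'b" where
  "iter_partial [] f = f"
| "iter_partial (b # bs) f = (\<lambda>x. frechet_derivative (iter_partial bs f) (at x) b)"

text \<open>
  Total differentiability of all iterated partial derivatives makes each of them continuous, so
  this is \<open>C\<^sup>\<infinity>\<close>; it also ensures that \<^const>\<open>frechet_derivative\<close> is meaningful above.
\<close>

definition smooth :: "('a::euclidean_space \<Rightarrow> 'b::real_normed_vector) \<Rightarrow> bool" where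
  "smooth f \<longleftrightarrow> (\<forall>bs x. set bs \<subseteq> Basis \<longrightarrow> iter_partial bs f differentiable (at x))"

definition schwartz :: "('a::euclidean_space \<Rightarrow> complex) set" where
  "schwartz = {f. smooth f \<and>
     (\<forall>bs N. set bs \<subseteq> Basis \<longrightarrow>
        (\<exists>C::real. \<forall>x. (1 + norm x) ^ N * norm (iter_partial bs f x) \<le> C))}"

subsection \<open>Fourier transform\<close>

definition fourier :: "('a::euclidean_space \<Rightarrow> complex) \<Rightarrow> 'a \<Rightarrow> complex" where
  "fourier f \<xi> = (\<integral>x. exp (- 2 * complex_of_real pi * \<i> * complex_of_real (x \<bullet> \<xi>)) * f x \<partial>lborel)"

definition inv_fourier :: "('a::euclidean_space \<Rightarrow> complex) \<Rightarrow> 'a \<Rightarrow> complex" where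
  "inv_fourier g x = (\<integral>\<xi>. exp (2 * complex_of_real pi * \<i> * complex_of_real (x \<bullet> \<xi>)) * g \<xi> \<partial>lborel)"

subsection \<open>Frequency-uniform decomposition\<close>

definition cutoff :: "(real \<Rightarrow> real) \<Rightarrow> bool" where
  "cutoff \<eta> \<longleftrightarrow> smooth \<eta> \<and> range \<eta> \<subseteq> {0..1} \<and>
     (\<forall>\<xi>. \<bar>\<xi>\<bar> \<le> 1 \<longrightarrow> \<eta> \<xi> = 1) \<and> (\<forall>\<xi>. \<bar>\<xi>\<bar> \<ge> 2 \<longrightarrow> \<eta> \<xi> = 0)"

definition int_lattice :: "'a::euclidean_space set" where
  "int_lattice = {k. \<forall>b\<in>Basis. k \<bullet> b \<in> \<int>}"

definition tensor_bump :: "(real \<Rightarrow> real) \<Rightarrow> 'a::euclidean_space \<Rightarrow> 'a \<Rightarrow> real" where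
  "tensor_bump \<eta> k \<xi> = (\<Prod>b\<in>Basis. \<eta> (2 * (\<xi> \<bullet> b - k \<bullet> b)))"

text \<open>
  For a cutoff, the sum in the denominator has only finitely many nonzero terms at each point
  and is at least 1.
\<close>

definition uniform_symbol :: "(real \<Rightarrow> real) \<Rightarrow> 'a::euclidean_space \<Rightarrow> 'a \<Rightarrow> real" where
  "uniform_symbol \<eta> k \<xi> = tensor_bump \<eta> k \<xi> / (\<Sum>\<^sub>\<infinity>m\<in>int_lattice. tensor_bump \<eta> m \<xi>)"

definition box_op ::
  "(real \<Rightarrow> real) \<Rightarrow> 'a::euclidean_space \<Rightarrow> ('a \<Rightarrow> complex) \<Rightarrow> 'a \<Rightarrow> complex" where
  "box_op \<eta> k f = inv_fourier (\<lambda>\<xi>. complex_of_real (uniform_symbol \<eta> k \<xi>) * fourier f \<xi>)"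

subsection \<open>Wiener amalgam quasi-norms\<close>

text \<open>Power of an extended nonnegative number; only used with exponents \<open>a > 0\<close>.\<close>

definition ennpowr :: "ennreal \<Rightarrow> real \<Rightarrow> ennreal" where
  "ennpowr x a = (if x = \<infinity> then \<infinity> else ennreal (enn2real x powr a))"

text \<open>For \<open>0 < p < \<infinity>\<close>; the sequence space quasi-norm is the case of counting measure.\<close>

definition Lp_qnorm :: "'i measure \<Rightarrow> real \<Rightarrow> ('i \<Rightarrow> ennreal) \<Rightarrow> ennreal" where
  "Lp_qnorm M p g = ennpowr (\<integral>\<^sup>+x. ennpowr (g x) p \<partial>M) (1 / p)"

definition japanese :: "'a::euclidean_space \<Rightarrow> real" where
  "japanese k = sqrt (1 + (norm k)\<^sup>2)"

text \<open>
  The quasi-norm of \<open>W\<^sup>p\<^sup>,\<^sup>q\<^sub>s\<close>, with value \<open>\<infinity>\<close> allowed.  The Fourier transform being given by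
  the integral, this is meant for Schwartz functions, on which boundedness of the trace is tested.
\<close>

definition wiener_qnorm ::
  "(real \<Rightarrow> real) \<Rightarrow> real \<Rightarrow> real \<Rightarrow> real \<Rightarrow> ('a::euclidean_space \<Rightarrow> complex) \<Rightarrow> ennreal" where
  "wiener_qnorm \<eta> p q s f =
     Lp_qnorm lborel p (\<lambda>x. Lp_qnorm (count_space int_lattice) q
       (\<lambda>k. ennreal (norm ((japanese k powr s) *\<^sub>R box_op \<eta> k f x))))"

subsection \<open>Trace\<close>

definition trace_op :: "('a \<times> real \<Rightarrow> complex) \<Rightarrow> 'a \<Rightarrow> complex" where
  "trace_op f = (\<lambda>x. f (x, 0))"

definition trace_bounded ::
  "(('a::euclidean_space \<times> real \<Rightarrow> complex) \<Rightarrow> ennreal) \<Rightarrow> (('a \<Rightarrow> complex) \<Rightarrow> ennreal) \<Rightarrow> bool" where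
  "trace_bounded X Y \<longleftrightarrow>
     (\<exists>C::real. C > 0 \<and> (\<forall>f\<in>schwartz. Y (trace_op f) \<le> ennreal C * X f))"

end

theory Submission
  imports Defs "HOL-Probability.Probability"
begin

text \<open>
  The idea is to compare the frequency pieces of the trace with those of \<open>f\<close> pointwise, by a
  maximal function that is controlled by an average of the same power.

  Write \<open>f\<^sub>l = \<box>\<^sub>l f\<close>.  Since \<open>\<phi>\<^sub>l\<close> lives on a cube of side 2, \<open>f\<^sub>l\<close> reproduces itself by convolution
  with a kernel that decays faster than any power, uniformly in \<open>l\<close>.  Peetre's argument
  (\<open>Peetre_maximal\<close>) turns the resulting inequality
  \<open>|f\<^sub>l| \<le> K |f\<^sub>l| * wt\<^sup>-\<^sup>a\<close> into
  \<open>(|f\<^sub>l(y)| wt(x - y)\<^sup>-\<^sup>a)\<^sup>t \<le> C \<integral> |f\<^sub>l(z)|\<^sup>t wt(x - z)\<^sup>-\<^sup>b dz\<close> for any exponent \<open>t > 0\<close>.  As all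
  frequency cubes have the same size, the same integrable weight serves every \<open>l\<close>, so the sum over
  \<open>l\<close> can be taken inside the average.

  For the trace, Fourier inversion and \<open>\<Sum>\<^sub>l \<phi>\<^sub>l = 1\<close> give
  \<open>\<box>\<^sub>k (T f) = \<Sum>\<^sub>l \<box>\<^sub>k (f\<^sub>l(\<cdot>, 0))\<close>, where only the \<open>l\<close> whose first coordinates are within 1 of those of
  \<open>k\<close> contribute (\<open>box_op_trace_le\<close>, \<open>trace_piece_eq_0\<close>).  Peetre's inequality with \<open>t = q\<close> bounds
  the \<open>q\<close>-th power of each summand at \<open>x\<close> by an average of \<open>|f\<^sub>l|\<^sup>q\<close> around \<open>(x, 0)\<close>
  (\<open>box_op_trace_piece_bound\<close>).  The remaining sum over the last coordinate of \<open>l\<close> is infinite.  For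
  \<open>q \<le> 1\<close> it is moved outside the \<open>q\<close>-th power for free; for \<open>q > 1\<close> Hoelder's inequality costs the
  weight \<open>\<langle>l\<rangle>\<close> to a power just above \<open>1 - 1/q\<close>, which is the loss of smoothness in the theorem
  (\<open>freq_near_sum_powr_le\<close>).  This bounds the \<open>q\<close>-th power of the sequence norm of \<open>T f\<close> at \<open>x\<close> by
  an average over \<open>\<real>\<^sup>n\<close> of the \<open>q\<close>-th power \<open>U\<close> of the sequence norm of \<open>f\<close>
  (\<open>trace_sequence_bound\<close>).

  Finally \<open>U\<close> satisfies the same kind of self-improving inequality as each \<open>|f\<^sub>l|\<^sup>q\<close>, so Peetre's
  argument with \<open>t = p/q\<close> moves the power \<open>p/q\<close> inside the average (\<open>square_function_bound\<close>), and
  Tonelli's theorem finishes the proof, because the weight centred at \<open>(x, 0)\<close> has an integral in \<open>x\<close>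
  that is bounded independently of the point where it is evaluated.

  The Fourier analysis behind this is developed for Schwartz functions: decay of the Fourier
  transform by differentiation, and the inversion formula by Gaussian regularisation.  All
  symbols are tensor products of one-dimensional test functions, which reduces every statement about
  kernels to dimension one.
\<close>

section \<open>Powers of extended nonnegative numbers\<close>

lemma ennpowr_ennreal: "0 \<le> r \<Longrightarrow> ennpowr (ennreal r) a = ennreal (r powr a)"
  by (simp add: ennpowr_def)

lemma ennpowr_top [simp]: "ennpowr \<top> a = \<top>"
  by (simp add: ennpowr_def)

lemma ennpowr_0 [simp]: "ennpowr 0 a = 0"
  by (simp add: ennpowr_def)

lemma ennpowr_mono: "0 \<le> a \<Longrightarrow> x \<le> y \<Longrightarrow> ennpowr x a \<le> ennpowr y a"
  by (cases x; cases y) (auto simp: ennpowr_ennreal powr_mono2 top_unique)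

lemma ennpowr_mult: "ennpowr (x * y) a = ennpowr x a * ennpowr y a"
proof (cases x; cases y)
  fix r s assume "x = ennreal r" "0 \<le> r" "y = ennreal s" "0 \<le> s"
  then show ?thesis
    by (simp add: ennpowr_ennreal powr_mult flip: ennreal_mult)
next
  fix r assume "x = ennreal r" "0 \<le> r" "y = \<top>"
  then show ?thesis
    by (cases "r = 0") (auto simp: ennpowr_ennreal ennreal_mult_top)
next
  fix r assume "x = \<top>" "y = ennreal r" "0 \<le> r"
  then show ?thesis
    by (cases "r = 0") (auto simp: ennpowr_ennreal ennreal_top_mult)
qed simp

lemma ennpowr_ennpowr: "ennpowr (ennpowr x a) b = ennpowr x (a * b)"
  by (cases x) (auto simp: ennpowr_ennreal powr_powr)

lemma ennpowr_1 [simp]: "ennpowr x 1 = x"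
  by (cases x) (auto simp: ennpowr_ennreal)

lemma measurable_ennpowr [measurable (raw)]:
  assumes [measurable]: "f \<in> borel_measurable M"
  shows "(\<lambda>x. ennpowr (f x) a) \<in> borel_measurable M"
  unfolding ennpowr_def by measurable

section \<open>Lebesgue integrals: substitution, Hoelder, tensor products\<close>

lemma nn_integral_lborel_reflect:
  fixes f :: "'a::euclidean_space \<Rightarrow> ennreal"
  assumes [measurable]: "f \<in> borel_measurable borel"
  shows "(\<integral>\<^sup>+z. f (x - z) \<partial>lborel) = (\<integral>\<^sup>+z. f z \<partial>lborel)"
  by (subst (2) lborel_affine[of "-1" x])
    (simp_all add: nn_integral_density nn_integral_distr)

lemma integral_lborel_affine:
  fixes f :: "'a::euclidean_space \<Rightarrow> complex"
  assumes c: "c \<noteq> 0"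
  assumes [measurable]: "f \<in> borel_measurable borel"
  shows "(\<integral>z. f z \<partial>lborel) = complex_of_real (\<bar>c\<bar> ^ DIM('a)) * (\<integral>z. f (x + c *\<^sub>R z) \<partial>lborel)"
  by (subst lborel_affine[of "c" x])
    (use c in \<open>simp_all add: integral_density integral_distr scaleR_conv_of_real flip: of_real_power\<close>)

lemma integrable_lborel_affine:
  fixes f :: "'a::euclidean_space \<Rightarrow> complex"
  assumes c: "c \<noteq> 0"
  assumes "integrable lborel f"
  shows "integrable lborel (\<lambda>z. f (x + c *\<^sub>R z))"
proof -
  have [measurable]: "f \<in> borel_measurable borel"
    using assms(2) by auto
  have "integrable (density (distr lborel borel (\<lambda>z. x + c *\<^sub>R z)) (\<lambda>_. \<bar>c\<bar>^DIM('a))) f"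
    using assms lborel_affine[of c x] by metis
  then have "integrable lborel (\<lambda>z. complex_of_real (\<bar>c\<bar> ^ DIM('a)) * f (x + c *\<^sub>R z))"
    by (subst (asm) integrable_density) (simp_all add: integrable_distr_eq scaleR_conv_of_real flip: of_real_power)
  then have "integrable lborel (\<lambda>z. complex_of_real (1 / \<bar>c\<bar> ^ DIM('a)) *
      (complex_of_real (\<bar>c\<bar> ^ DIM('a)) * f (x + c *\<^sub>R z)))"
    by (rule integrable_mult_right)
  then show ?thesis using c by (simp flip: mult.assoc of_real_mult)
qed

lemma integral_lborel_reflect:
  fixes f :: "'a::euclidean_space \<Rightarrow> complex"
  assumes [measurable]: "f \<in> borel_measurable borel"
  shows "(\<integral>z. f (x - z) \<partial>lborel) = (\<integral>z. f z \<partial>lborel)"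
  using integral_lborel_affine[of "-1" f x] by simp

text \<open>
  Hoelder's inequality against a weight of finite mass.  Integrating the tangent-line inequality
  \<open>v \<le> (1 - 1/t) l + (1/t) l\<^sup>1\<^sup>-\<^sup>t v\<^sup>t\<close> and optimising the free parameter \<open>l\<close> gives it with values
  in \<open>[0, \<infinity>]\<close>.
\<close>

lemma nn_integral_powr_Jensen:
  fixes v m :: "'a \<Rightarrow> real"
  assumes t: "1 \<le> t" and [measurable]: "v \<in> borel_measurable N" "m \<in> borel_measurable N"
    and nn: "\<And>x. 0 \<le> v x" "\<And>x. 0 \<le> m x"
    and M: "0 < M" "(\<integral>\<^sup>+x. ennreal (m x) \<partial>N) \<le> ennreal M"
  shows "ennpowr (\<integral>\<^sup>+x. ennreal (v x * m x) \<partial>N) t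
           \<le> ennreal (M powr (t - 1)) * (\<integral>\<^sup>+x. ennreal (v x powr t * m x) \<partial>N)"
proof (cases "(\<integral>\<^sup>+x. ennreal (v x powr t * m x) \<partial>N)")
  case top
  then show ?thesis using M by (simp add: ennreal_mult_top)
next
  case (real A)
  have le: "(\<integral>\<^sup>+x. ennreal (v x * m x) \<partial>N) \<le> ennreal (l * M)" if l: "0 < l" "A \<le> l powr t * M" for l
  proof -
    \<comment> \<open>The tangent line at \<open>v = l\<close>.\<close>
    have young: "v x \<le> (1 - 1 / t) * l + 1 / t * l powr (1 - t) * v x powr t" for x
    proof (cases "v x = 0")
      case True
      then show ?thesis using t l by simp
    next
      case False
      then have "l powr (1 - 1/t) * (l powr (1 - t) * v x powr t) powr (1/t) \<le>
          (1 - 1/t) * l + 1/t * (l powr (1 - t) * v x powr t)"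
        using t l nn(1)[of x]
        by (intro Youngs_inequality_0) (auto simp: less_le)
      moreover have "l powr (1 - 1/t) * (l powr (1 - t) * v x powr t) powr (1/t) = v x"
        using t l nn(1)[of x] by (simp add: powr_mult powr_powr diff_divide_distrib flip: powr_add mult.assoc)
      ultimately show ?thesis by simp
    qed
    have "(\<integral>\<^sup>+x. ennreal (v x * m x) \<partial>N)
        \<le> (\<integral>\<^sup>+x. ennreal ((1 - 1 / t) * l) * ennreal (m x) +
              ennreal (1 / t * l powr (1 - t)) * ennreal (v x powr t * m x) \<partial>N)"
    proof (intro nn_integral_mono)
      fix x
      have "v x * m x \<le> ((1 - 1 / t) * l + 1 / t * l powr (1 - t) * v x powr t) * m x"
        using young nn by (intro mult_right_mono) auto
      also have "\<dots> = (1 - 1 / t) * l * m x + 1 / t * l powr (1 - t) * (v x powr t * m x)"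
        by (simp add: algebra_simps)
      finally show "ennreal (v x * m x) \<le> ennreal ((1 - 1 / t) * l) * ennreal (m x) +
              ennreal (1 / t * l powr (1 - t)) * ennreal (v x powr t * m x)"
        using t l nn by (simp flip: ennreal_mult ennreal_plus)
    qed
    also have "\<dots> = ennreal ((1 - 1 / t) * l) * (\<integral>\<^sup>+x. ennreal (m x) \<partial>N) +
              ennreal (1 / t * l powr (1 - t)) * ennreal A"
      by (subst nn_integral_add) (simp_all add: nn_integral_cmult real)
    also have "\<dots> \<le> ennreal ((1 - 1 / t) * l) * ennreal M + ennreal (1 / t * l powr (1 - t)) * ennreal (l powr t * M)"
      using M l by (intro add_mono mult_left_mono) (auto intro!: ennreal_leI)
    also have "\<dots> = ennreal ((1 - 1 / t) * l * M + 1 / t * l powr (1 - t) * (l powr t * M))"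
      using t l M by (simp flip: ennreal_mult ennreal_plus)
    also have "(1 - 1 / t) * l * M + 1 / t * l powr (1 - t) * (l powr t * M) = l * M"
    proof -
      have "l powr (1 - t) * l powr t = l" using l by (simp flip: powr_add)
      then have "1 / t * l powr (1 - t) * (l powr t * M) = 1 / t * l * M"
        by (metis mult.assoc)
      then show ?thesis by (simp add: algebra_simps)
    qed
    finally show ?thesis .
  qed
  show ?thesis
  proof (cases "A = 0")
    case True
    have "(\<integral>\<^sup>+x. ennreal (v x * m x) \<partial>N) \<le> ennreal e" if "0 < e" for e
      using le[of "e / M"] that M True by simp
    then have "(\<integral>\<^sup>+x. ennreal (v x * m x) \<partial>N) \<le> 0 + ennreal e" if "0 < e" for e
      using that by simp
    then have "(\<integral>\<^sup>+x. ennreal (v x * m x) \<partial>N) \<le> 0"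
      by (rule ennreal_le_epsilon)
    then show ?thesis by simp
  next
    case False
    then have A: "0 < A" using real by simp
    \<comment> \<open>The minimiser of the bound; it makes \<open>A = l\<^sup>t M\<close>.\<close>
    let ?l = "(A / M) powr (1 / t)"
    have "(\<integral>\<^sup>+x. ennreal (v x * m x) \<partial>N) \<le> ennreal (?l * M)"
      using A M t by (intro le) (auto simp: powr_powr)
    then have "ennpowr (\<integral>\<^sup>+x. ennreal (v x * m x) \<partial>N) t \<le> ennpowr (ennreal (?l * M)) t"
      using t by (intro ennpowr_mono) auto
    also have "\<dots> = ennreal (M powr (t - 1) * A)"
      using t A M by (simp add: ennpowr_ennreal powr_mult powr_powr powr_diff field_simps)
    finally show ?thesis using real by (simp add: ennreal_mult)
  qed
qed

lemma
  fixes h :: "'a::euclidean_space \<Rightarrow> real \<Rightarrow> complex"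
  assumes int: "\<And>b. b \<in> Basis \<Longrightarrow> integrable lborel (h b)"
  shows integrable_lborel_tensor: "integrable lborel (\<lambda>x. \<Prod>b\<in>Basis. h b (x \<bullet> b))"
    and integral_lborel_tensor: "(\<integral>x. (\<Prod>b\<in>Basis. h b (x \<bullet> b)) \<partial>lborel) = (\<Prod>b\<in>Basis. \<integral>t. h b t \<partial>lborel)"
proof -
  interpret product_sigma_finite "\<lambda>_::'a. lborel :: real measure" ..
  have [measurable]: "b \<in> Basis \<Longrightarrow> h b \<in> borel_measurable borel" for b
    using borel_measurable_integrable[OF int] by simp
  have coord: "(\<Sum>b'\<in>Basis. f b' *\<^sub>R b') \<bullet> b = f b" if "b \<in> Basis" for f and b :: 'a
    using that by simp
  let ?g = "\<lambda>x::'a. \<Prod>b\<in>Basis. h b (x \<bullet> b)" and ?T = "\<lambda>f. \<Sum>b\<in>(Basis::'a set). f b *\<^sub>R b"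
  let ?P = "\<Pi>\<^sub>M b\<in>(Basis::'a set). lborel :: real measure"
  have g: "?g \<in> borel_measurable borel" by measurable
  have T: "?T \<in> ?P \<rightarrow>\<^sub>M borel" by measurable
  have eq: "(lborel :: 'a measure) = distr ?P borel ?T"
    by (rule lborel_eq)
  have gT: "?g (?T f) = (\<Prod>b\<in>Basis. h b (f b))" for f
    by (intro prod.cong refl) (simp add: coord)
  show "integrable lborel ?g"
    unfolding eq integrable_distr_eq[OF T g] gT
    by (rule product_integrable_prod) (simp_all add: int)
  show "(\<integral>x. ?g x \<partial>lborel) = (\<Prod>b\<in>Basis. \<integral>t. h b t \<partial>lborel)"
    unfolding eq integral_distr[OF T g] gT
    by (rule product_integral_prod) (simp_all add: int)
qed

section \<open>The tensor weight\<close>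

text \<open>
  It lies between \<open>1 + norm z\<close> and a power of it, but it is a tensor product: its integrals factor, and on a product
  space it splits into the weights of the components, which is what the restriction to a hyperplane
  needs.
\<close>

definition wt :: "'a::euclidean_space \<Rightarrow> real" where
  "wt z = (\<Prod>b\<in>Basis. 1 + \<bar>z \<bullet> b\<bar>)"

lemma wt_ge_1: "1 \<le> wt z"
  unfolding wt_def by (intro prod_ge_1) auto

lemma wt_pos [simp]: "0 < wt z"
  using wt_ge_1[of z] by linarith

lemma wt_0 [simp]: "wt 0 = 1"
  by (simp add: wt_def)

lemma wt_minus: "wt (- z) = wt z"
  by (simp add: wt_def)

lemma wt_minus_commute: "wt (x - y) = wt (y - x)"
  using wt_minus[of "y - x"] by simp

lemma measurable_wt [measurable (raw)]:
  assumes [measurable]: "f \<in> borel_measurable M"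
  shows "(\<lambda>x. wt (f x)) \<in> borel_measurable M"
  unfolding wt_def by measurable

lemma wt_add_le: "wt (x + y) \<le> wt x * wt y"
  unfolding wt_def prod.distrib[symmetric]
proof (intro prod_mono conjI)
  fix b :: 'a
  have "1 + \<bar>(x + y) \<bullet> b\<bar> \<le> 1 + \<bar>x \<bullet> b\<bar> + \<bar>y \<bullet> b\<bar>"
    by (simp add: inner_add_left)
  also have "\<dots> \<le> (1 + \<bar>x \<bullet> b\<bar>) * (1 + \<bar>y \<bullet> b\<bar>)"
    by (simp add: algebra_simps)
  finally show "1 + \<bar>(x + y) \<bullet> b\<bar> \<le> (1 + \<bar>x \<bullet> b\<bar>) * (1 + \<bar>y \<bullet> b\<bar>)" .
qed auto

lemma wt_triangle: "wt (x - z) \<le> wt (x - y) * wt (y - z)"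
  using wt_add_le[of "x - y" "y - z"] by simp

lemma wt_Pair: "wt (x, y) = wt x * wt y"
proof -
  have "wt (x, y) = (\<Prod>b\<in>(\<lambda>u. (u, 0)) ` Basis. 1 + \<bar>(x, y) \<bullet> b\<bar>) *
                    (\<Prod>b\<in>(\<lambda>v. (0, v)) ` Basis. 1 + \<bar>(x, y) \<bullet> b\<bar>)"
    unfolding wt_def Basis_prod_def by (intro prod.union_disjoint) auto
  also have "\<dots> = wt x * wt y"
    by (simp add: wt_def prod.reindex inj_on_def)
  finally show ?thesis .
qed

lemma wt_le_norm: "wt z \<le> (1 + norm z) ^ DIM('a)" for z :: "'a::euclidean_space"
proof -
  have "wt z \<le> (\<Prod>b\<in>(Basis::'a set). 1 + norm z)"
    unfolding wt_def by (intro prod_mono) (auto simp: Basis_le_norm)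
  then show ?thesis by simp
qed

lemma integrable_inverse_square_1d: "integrable lborel (\<lambda>t::real. (1 + \<bar>t\<bar>) powr - 2)"
proof (rule Bochner_Integration.integrable_bound[where f = "\<lambda>t::real. inverse (1 + t^2)"])
  show "integrable lborel (\<lambda>t::real. inverse (1 + t^2))"
    using integrable_inverse_1_plus_square by (simp add: set_integrable_def)
  have "norm ((1 + \<bar>t\<bar>) powr - 2) \<le> norm (inverse (1 + t\<^sup>2))" for t :: real
  proof -
    have "1 + t^2 \<le> (1 + \<bar>t\<bar>)^2" by (simp add: power2_eq_square algebra_simps)
    then have "inverse ((1 + \<bar>t\<bar>)^2) \<le> inverse (1 + t^2)"
      by (intro le_imp_inverse_le) (auto intro: add_pos_nonneg)
    then show ?thesis
      by (simp add: powr_minus)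
  qed
  then show "AE t in lborel. norm ((1 + \<bar>t\<bar>) powr - 2) \<le> norm (inverse (1 + (t::real)\<^sup>2))"
    by blast
qed auto

text \<open>
  The summand 1 serves to make the constant evidently positive.
\<close>

definition wt_mass :: "'a::euclidean_space itself \<Rightarrow> real" where
  "wt_mass _ = 1 + enn2real (\<integral>\<^sup>+z. ennreal (wt (z::'a) powr - 2) \<partial>lborel)"

lemma wt_mass_pos: "0 < wt_mass TYPE('a::euclidean_space)"
  unfolding wt_mass_def by (simp add: add_pos_nonneg)

lemma wt_powr_tensor: "wt z powr a = (\<Prod>b\<in>Basis. (1 + \<bar>z \<bullet> b\<bar>) powr a)"
  unfolding wt_def by (subst prod_powr_distrib) auto

lemma nn_integral_wt:
  fixes x :: "'a::euclidean_space"
  assumes "2 \<le> a"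
  shows "(\<integral>\<^sup>+z. ennreal (wt (x - z) powr - a) \<partial>lborel) \<le> ennreal (wt_mass TYPE('a))"
proof -
  have "(\<integral>\<^sup>+z. ennreal (wt (z::'a) powr - 2) \<partial>lborel) =
      (\<integral>\<^sup>+z. (\<Prod>b\<in>Basis. ennreal ((1 + \<bar>(z::'a) \<bullet> b\<bar>) powr - 2)) \<partial>lborel)"
    by (simp add: wt_powr_tensor prod_ennreal)
  also have "\<dots> = (\<Prod>b\<in>(Basis::'a set). \<integral>\<^sup>+t. ennreal ((1 + \<bar>t\<bar>) powr - 2) \<partial>lborel)"
    by (rule nn_integral_lborel_prod) auto
  also have "\<dots> < \<top>"
    using integrable_inverse_square_1d
    by (simp add: integrable_iff_bounded prod_constant power_less_top_ennreal)
  finally have fin: "(\<integral>\<^sup>+z. ennreal (wt (z::'a) powr - 2) \<partial>lborel) < \<top>" .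
  have "(\<integral>\<^sup>+z. ennreal (wt (x - z) powr - a) \<partial>lborel) \<le> (\<integral>\<^sup>+z. ennreal (wt (x - z) powr - 2) \<partial>lborel)"
    using assms by (intro nn_integral_mono ennreal_leI powr_mono wt_ge_1) auto
  also have "\<dots> = (\<integral>\<^sup>+z. ennreal (wt (z::'a) powr - 2) \<partial>lborel)"
    by (rule nn_integral_lborel_reflect) measurable
  also have "\<dots> \<le> ennreal (wt_mass TYPE('a))"
    using fin unfolding wt_mass_def
    by (metis add_increasing ennreal_enn2real ennreal_leI order_refl zero_le_one less_top)
  finally show ?thesis .
qed

lemma integrable_wt:
  assumes "2 \<le> a"
  shows "integrable lborel (\<lambda>z::'a::euclidean_space. wt z powr - a)"
  using nn_integral_wt[OF assms, of "0::'a"]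
  by (auto simp: integrable_iff_bounded wt_minus intro: le_less_trans)

text \<open>
  A convolution with \<open>wt\<^sup>-\<^sup>a\<close> centred at \<open>y\<close> is dominated by one centred at \<open>x\<close>, at the price of the
  factor \<open>wt(x - y)\<^sup>a\<close>; this is what lets Peetre's argument move the centre.
\<close>

section \<open>Peetre's maximal inequality\<close>

lemma wt_powr_triangle:
  assumes "0 \<le> a"
  shows "wt (y - z) powr - a * wt (x - y) powr - a \<le> wt (x - z) powr - a"
proof -
  have "(wt (x - y) * wt (y - z)) powr - a \<le> wt (x - z) powr - a"
    using assms by (intro powr_mono2' wt_triangle) auto
  then show ?thesis by (simp add: powr_mult less_imp_le mult.commute)
qed

lemma wt_powr_le_1: "0 \<le> a \<Longrightarrow> wt z powr - a \<le> 1"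
  using powr_mono2'[of "-a" 1 "wt z"] wt_ge_1[of z] by simp

text \<open>
  Let \<open>U\<close> be the supremum over \<open>y\<close> of \<open>u(y) wt(x - y)\<^sup>-\<^sup>a\<close>.  The hypothesis bounds \<open>U\<close> by
  \<open>K \<integral> u wt\<^sup>-\<^sup>a\<close>.  For \<open>t \<ge> 1\<close> Hoelder's inequality suffices.  For \<open>t < 1\<close> one splits the
  integrand \<open>v = u wt\<^sup>-\<^sup>a\<close> as \<open>v\<^sup>t v\<^sup>1\<^sup>-\<^sup>t \<le> v\<^sup>t U\<^sup>1\<^sup>-\<^sup>t\<close> and divides by \<open>U\<^sup>1\<^sup>-\<^sup>t\<close>; boundedness of \<open>u\<close>
  makes \<open>U\<close> finite, and the constant does not depend on the bound.  The choice of \<open>a\<close>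
  is the smallest for which both \<open>a \<ge> b\<close> and \<open>a t \<ge> b\<close>.
\<close>

lemma Peetre_maximal:
  fixes t b K :: real
  assumes t: "0 < t" and b: "2 \<le> b" and K: "0 < K"
  defines "a \<equiv> b * max 1 (1 / t)"
  shows "\<exists>C>0. \<forall>(u :: 'a::euclidean_space \<Rightarrow> real) B.
    u \<in> borel_measurable borel \<longrightarrow> (\<forall>x. 0 \<le> u x \<and> u x \<le> B) \<longrightarrow>
    (\<forall>x. ennreal (u x) \<le> ennreal K * (\<integral>\<^sup>+z. ennreal (u z * wt (x - z) powr - a) \<partial>lborel)) \<longrightarrow>
    (\<forall>x y. ennreal ((u y * wt (x - y) powr - a) powr t)
       \<le> ennreal C * (\<integral>\<^sup>+z. ennreal (u z powr t * wt (x - z) powr - b) \<partial>lborel))"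
proof -
  let ?M = "wt_mass TYPE('a)"
  have a: "b \<le> a" unfolding a_def using b by simp
  \<comment> \<open>The hypothesis passes from \<open>u\<close> to its weighted values around any centre \<open>x\<close>.\<close>
  have spread: "ennreal (u y * wt (x - y) powr - a)
      \<le> ennreal K * (\<integral>\<^sup>+z. ennreal (u z * wt (x - z) powr - a) \<partial>lborel)"
    if [measurable]: "u \<in> borel_measurable borel" and nn: "\<And>x. 0 \<le> u x"
    and le: "\<And>x. ennreal (u x) \<le> ennreal K * (\<integral>\<^sup>+z. ennreal (u z * wt (x - z) powr - a) \<partial>lborel)"
    for u :: "'a \<Rightarrow> real" and x y
  proof -
    have "ennreal (u y * wt (x - y) powr - a) = ennreal (u y) * ennreal (wt (x - y) powr - a)"
      using nn by (simp add: ennreal_mult)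
    also have "\<dots> \<le> (ennreal K * (\<integral>\<^sup>+z. ennreal (u z * wt (y - z) powr - a) \<partial>lborel)) * ennreal (wt (x - y) powr - a)"
      by (intro mult_right_mono le) auto
    also have "\<dots> = ennreal K * (\<integral>\<^sup>+z. ennreal (u z * wt (y - z) powr - a) * ennreal (wt (x - y) powr - a) \<partial>lborel)"
      by (subst nn_integral_multc) (auto simp: mult.assoc)
    also have "\<dots> \<le> ennreal K * (\<integral>\<^sup>+z. ennreal (u z * wt (x - z) powr - a) \<partial>lborel)"
    proof (intro mult_left_mono nn_integral_mono)
      fix z
      have "u z * (wt (y - z) powr - a * wt (x - y) powr - a) \<le> u z * wt (x - z) powr - a"
        using a b by (intro mult_left_mono wt_powr_triangle nn) auto
      then show "ennreal (u z * wt (y - z) powr - a) * ennreal (wt (x - y) powr - a) \<le> ennreal (u z * wt (x - z) powr - a)"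
        using nn by (subst ennreal_mult[symmetric]) (auto simp: mult.assoc intro!: ennreal_leI)
    qed auto
    finally show ?thesis .
  qed
  show ?thesis
  proof (cases "1 \<le> t")
    case True
    then have ab: "a = b" unfolding a_def by simp
    have M: "(\<integral>\<^sup>+z. ennreal (wt (x - z) powr - a) \<partial>lborel) \<le> ennreal ?M" for x :: 'a
      using nn_integral_wt[of a x] a b by simp
    have "ennreal ((u y * wt (x - y) powr - a) powr t)
       \<le> ennreal (K powr t * ?M powr (t - 1)) * (\<integral>\<^sup>+z. ennreal (u z powr t * wt (x - z) powr - b) \<partial>lborel)"
      if [measurable]: "u \<in> borel_measurable borel" and nn: "\<And>x. 0 \<le> u x"
        and le: "\<And>x. ennreal (u x) \<le> ennreal K * (\<integral>\<^sup>+z. ennreal (u z * wt (x - z) powr - a) \<partial>lborel)"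
      for u :: "'a \<Rightarrow> real" and x y
    proof -
      have "ennreal ((u y * wt (x - y) powr - a) powr t) = ennpowr (ennreal (u y * wt (x - y) powr - a)) t"
        using nn by (simp add: ennpowr_ennreal)
      also have "\<dots> \<le> ennpowr (ennreal K * (\<integral>\<^sup>+z. ennreal (u z * wt (x - z) powr - a) \<partial>lborel)) t"
        using t by (intro ennpowr_mono spread nn le) auto
      also have "\<dots> = ennreal (K powr t) * ennpowr (\<integral>\<^sup>+z. ennreal (u z * wt (x - z) powr - a) \<partial>lborel) t"
        using K by (simp add: ennpowr_mult ennpowr_ennreal)
      also have "\<dots> \<le> ennreal (K powr t) * (ennreal (?M powr (t - 1)) * (\<integral>\<^sup>+z. ennreal (u z powr t * wt (x - z) powr - a) \<partial>lborel))"
        using True nn M by (intro mult_left_mono nn_integral_powr_Jensen wt_mass_pos) auto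
      finally show ?thesis by (simp add: ab ennreal_mult mult.assoc)
    qed
    moreover have "0 < K powr t * ?M powr (t - 1)"
      using K wt_mass_pos[where 'a='a] by simp
    ultimately show ?thesis by blast
  next
    case False
    then have at: "a * t = b" unfolding a_def using t by (simp add: max_def field_simps)
    have "ennreal ((u y * wt (x - y) powr - a) powr t)
       \<le> ennreal K * (\<integral>\<^sup>+z. ennreal (u z powr t * wt (x - z) powr - b) \<partial>lborel)"
      if [measurable]: "u \<in> borel_measurable borel" and nn: "\<And>x. 0 \<le> u x" and bdd: "\<And>x. u x \<le> B"
        and le: "\<And>x. ennreal (u x) \<le> ennreal K * (\<integral>\<^sup>+z. ennreal (u z * wt (x - z) powr - a) \<partial>lborel)"
      for u :: "'a \<Rightarrow> real" and B x y
    proof (cases "\<integral>\<^sup>+z. ennreal (u z powr t * wt (x - z) powr - b) \<partial>lborel")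
      case top
      then show ?thesis using K by (simp add: ennreal_mult_top)
    next
      case (real i)
      define v where "v = (\<lambda>z. u z * wt (x - z) powr - a)"
      define U where "U = (SUP z. v z)"
      have v0: "0 \<le> v z" for z using nn by (simp add: v_def)
      have "v z \<le> B" for z
      proof -
        have "v z \<le> u z * 1"
          unfolding v_def using a b by (intro mult_left_mono wt_powr_le_1 nn) auto
        then show ?thesis using bdd[of z] by simp
      qed
      then have vU: "v z \<le> U" for z
        unfolding U_def by (intro cSUP_upper) (auto intro!: bdd_aboveI2)
      have vt: "v z powr t = u z powr t * wt (x - z) powr - b" for z
        using nn at by (simp add: v_def powr_mult powr_powr)
      have "ennreal (v w) \<le> ennreal (K * U powr (1 - t) * i)" for w
      proof -
        have "ennreal (v w) \<le> ennreal K * (\<integral>\<^sup>+z. ennreal (v z) \<partial>lborel)"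
          unfolding v_def by (intro spread nn le) simp
        also have "\<dots> \<le> ennreal K * (\<integral>\<^sup>+z. ennreal (U powr (1 - t)) * ennreal (u z powr t * wt (x - z) powr - b) \<partial>lborel)"
        proof (intro mult_left_mono nn_integral_mono)
          fix z
          have "v z = v z powr (1 - t) * v z powr t"
            using v0 by (simp flip: powr_add)
          also have "\<dots> \<le> U powr (1 - t) * (u z powr t * wt (x - z) powr - b)"
            unfolding vt using False v0 vU nn by (intro mult_right_mono powr_mono2) auto
          finally show "ennreal (v z) \<le> ennreal (U powr (1 - t)) * ennreal (u z powr t * wt (x - z) powr - b)"
            using nn by (simp flip: ennreal_mult add: ennreal_leI)
        qed auto
        also have "\<dots> = ennreal (K * U powr (1 - t) * i)"
          using K real by (simp add: nn_integral_cmult ennreal_mult mult.assoc)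
        finally show ?thesis .
      qed
      then have "v w \<le> K * U powr (1 - t) * i" for w
        using K real by (subst (asm) ennreal_le_iff) auto
      then have U: "U \<le> K * U powr (1 - t) * i"
        unfolding U_def by (intro cSUP_least) auto
      have "U powr t \<le> K * i"
      proof (cases "U = 0")
        case True
        then show ?thesis using K real by simp
      next
        case False
        then have "0 < U" using v0[of x] vU[of x] by linarith
        then have "U = U powr (1 - t) * U powr t" by (simp flip: powr_add)
        then have "U powr (1 - t) * U powr t \<le> U powr (1 - t) * (K * i)"
          using U by (simp add: mult.left_commute mult.commute mult.assoc)
        then show ?thesis using \<open>0 < U\<close> by simp
      qed
      moreover have "v y powr t \<le> U powr t"
        using t v0 vU by (intro powr_mono2) auto
      ultimately have "ennreal (v y powr t) \<le> ennreal (K * i)"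
        by (intro ennreal_leI) linarith
      then show ?thesis using K real by (simp add: v_def ennreal_mult)
    qed
    then show ?thesis using K by blast
  qed
qed

section \<open>Characters and the Fourier integral\<close>

definition expi :: "real \<Rightarrow> complex" where
  "expi t = cis (2 * pi * t)"

lemma norm_expi [simp]: "norm (expi t) = 1"
  by (simp add: expi_def)

lemma expi_0 [simp]: "expi 0 = 1"
  by (simp add: expi_def)

lemma expi_add: "expi (s + t) = expi s * expi t"
  by (simp add: expi_def cis_mult distrib_left)

lemma expi_diff: "expi (s - t) = expi s * expi (- t)"
  by (simp flip: expi_add)

lemma expi_sum: "expi (\<Sum>i\<in>A. f i) = (\<Prod>i\<in>A. expi (f i))"
  by (induction A rule: infinite_finite_induct) (auto simp: expi_add)

lemma continuous_on_expi [continuous_intros]: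
  assumes "continuous_on A f"
  shows "continuous_on A (\<lambda>x. expi (f x))"
  unfolding expi_def using assms by (intro continuous_intros)

lemma measurable_expi [measurable (raw)]:
  assumes [measurable]: "f \<in> borel_measurable M"
  shows "(\<lambda>x. expi (f x)) \<in> borel_measurable M"
proof -
  have [measurable]: "expi \<in> borel_measurable borel"
    by (intro borel_measurable_continuous_onI continuous_intros)
  show ?thesis by measurable
qed

lemma fourier_expi: "fourier f \<xi> = (\<integral>x. expi (- (x \<bullet> \<xi>)) * f x \<partial>lborel)"
  unfolding fourier_def expi_def cis_conv_exp by (simp add: mult_ac)

lemma inv_fourier_expi: "inv_fourier g x = (\<integral>\<xi>. expi (x \<bullet> \<xi>) * g \<xi> \<partial>lborel)"
  unfolding inv_fourier_def expi_def cis_conv_exp by (simp add: mult_ac)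

lemma inv_fourier_eq_fourier: "inv_fourier g x = fourier g (- x)"
  by (simp add: fourier_expi inv_fourier_expi inner_commute)

lemma measurable_fourier [measurable (raw)]:
  fixes f :: "'a::euclidean_space \<Rightarrow> complex"
  assumes [measurable]: "f \<in> borel_measurable borel" "g \<in> borel_measurable M"
  shows "(\<lambda>x. fourier f (g x)) \<in> borel_measurable M"
proof -
  have "(\<lambda>\<xi>. fourier f \<xi>) \<in> borel_measurable borel"
    unfolding fourier_expi by measurable
  from measurable_compose[OF assms(2) this] show ?thesis by simp
qed

lemma measurable_inv_fourier [measurable (raw)]:
  fixes f :: "'a::euclidean_space \<Rightarrow> complex"
  assumes [measurable]: "f \<in> borel_measurable borel" "g \<in> borel_measurable M"
  shows "(\<lambda>x. inv_fourier f (g x)) \<in> borel_measurable M"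
  unfolding inv_fourier_eq_fourier by measurable

lemma integrable_expi_mult:
  assumes "integrable M f" and [measurable]: "h \<in> borel_measurable M"
  shows "integrable M (\<lambda>x. expi (h x) * f x)"
proof (rule Bochner_Integration.integrable_bound[OF assms(1)])
  have [measurable]: "f \<in> borel_measurable M" using assms(1) by auto
  show "(\<lambda>x. expi (h x) * f x) \<in> borel_measurable M" by measurable
qed (simp add: norm_mult)

lemma norm_integral_le:
  fixes f :: "'a \<Rightarrow> complex"
  shows "ennreal (norm (\<integral>x. f x \<partial>M)) \<le> (\<integral>\<^sup>+x. ennreal (norm (f x)) \<partial>M)"
  by (cases "integrable M f") (auto intro: integral_norm_bound_ennreal simp: not_integrable_integral_eq)

lemma norm_fourier_le:
  assumes "integrable lborel f"
  shows "norm (fourier f \<xi>) \<le> (\<integral>x. norm (f x) \<partial>lborel)"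
  unfolding fourier_expi
  by (rule order_trans[OF integral_norm_bound]) (simp add: norm_mult)

lemma integrable_lborel_pair_mult:
  fixes g :: "'a::euclidean_space \<Rightarrow> complex" and f :: "'b::euclidean_space \<Rightarrow> complex"
  assumes g: "integrable lborel g" and f: "integrable lborel f"
    and [measurable]: "(\<lambda>(x, y). h x y) \<in> borel_measurable (borel \<Otimes>\<^sub>M borel)"
  shows "integrable (lborel \<Otimes>\<^sub>M lborel) (\<lambda>(x, y). expi (h x y) * (g x * f y))"
proof -
  have [measurable]: "g \<in> borel_measurable borel" "f \<in> borel_measurable borel"
    using f g by auto
  show ?thesis
  proof (rule lborel_pair.Fubini_integrable)
    show "(\<lambda>(x, y). expi (h x y) * (g x * f y)) \<in> borel_measurable (lborel \<Otimes>\<^sub>M lborel)"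
      by measurable
    show "integrable lborel (\<lambda>x. \<integral>y. norm (case (x, y) of (x, y) \<Rightarrow> expi (h x y) * (g x * f y)) \<partial>lborel)"
      using g by (simp add: norm_mult)
    show "AE x in lborel. integrable lborel (\<lambda>y. case (x, y) of (x, y) \<Rightarrow> expi (h x y) * (g x * f y))"
      using f by (intro AE_I2) (auto intro!: integrable_expi_mult)
  qed
qed

section \<open>Schwartz functions and the decay of their Fourier transforms\<close>

lemma iter_partial_append: "iter_partial (bs @ cs) f = iter_partial bs (iter_partial cs f)"
  by (induction bs) auto

lemma schwartz_partial:
  assumes f: "f \<in> schwartz" and b: "b \<in> Basis"
  shows "(\<lambda>x. frechet_derivative f (at x) b) \<in> schwartz"
proof -
  have eq: "iter_partial bs (\<lambda>x. frechet_derivative f (at x) b) = iter_partial (bs @ [b]) f" for bs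
    by (simp add: iter_partial_append)
  show ?thesis
    unfolding schwartz_def smooth_def mem_Collect_eq eq
  proof (intro conjI allI impI)
    fix bs :: "'a list" and x :: 'a and N :: nat assume "set bs \<subseteq> Basis"
    then have "set (bs @ [b]) \<subseteq> Basis" using b by auto
    then show "iter_partial (bs @ [b]) f differentiable at x"
      and "\<exists>C. \<forall>x. (1 + norm x) ^ N * norm (iter_partial (bs @ [b]) f x) \<le> C"
      using f unfolding schwartz_def smooth_def by blast+
  qed
qed

lemma schwartz_differentiable: "f \<in> schwartz \<Longrightarrow> f differentiable at x"
  unfolding schwartz_def smooth_def mem_Collect_eq
  by (metis empty_subsetI iter_partial.simps(1) list.set(1))

lemma schwartz_continuous: "f \<in> schwartz \<Longrightarrow> continuous_on A f"
  by (meson continuous_at_imp_continuous_on differentiable_imp_continuous_within schwartz_differentiable)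

lemma schwartz_measurable [measurable_dest]: "f \<in> schwartz \<Longrightarrow> f \<in> borel_measurable borel"
  by (intro borel_measurable_continuous_onI schwartz_continuous)

lemma schwartz_decay:
  assumes "f \<in> schwartz"
  obtains C where "0 \<le> C" "\<And>x. (1 + norm x) ^ N * norm (f x) \<le> C"
proof -
  have "\<exists>C. \<forall>x. (1 + norm x) ^ N * norm (iter_partial [] f x) \<le> C"
    using assms unfolding schwartz_def mem_Collect_eq
    by (metis (no_types, opaque_lifting) empty_subsetI list.set(1))
  then obtain C where "\<And>x. (1 + norm x) ^ N * norm (f x) \<le> C" by auto
  then show ?thesis using that[of "max C 0"] by (simp add: le_max_iff_disj)
qed

lemma powr_neg_bound:
  fixes w r C :: real
  assumes "w powr a * r \<le> C" "0 < w"
  shows "r \<le> C * w powr - a"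
proof -
  have "w powr - a * (w powr a * r) \<le> w powr - a * C"
    using assms by (intro mult_left_mono) auto
  moreover have "w powr - a * w powr a = 1"
    using assms(2) by (simp flip: powr_add)
  ultimately show ?thesis by (metis mult.assoc mult.commute mult_1)
qed

lemma schwartz_wt_decay:
  fixes f :: "'a::euclidean_space \<Rightarrow> complex"
  assumes "f \<in> schwartz"
  obtains C where "0 \<le> C" "\<And>x. norm (f x) \<le> C * wt x powr - real N"
proof -
  obtain C where C: "0 \<le> C" "\<And>x. (1 + norm x) ^ (DIM('a) * N) * norm (f x) \<le> C"
    using schwartz_decay[OF assms] by blast
  have "norm (f x) \<le> C * wt x powr - real N" for x
  proof (rule powr_neg_bound)
    have "wt x ^ N \<le> (1 + norm x) ^ (DIM('a) * N)"
      unfolding power_mult by (intro power_mono wt_le_norm) (simp add: less_imp_le)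
    then have "wt x powr real N * norm (f x) \<le> (1 + norm x) ^ (DIM('a) * N) * norm (f x)"
      by (intro mult_right_mono) (auto simp: powr_realpow)
    then show "wt x powr real N * norm (f x) \<le> C" using C(2)[of x] by linarith
  qed simp
  then show ?thesis using that C by blast
qed

lemma integrable_wt_bound:
  fixes f :: "'a::euclidean_space \<Rightarrow> complex"
  assumes "f \<in> borel_measurable borel" "\<And>x. norm (f x) \<le> C * wt x powr - a" "2 \<le> a"
  shows "integrable lborel f"
proof (rule Bochner_Integration.integrable_bound)
  show "integrable lborel (\<lambda>x::'a. C * wt x powr - a)"
    using assms by (intro integrable_mult_right integrable_wt)
  show "AE x in lborel. norm (f x) \<le> norm (C * wt x powr - a)"
    using assms(2) by (intro AE_I2) (metis abs_ge_self order_trans real_norm_def)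
qed (use assms in auto)

lemma schwartz_integrable:
  fixes f :: "'a::euclidean_space \<Rightarrow> complex"
  assumes f: "f \<in> schwartz"
  shows "integrable lborel f"
proof -
  obtain C where C: "\<And>x. norm (f x) \<le> C * wt x powr - real 2"
    using schwartz_wt_decay[OF f, where N=2] by metis
  show ?thesis
    using integrable_wt_bound[of f C 2] C schwartz_measurable[OF f] by simp
qed

text \<open>
  Integration by parts without coordinates: \<open>h(x + b) - h(x)\<close> integrates to 0 by translation
  invariance, and it is the integral of \<open>h'(x + t b)\<close> over \<open>t\<close> in \<open>[0, 1]\<close>, whose integral over \<open>x\<close> is
  \<open>\<integral> h'\<close> for every \<open>t\<close>.
\<close>

lemma integral_directional_derivative_eq_0:
  fixes h h' :: "'a::euclidean_space \<Rightarrow> complex"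
  assumes h: "integrable lborel h" and h': "integrable lborel h'" and cont: "continuous_on UNIV h'"
    and deriv: "\<And>x t. ((\<lambda>t. h (x + t *\<^sub>R b)) has_vector_derivative h' (x + t *\<^sub>R b)) (at t)"
  shows "(\<integral>x. h' x \<partial>lborel) = 0"
proof -
  have [measurable]: "h \<in> borel_measurable borel" "h' \<in> borel_measurable borel"
    using h h' by auto
  let ?F = "\<lambda>x t. indicator {0..1} t *\<^sub>R h' (x + t *\<^sub>R b)"
  have shift: "(\<integral>x. g (x + c) \<partial>lborel) = (\<integral>x. g x \<partial>lborel)" "integrable lborel g \<Longrightarrow> integrable lborel (\<lambda>x. g (x + c))"
    if [measurable]: "g \<in> borel_measurable borel" for g :: "'a \<Rightarrow> complex" and c
    using integral_lborel_affine[of 1 g c] integrable_lborel_affine[of 1 g c] by (simp_all add: add.commute)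
  have shift_norm: "(\<integral>x. norm (h' (x + c)) \<partial>lborel) = (\<integral>x. norm (h' x) \<partial>lborel)" for c
  proof -
    have "complex_of_real (\<integral>x. norm (h' (x + c)) \<partial>lborel) = complex_of_real (\<integral>x. norm (h' x) \<partial>lborel)"
      using shift(1)[of "\<lambda>x. complex_of_real (norm (h' x))" c] by simp
    then show ?thesis by (simp only: of_real_eq_iff)
  qed
  have int: "integrable (lborel \<Otimes>\<^sub>M lborel) (\<lambda>(t, x). ?F x t)"
  proof (rule lborel_pair.Fubini_integrable)
    show "integrable lborel (\<lambda>t. \<integral>x. norm (case (t, x) of (t, x) \<Rightarrow> ?F x t) \<partial>lborel)"
      by (simp add: shift_norm)
    show "AE t in lborel. integrable lborel (\<lambda>x. case (t, x) of (t, x) \<Rightarrow> ?F x t)"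
      using h' by (intro AE_I2) (auto intro!: integrable_scaleR_right shift)
  qed measurable
  have "(\<integral>t. \<integral>x. ?F x t \<partial>lborel \<partial>lborel) = (\<integral>x. \<integral>t. ?F x t \<partial>lborel \<partial>lborel)"
    using lborel_pair.Fubini_integral[OF int] by simp
  also have "\<dots> = (\<integral>x. h (x + b) - h x \<partial>lborel)"
  proof (intro Bochner_Integration.integral_cong refl)
    fix x
    have "(\<integral>t. indicator {0..1} t *\<^sub>R h' (x + t *\<^sub>R b) \<partial>lborel) = h (x + 1 *\<^sub>R b) - h (x + 0 *\<^sub>R b)"
      by (rule integral_FTC_Icc)
        (auto intro!: has_vector_derivative_at_within[OF deriv] continuous_on_compose2[OF cont] continuous_intros)
    then show "(\<integral>t. ?F x t \<partial>lborel) = h (x + b) - h x" by simp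
  qed
  also have "\<dots> = 0"
    using h shift[of h b] by simp
  also have "(\<integral>t. \<integral>x. ?F x t \<partial>lborel \<partial>lborel) = (\<integral>t. indicator {0..1} t *\<^sub>R (\<integral>x. h' x \<partial>lborel) \<partial>(lborel :: real measure))"
    by (simp add: shift)
  also have "\<dots> = (\<integral>x. h' x \<partial>lborel)"
    by (subst integral_scaleR_left) auto
  finally show ?thesis .
qed

lemma has_vector_derivative_expi:
  "((\<lambda>t. expi (c + t * d)) has_vector_derivative (2 * pi * \<i> * d) * expi (c + t * d)) (at t)"
proof -
  have "((\<lambda>z. exp (\<i> * (2 * pi * (c + z * d)))) has_field_derivative
      2 * pi * \<i> * d * exp (\<i> * (2 * pi * (c + of_real t * d)))) (at (of_real t))"
    by (auto intro!: derivative_eq_intros)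
  from has_vector_derivative_real_field[OF this] show ?thesis
    by (simp add: expi_def cis_conv_exp)
qed

lemma fourier_partial:
  fixes f :: "'a::euclidean_space \<Rightarrow> complex"
  assumes f: "f \<in> schwartz" and b: "b \<in> Basis"
  shows "fourier (\<lambda>x. frechet_derivative f (at x) b) \<xi> = 2 * pi * \<i> * (\<xi> \<bullet> b) * fourier f \<xi>"
proof -
  define f' where "f' = (\<lambda>x. frechet_derivative f (at x) b)"
  define c :: complex where "c = 2 * pi * \<i> * (\<xi> \<bullet> b)"
  have f': "f' \<in> schwartz" unfolding f'_def by (rule schwartz_partial[OF f b])
  let ?h = "\<lambda>x. expi (- (x \<bullet> \<xi>)) * f x" and ?h' = "\<lambda>x. expi (- (x \<bullet> \<xi>)) * f' x - c * (expi (- (x \<bullet> \<xi>)) * f x)"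
  have int: "integrable lborel (\<lambda>x. expi (- (x \<bullet> \<xi>)) * g x)" if "g \<in> schwartz" for g
    using that by (intro integrable_expi_mult schwartz_integrable) auto
  have "(\<integral>x. ?h' x \<partial>lborel) = 0"
  proof (rule integral_directional_derivative_eq_0)
    show "continuous_on UNIV ?h'"
      using schwartz_continuous[OF f] schwartz_continuous[OF f'] by (intro continuous_intros)
    fix x t
    have "(f has_derivative frechet_derivative f (at (x + t *\<^sub>R b))) (at (x + t *\<^sub>R b))"
      using schwartz_differentiable[OF f] frechet_derivative_works by blast
    moreover have "((\<lambda>t. x + t *\<^sub>R b) has_derivative (\<lambda>t. t *\<^sub>R b)) (at t)"
      by (auto intro!: derivative_eq_intros)
    ultimately have "((\<lambda>t. f (x + t *\<^sub>R b)) has_derivative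
        (\<lambda>s. frechet_derivative f (at (x + t *\<^sub>R b)) (s *\<^sub>R b))) (at t)"
      using has_derivative_compose[of "\<lambda>t. x + t *\<^sub>R b" "\<lambda>t. t *\<^sub>R b" t UNIV f "frechet_derivative f (at (x + t *\<^sub>R b))"]
      by (simp add: o_def)
    moreover have "linear (frechet_derivative f (at (x + t *\<^sub>R b)))"
      by (simp add: linear_frechet_derivative schwartz_differentiable[OF f])
    ultimately have 1: "((\<lambda>t. f (x + t *\<^sub>R b)) has_vector_derivative f' (x + t *\<^sub>R b)) (at t)"
      by (simp add: has_vector_derivative_def f'_def linear_cmul)
    have 2: "((\<lambda>t. expi (- ((x + t *\<^sub>R b) \<bullet> \<xi>))) has_vector_derivative - c * expi (- ((x + t *\<^sub>R b) \<bullet> \<xi>))) (at t)"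
      using has_vector_derivative_expi[of "- (x \<bullet> \<xi>)" "- (b \<bullet> \<xi>)" t]
      by (simp add: inner_add_left c_def inner_commute[of \<xi> b])
    show "((\<lambda>t. ?h (x + t *\<^sub>R b)) has_vector_derivative ?h' (x + t *\<^sub>R b)) (at t)"
      by (rule has_vector_derivative_eq_rhs[OF has_vector_derivative_mult[OF 2 1]]) (simp add: algebra_simps)
  qed (intro Bochner_Integration.integrable_diff integrable_mult_right int f f')+
  then show ?thesis
    using int[OF f] int[OF f'] by (simp add: fourier_expi f'_def c_def)
qed

text \<open>
  Each factor \<open>1 + |\<xi> \<bullet> b|\<close> is absorbed by one derivative in direction \<open>b\<close>.  The outer
  induction raises the power of the weight, the inner one runs through the factors of one weight.
\<close>

lemma fourier_schwartz_decay:
  fixes f :: "'a::euclidean_space \<Rightarrow> complex"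
  assumes "f \<in> schwartz"
  shows "\<exists>C\<ge>0. \<forall>\<xi>. wt \<xi> ^ N * norm (fourier f \<xi>) \<le> C"
  using assms
proof (induction N arbitrary: f)
  case 0
  have "0 \<le> (\<integral>x. norm (f x) \<partial>lborel)" by simp
  then show ?case
    using norm_fourier_le[OF schwartz_integrable[OF 0]]
    by (intro exI[of _ "\<integral>x. norm (f x) \<partial>lborel"]) auto
next
  case (Suc N)
  have "\<exists>C\<ge>0. \<forall>\<xi>. (\<Prod>b\<in>S. 1 + \<bar>\<xi> \<bullet> b\<bar>) * (wt \<xi> ^ N * norm (fourier g \<xi>)) \<le> C"
    if "finite S" "S \<subseteq> Basis" "g \<in> schwartz" for S and g :: "'a \<Rightarrow> complex"
    using that
  proof (induction S arbitrary: g rule: finite_induct)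
    case empty
    then show ?case using Suc.IH by simp
  next
    case (insert b S)
    let ?P = "\<lambda>\<xi>. \<Prod>b\<in>S. 1 + \<bar>\<xi> \<bullet> b\<bar>" and ?g' = "\<lambda>x. frechet_derivative g (at x) b"
    have b: "b \<in> Basis" using insert.prems by auto
    obtain C where C: "0 \<le> C" "\<And>\<xi>. ?P \<xi> * (wt \<xi> ^ N * norm (fourier g \<xi>)) \<le> C"
      using insert.IH[of g] insert.prems by auto
    obtain C' where C': "0 \<le> C'" "\<And>\<xi>. ?P \<xi> * (wt \<xi> ^ N * norm (fourier ?g' \<xi>)) \<le> C'"
      using insert.IH[of ?g'] insert.prems schwartz_partial[of g b] by auto
    have "(\<Prod>b\<in>insert b S. 1 + \<bar>\<xi> \<bullet> b\<bar>) * (wt \<xi> ^ N * norm (fourier g \<xi>)) \<le> C + C'" for \<xi>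
    proof -
      have "\<bar>\<xi> \<bullet> b\<bar> * norm (fourier g \<xi>) \<le> (2 * pi * \<bar>\<xi> \<bullet> b\<bar>) * norm (fourier g \<xi>)"
        using pi_gt3 by (intro mult_right_mono) (auto simp: mult_le_cancel_right1)
      also have "\<dots> = norm (fourier ?g' \<xi>)"
        using insert.prems b by (simp add: fourier_partial norm_mult)
      finally have "?P \<xi> * (wt \<xi> ^ N * (\<bar>\<xi> \<bullet> b\<bar> * norm (fourier g \<xi>))) \<le> C'"
        using C'(2)[of \<xi>] by (smt (verit) mult_left_mono prod_nonneg wt_pos zero_less_power abs_ge_zero)
      then show ?thesis
        using C(2)[of \<xi>] insert.hyps by (simp add: algebra_simps)
    qed
    then show ?case using C C' by (intro exI[of _ "C + C'"]) auto
  qed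
  from this[of Basis f] Suc.prems show ?case
    by (simp add: wt_def mult.assoc)
qed

lemma fourier_schwartz_integrable:
  fixes f :: "'a::euclidean_space \<Rightarrow> complex"
  assumes f: "f \<in> schwartz"
  shows "integrable lborel (fourier f)"
proof -
  note [measurable] = schwartz_measurable[OF f]
  obtain C where C: "\<And>\<xi>. wt \<xi> ^ 2 * norm (fourier f \<xi>) \<le> C"
    using fourier_schwartz_decay[OF f, of 2] by blast
  have "norm (fourier f \<xi>) \<le> C * wt \<xi> powr - 2" for \<xi>
    using C[of \<xi>] by (intro powr_neg_bound) (auto simp: powr_numeral less_imp_le)
  then show ?thesis by (intro integrable_wt_bound[of _ C 2]) auto
qed

section \<open>Fourier inversion\<close>

definition gauss :: "'a::euclidean_space \<Rightarrow> complex" where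
  "gauss x = of_real (exp (- pi * (x \<bullet> x)))"

lemma gauss_tensor: "gauss x = (\<Prod>b\<in>Basis. of_real (exp (- pi * (x \<bullet> b)\<^sup>2)))"
  unfolding gauss_def of_real_prod[symmetric] exp_sum[OF finite_Basis, symmetric]
  by (subst euclidean_inner) (simp add: power2_eq_square sum_distrib_left)

lemma gauss_0 [simp]: "gauss 0 = 1"
  by (simp add: gauss_def)

lemma gauss_minus [simp]: "gauss (- x) = gauss x"
  by (simp add: gauss_def)

lemma norm_gauss_le_1: "norm (gauss x) \<le> 1"
  by (simp add: gauss_def)

lemma continuous_on_gauss [continuous_intros]:
  "continuous_on A f \<Longrightarrow> continuous_on A (\<lambda>x. gauss (f x))"
  unfolding gauss_def by (intro continuous_intros)

lemma measurable_gauss [measurable (raw)]: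
  assumes [measurable]: "f \<in> borel_measurable M"
  shows "(\<lambda>x. gauss (f x)) \<in> borel_measurable M"
  unfolding gauss_def by measurable

lemma
  fixes v :: real
  shows integrable_gauss_1d: "integrable lborel (\<lambda>t::real. complex_of_real (exp (- pi * t\<^sup>2)))"
    and integral_gauss_1d: "(\<integral>t. expi (t * v) * complex_of_real (exp (- pi * t\<^sup>2)) \<partial>lborel) = of_real (exp (- pi * v\<^sup>2))"
proof -
  \<comment> \<open>Rescaling by this constant turns \<open>exp (- x\<^sup>2 / 2)\<close> into \<open>exp (- \<pi> t\<^sup>2)\<close>.\<close>
  let ?c = "sqrt (2 * pi)"
  have c: "?c \<noteq> 0" "0 < ?c" by auto
  have dens: "std_normal_density (0 + ?c * t) = exp (- pi * t\<^sup>2) / ?c" for t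
    by (simp add: std_normal_density_def power_mult_distrib)
  have "integrable lborel (\<lambda>t. std_normal_density (0 + ?c * t))"
    using c by (intro lborel_integrable_real_affine) auto
  then have "integrable lborel (\<lambda>t. ?c * (exp (- pi * t\<^sup>2) / ?c))"
    unfolding dens by (rule integrable_mult_right)
  then have "integrable lborel (\<lambda>t. exp (- pi * t\<^sup>2))" using c by simp
  then show "integrable lborel (\<lambda>t::real. complex_of_real (exp (- pi * t\<^sup>2)))"
    by (rule integrable_of_real)
  have "of_real (exp (- pi * v\<^sup>2)) = char std_normal_distribution (?c * v)"
    by (simp add: char_std_normal_distribution power_mult_distrib)
  also have "\<dots> = (\<integral>x. std_normal_density x *\<^sub>R iexp (?c * v * x) \<partial>lborel)"
    unfolding char_def by (subst integral_density) auto
  also have "\<dots> = \<bar>?c\<bar> *\<^sub>R (\<integral>t. std_normal_density (0 + ?c * t) *\<^sub>R iexp (?c * v * (0 + ?c * t)) \<partial>lborel)"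
    by (rule lborel_integral_real_affine[OF c(1)])
  also have "\<dots> = (\<integral>t. ?c *\<^sub>R (std_normal_density (0 + ?c * t) *\<^sub>R iexp (?c * v * (0 + ?c * t))) \<partial>lborel)"
    using c by (simp del: integral_scaleR_right add: integral_scaleR_right[symmetric])
  also have "\<dots> = (\<integral>t. expi (t * v) * complex_of_real (exp (- pi * t\<^sup>2)) \<partial>lborel)"
  proof (intro Bochner_Integration.integral_cong refl)
    fix t :: real
    have "?c * v * (0 + ?c * t) = 2 * pi * (t * v)"
      using real_sqrt_mult_self[of "2 * pi"] by (simp add: algebra_simps)
    then have "iexp (?c * v * (0 + ?c * t)) = expi (t * v)"
      by (simp only: expi_def cis_conv_exp)
    then show "?c *\<^sub>R (std_normal_density (0 + ?c * t) *\<^sub>R iexp (?c * v * (0 + ?c * t))) =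
        expi (t * v) * complex_of_real (exp (- pi * t\<^sup>2))"
      unfolding dens using c by (simp add: scaleR_conv_of_real)
  qed
  finally show "(\<integral>t. expi (t * v) * complex_of_real (exp (- pi * t\<^sup>2)) \<partial>lborel) = of_real (exp (- pi * v\<^sup>2))" ..
qed

lemma integrable_gauss: "integrable lborel (gauss :: 'a::euclidean_space \<Rightarrow> complex)"
  unfolding gauss_tensor[abs_def] by (intro integrable_lborel_tensor integrable_gauss_1d)

lemma expi_inner: "expi (x \<bullet> v) = (\<Prod>b\<in>Basis. expi ((x \<bullet> b) * (v \<bullet> b)))"
  by (subst euclidean_inner) (simp add: expi_sum)

text \<open>
  The Gaussian is its own Fourier transform; as it is a tensor product, this reduces to the
  characteristic function of the standard normal distribution.
\<close>

lemma integral_gauss: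
  fixes v :: "'a::euclidean_space"
  shows "(\<integral>x. expi (x \<bullet> v) * gauss x \<partial>lborel) = gauss v"
  unfolding expi_inner gauss_tensor prod.distrib[symmetric]
  by (subst integral_lborel_tensor)
    (intro integrable_expi_mult integrable_gauss_1d, measurable, simp only: integral_gauss_1d)

text \<open>
  The inversion integral with a Gaussian cut-off at scale \<open>1/e\<close> is the average of \<open>f\<close> near \<open>x\<close>
  at scale \<open>e\<close>.
\<close>

lemma gauss_mean_fourier:
  fixes f :: "'a::euclidean_space \<Rightarrow> complex"
  assumes f: "integrable lborel f" and e: "0 < e"
  shows "(\<integral>\<xi>. expi (x \<bullet> \<xi>) * (gauss (e *\<^sub>R \<xi>) * fourier f \<xi>) \<partial>lborel) = (\<integral>v. f (x + e *\<^sub>R v) * gauss v \<partial>lborel)"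
proof -
  have [measurable]: "f \<in> borel_measurable borel" using f by auto
  have ge: "integrable lborel (\<lambda>\<xi>::'a. gauss (e *\<^sub>R \<xi>))"
    using integrable_lborel_affine[OF _ integrable_gauss, of e 0] e by simp
  have int: "integrable (lborel \<Otimes>\<^sub>M lborel) (\<lambda>(\<xi>, y). expi ((x - y) \<bullet> \<xi>) * (gauss (e *\<^sub>R \<xi>) * f y))"
    by (intro integrable_lborel_pair_mult ge f) measurable
  have inner: "(\<integral>\<xi>. expi ((x - y) \<bullet> \<xi>) * (gauss (e *\<^sub>R \<xi>) * f y) \<partial>lborel)
      = of_real (inverse e ^ DIM('a)) * (f y * gauss (inverse e *\<^sub>R (x - y)))" for y
  proof -
    have "(\<integral>\<xi>. expi ((x - y) \<bullet> \<xi>) * (gauss (e *\<^sub>R \<xi>) * f y) \<partial>lborel)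
        = of_real (inverse e ^ DIM('a)) * (\<integral>\<zeta>. expi (\<zeta> \<bullet> (inverse e *\<^sub>R (x - y))) * gauss \<zeta> * f y \<partial>lborel)"
      using e by (subst integral_lborel_affine[of "inverse e" _ 0]) (auto simp: inner_commute mult_ac)
    also have "(\<integral>\<zeta>. expi (\<zeta> \<bullet> (inverse e *\<^sub>R (x - y))) * gauss \<zeta> * f y \<partial>lborel)
        = gauss (inverse e *\<^sub>R (x - y)) * f y"
      unfolding integral_mult_left_zero by (simp only: integral_gauss)
    finally show ?thesis by (simp add: mult_ac)
  qed
  have "(\<integral>\<xi>. expi (x \<bullet> \<xi>) * (gauss (e *\<^sub>R \<xi>) * fourier f \<xi>) \<partial>lborel) =
      (\<integral>\<xi>. \<integral>y. expi ((x - y) \<bullet> \<xi>) * (gauss (e *\<^sub>R \<xi>) * f y) \<partial>lborel \<partial>lborel)"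
    unfolding fourier_expi
    by (simp add: inner_diff_left expi_diff mult_ac flip: integral_mult_right_zero)
  also have "\<dots> = (\<integral>y. \<integral>\<xi>. expi ((x - y) \<bullet> \<xi>) * (gauss (e *\<^sub>R \<xi>) * f y) \<partial>lborel \<partial>lborel)"
    using lborel_pair.Fubini_integral[OF int] by simp
  also have "\<dots> = (\<integral>y. of_real (inverse e ^ DIM('a)) * (f y * gauss (inverse e *\<^sub>R (x - y))) \<partial>lborel)"
    unfolding inner ..
  also have "\<dots> = of_real (e ^ DIM('a)) *
      (\<integral>v. of_real (inverse e ^ DIM('a)) * (f (x + e *\<^sub>R v) * gauss (inverse e *\<^sub>R (x - (x + e *\<^sub>R v)))) \<partial>lborel)"
    using e by (subst integral_lborel_affine[of e _ x]) auto
  also have "\<dots> = (\<integral>v. f (x + e *\<^sub>R v) * gauss v \<partial>lborel)"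
    using e by (simp only: integral_mult_right_zero) (simp flip: mult.assoc of_real_mult power_mult_distrib)
  finally show ?thesis .
qed

text \<open>
  Let the scale tend to 0 in the previous identity: dominated convergence applies on the frequency
  side because the transform is integrable, and on the space side because \<open>f\<close> is bounded and
  continuous.
\<close>

theorem fourier_inversion_schwartz:
  fixes f :: "'a::euclidean_space \<Rightarrow> complex"
  assumes f: "f \<in> schwartz"
  shows "inv_fourier (fourier f) x = f x"
proof -
  note int = schwartz_integrable[OF f] and int' = fourier_schwartz_integrable[OF f]
  have [measurable]: "f \<in> borel_measurable borel" using schwartz_measurable[OF f] .
  obtain C where C: "\<And>x. norm (f x) \<le> C"
    using schwartz_decay[OF f, where N=0] by auto
  define e :: "nat \<Rightarrow> real" where "e = (\<lambda>n. inverse (real (Suc n)))"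
  have e0: "0 < e n" for n by (simp add: e_def)
  have e: "e \<longlonglongrightarrow> 0" unfolding e_def by (rule LIMSEQ_inverse_real_of_nat)
  have "(\<lambda>n. \<integral>\<xi>. expi (x \<bullet> \<xi>) * (gauss (e n *\<^sub>R \<xi>) * fourier f \<xi>) \<partial>lborel)
      \<longlonglongrightarrow> (\<integral>\<xi>. expi (x \<bullet> \<xi>) * fourier f \<xi> \<partial>lborel)"
  proof (rule integral_dominated_convergence)
    show "integrable lborel (\<lambda>\<xi>. norm (fourier f \<xi>))" using int' by simp
    show "AE \<xi> in lborel. (\<lambda>n. expi (x \<bullet> \<xi>) * (gauss (e n *\<^sub>R \<xi>) * fourier f \<xi>)) \<longlonglongrightarrow> expi (x \<bullet> \<xi>) * fourier f \<xi>"
    proof (intro AE_I2)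
      fix \<xi> :: 'a
      have "(\<lambda>n. gauss (e n *\<^sub>R \<xi>)) \<longlonglongrightarrow> gauss (0 *\<^sub>R \<xi>)"
        unfolding gauss_def by (intro tendsto_intros e)
      then have "(\<lambda>n. expi (x \<bullet> \<xi>) * (gauss (e n *\<^sub>R \<xi>) * fourier f \<xi>)) \<longlonglongrightarrow> expi (x \<bullet> \<xi>) * (gauss (0 *\<^sub>R \<xi>) * fourier f \<xi>)"
        by (intro tendsto_intros)
      then show "(\<lambda>n. expi (x \<bullet> \<xi>) * (gauss (e n *\<^sub>R \<xi>) * fourier f \<xi>)) \<longlonglongrightarrow> expi (x \<bullet> \<xi>) * fourier f \<xi>"
        by simp
    qed
    show "AE \<xi> in lborel. norm (expi (x \<bullet> \<xi>) * (gauss (e n *\<^sub>R \<xi>) * fourier f \<xi>)) \<le> norm (fourier f \<xi>)" for n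
      by (intro AE_I2) (auto simp: norm_mult intro: mult_left_le_one_le norm_gauss_le_1)
  qed measurable
  moreover have "(\<lambda>n. \<integral>v. f (x + e n *\<^sub>R v) * gauss v \<partial>lborel) \<longlonglongrightarrow> (\<integral>v. f x * gauss (v::'a) \<partial>lborel)"
  proof (rule integral_dominated_convergence)
    show "integrable lborel (\<lambda>v::'a. C * norm (gauss v))"
      by (intro integrable_mult_right integrable_norm integrable_gauss)
    show "AE v in lborel. (\<lambda>n. f (x + e n *\<^sub>R v) * gauss v) \<longlonglongrightarrow> f x * gauss v"
    proof (intro AE_I2)
      fix v :: 'a
      have "(\<lambda>n. x + e n *\<^sub>R v) \<longlonglongrightarrow> x + 0 *\<^sub>R v"
        by (intro tendsto_intros e)
      moreover have "isCont f x"
        using schwartz_differentiable[OF f] differentiable_imp_continuous_within by blast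
      ultimately have "(\<lambda>n. f (x + e n *\<^sub>R v)) \<longlonglongrightarrow> f x"
        by (auto intro: isCont_tendsto_compose)
      then show "(\<lambda>n. f (x + e n *\<^sub>R v) * gauss v) \<longlonglongrightarrow> f x * gauss v"
        by (intro tendsto_intros)
    qed
    show "AE v in lborel. norm (f (x + e n *\<^sub>R v) * gauss v) \<le> C * norm (gauss v)" for n
      by (intro AE_I2) (auto simp: norm_mult intro: mult_right_mono C)
  qed measurable
  ultimately have "(\<integral>\<xi>. expi (x \<bullet> \<xi>) * fourier f \<xi> \<partial>lborel) = (\<integral>v. f x * gauss (v::'a) \<partial>lborel)"
    using gauss_mean_fourier[OF int e0] by (simp add: LIMSEQ_unique)
  also have "\<dots> = f x"
    using integral_gauss[of "0::'a"] by simp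
  finally show ?thesis by (simp add: inv_fourier_expi)
qed

section \<open>One-dimensional test functions\<close>

text \<open>
  \<open>n\<close>-fold differentiability, in a form whose closure under products and quotients is a plain
  induction.  For functions on the line, \<open>smooth\<close> amounts to \<open>Ck n\<close> for all \<open>n\<close>.
\<close>

primrec Ck :: "nat \<Rightarrow> (real \<Rightarrow> 'b::real_normed_vector) \<Rightarrow> bool" where
  "Ck 0 f \<longleftrightarrow> True"
| "Ck (Suc n) f \<longleftrightarrow> (\<exists>f'. (\<forall>x. (f has_vector_derivative f' x) (at x)) \<and> Ck n f')"

lemma Ck_SucI: "(\<And>x. (f has_vector_derivative f' x) (at x)) \<Longrightarrow> Ck n f' \<Longrightarrow> Ck (Suc n) f"
  by auto

lemma Ck_Suc_obtain: "Ck (Suc n) f \<Longrightarrow> \<exists>f'. (\<forall>x. (f has_vector_derivative f' x) (at x)) \<and> Ck n f'"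
  by simp

lemma Ck_Suc_imp: "Ck (Suc n) f \<Longrightarrow> Ck n f"
proof (induction n arbitrary: f)
  case (Suc n)
  from Ck_Suc_obtain[OF Suc.prems]
  obtain f' where f': "(\<forall>x. (f has_vector_derivative f' x) (at x)) \<and> Ck (Suc n) f'" ..
  then have "Ck n f'" by (intro Suc.IH) (rule conjunct2)
  then show ?case using f' by (intro Ck_SucI[where f' = f']) (rule spec[OF conjunct1], assumption+)
qed simp

lemma Ck_const: "Ck n (\<lambda>_. c)"
proof (induction n arbitrary: c)
  case (Suc n)
  then show ?case by (intro Ck_SucI[where f' = "\<lambda>_. 0"]) simp_all
qed simp

lemma Ck_add: "Ck n f \<Longrightarrow> Ck n g \<Longrightarrow> Ck n (\<lambda>x. f x + g x)"
proof (induction n arbitrary: f g)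
  case (Suc n)
  from Ck_Suc_obtain[OF Suc.prems(1)] obtain f' where "(\<forall>x. (f has_vector_derivative f' x) (at x)) \<and> Ck n f'" ..
  then have f': "\<And>x. (f has_vector_derivative f' x) (at x)" "Ck n f'" by simp_all
  from Ck_Suc_obtain[OF Suc.prems(2)] obtain g' where "(\<forall>x. (g has_vector_derivative g' x) (at x)) \<and> Ck n g'" ..
  then have g': "\<And>x. (g has_vector_derivative g' x) (at x)" "Ck n g'" by simp_all
  show ?case
    by (rule Ck_SucI[OF has_vector_derivative_add[OF f'(1) g'(1)] Suc.IH[OF f'(2) g'(2)]])
qed simp

lemma Ck_mult:
  fixes f g :: "real \<Rightarrow> real"
  shows "Ck n f \<Longrightarrow> Ck n g \<Longrightarrow> Ck n (\<lambda>x. f x * g x)"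
proof (induction n arbitrary: f g)
  case (Suc n)
  note fg = Ck_Suc_imp[OF Suc.prems(1)] Ck_Suc_imp[OF Suc.prems(2)]
  from Ck_Suc_obtain[OF Suc.prems(1)] obtain f' where "(\<forall>x. (f has_vector_derivative f' x) (at x)) \<and> Ck n f'" ..
  then have f': "\<And>x. (f has_vector_derivative f' x) (at x)" "Ck n f'" by simp_all
  from Ck_Suc_obtain[OF Suc.prems(2)] obtain g' where "(\<forall>x. (g has_vector_derivative g' x) (at x)) \<and> Ck n g'" ..
  then have g': "\<And>x. (g has_vector_derivative g' x) (at x)" "Ck n g'" by simp_all
  show ?case
  proof (rule Ck_SucI)
    show "((\<lambda>x. f x * g x) has_vector_derivative f x * g' x + f' x * g x) (at x)" for x
      by (rule has_vector_derivative_mult[OF f'(1) g'(1)])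
    show "Ck n (\<lambda>x. f x * g' x + f' x * g x)"
      by (rule Ck_add[OF Suc.IH[OF fg(1) g'(2)] Suc.IH[OF f'(2) fg(2)]])
  qed
qed simp

lemma Ck_inverse:
  fixes f :: "real \<Rightarrow> real"
  assumes "\<And>x. f x \<noteq> 0"
  shows "Ck n f \<Longrightarrow> Ck n (\<lambda>x. inverse (f x))"
proof (induction n)
  case (Suc n)
  note f = Ck_Suc_imp[OF Suc.prems]
  from Ck_Suc_obtain[OF Suc.prems] obtain f' where "(\<forall>x. (f has_vector_derivative f' x) (at x)) \<and> Ck n f'" ..
  then have f': "\<And>x. (f has_vector_derivative f' x) (at x)" "Ck n f'" by simp_all
  have "((\<lambda>x. inverse (f x)) has_vector_derivative (- 1) * (f' x * (inverse (f x) * inverse (f x)))) (at x)" for x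
    using DERIV_inverse'[of f "f' x" x UNIV] f'(1)[of x] assms[of x]
    by (simp add: has_real_derivative_iff_has_vector_derivative mult_ac)
  moreover have "Ck n (\<lambda>x. (- 1) * (f' x * (inverse (f x) * inverse (f x))))"
    by (rule Ck_mult[OF Ck_const Ck_mult[OF f'(2) Ck_mult[OF Suc.IH[OF f] Suc.IH[OF f]]]])
  ultimately show ?case
    by (rule Ck_SucI[where f = "\<lambda>x. inverse (f x)"])
qed simp

lemma Ck_affine:
  fixes f :: "real \<Rightarrow> real"
  shows "Ck n f \<Longrightarrow> Ck n (\<lambda>x. f (a * x + b))"
proof (induction n arbitrary: f)
  case (Suc n)
  from Ck_Suc_obtain[OF Suc.prems] obtain f' where "(\<forall>x. (f has_vector_derivative f' x) (at x)) \<and> Ck n f'" ..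
  then have f': "\<And>x. (f has_vector_derivative f' x) (at x)" "Ck n f'" by simp_all
  have "((\<lambda>x. f (a * x + b)) has_vector_derivative a * f' (a * x + b)) (at x)" for x
  proof -
    have "((\<lambda>x. a * x + b) has_real_derivative a) (at x)" by (auto intro!: derivative_eq_intros)
    moreover have "(f has_real_derivative f' (a * x + b)) (at (a * x + b))"
      using f'(1) by (simp add: has_real_derivative_iff_has_vector_derivative)
    ultimately have "((\<lambda>x. f (a * x + b)) has_real_derivative f' (a * x + b) * a) (at x)"
      by (rule DERIV_chain2[rotated])
    then show ?thesis
      unfolding has_real_derivative_iff_has_vector_derivative by (simp only: mult.commute[of a])
  qed
  moreover have "Ck n (\<lambda>x. a * f' (a * x + b))"
    by (rule Ck_mult[OF Ck_const Suc.IH[OF f'(2)]])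
  ultimately show ?case
    by (rule Ck_SucI[where f = "\<lambda>x. f (a * x + b)"])
qed simp

lemma Ck_of_real: "Ck n f \<Longrightarrow> Ck n (\<lambda>x. complex_of_real (f x))"
proof (induction n arbitrary: f)
  case (Suc n)
  from Ck_Suc_obtain[OF Suc.prems] obtain f' where "(\<forall>x. (f has_vector_derivative f' x) (at x)) \<and> Ck n f'" ..
  then have f': "\<And>x. (f has_vector_derivative f' x) (at x)" "Ck n f'" by simp_all
  then show ?case
    by (intro Ck_SucI[where f' = "\<lambda>x. complex_of_real (f' x)"] has_vector_derivative_of_real Suc.IH)
       (simp add: has_real_derivative_iff_has_vector_derivative)
qed simp

lemma has_vector_derivative_frechet:
  fixes f :: "real \<Rightarrow> 'b::real_normed_vector"
  assumes "f differentiable at x"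
  shows "(f has_vector_derivative frechet_derivative f (at x) 1) (at x)"
proof -
  have "(f has_derivative frechet_derivative f (at x)) (at x)"
    using assms frechet_derivative_works by blast
  moreover have "frechet_derivative f (at x) t = t *\<^sub>R frechet_derivative f (at x) 1" for t
    using linear_cmul[OF linear_frechet_derivative[OF assms], of t 1] by simp
  ultimately show ?thesis
    unfolding has_vector_derivative_def by (metis (no_types, lifting) has_derivative_transform UNIV_I ext)
qed

lemma frechet_derivative_real_eq:
  fixes f :: "real \<Rightarrow> 'b::real_normed_vector"
  assumes "(f has_vector_derivative d) (at x)"
  shows "frechet_derivative f (at x) 1 = d"
  using frechet_derivative_at[OF assms[unfolded has_vector_derivative_def]] by (metis scaleR_one)

lemma smooth_imp_Ck:
  fixes f :: "real \<Rightarrow> 'b::real_normed_vector"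
  shows "smooth f \<Longrightarrow> Ck n f"
proof (induction n arbitrary: f)
  case (Suc n)
  have diff: "iter_partial (bs @ replicate k 1) f differentiable at x" if "set bs \<subseteq> Basis" for bs k x
    using Suc.prems that unfolding smooth_def by (simp add: set_replicate_conv_if)
  have "smooth (\<lambda>x. frechet_derivative f (at x) 1)"
    using diff[where k=1] unfolding smooth_def by (simp add: iter_partial_append)
  moreover have "f differentiable at x" for x
    using diff[of "[]" 0 x] by simp
  ultimately show ?case
    by (intro Ck_SucI[where f' = "\<lambda>x. frechet_derivative f (at x) 1"] has_vector_derivative_frechet Suc.IH)
qed simp

lemma Ck_iter_partial:
  assumes "\<And>n. Ck n f" "set bs \<subseteq> (Basis :: real set)"
  shows "Ck n (iter_partial bs f)"
  using assms(2)
proof (induction bs arbitrary: n)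
  case Nil
  then show ?case using assms(1) by simp
next
  case (Cons b bs)
  then have "Ck (Suc n) (iter_partial bs f)" and b: "b = 1" by auto
  obtain g' where g': "\<And>x. (iter_partial bs f has_vector_derivative g' x) (at x)" "Ck n g'"
    using Ck_Suc_obtain[OF \<open>Ck (Suc n) (iter_partial bs f)\<close>] by blast
  then have "iter_partial (b # bs) f = g'"
    by (auto simp: b frechet_derivative_real_eq)
  then show ?case using g' by simp
qed

lemma Ck_imp_differentiable: "Ck (Suc n) f \<Longrightarrow> f differentiable at x"
  by (drule Ck_Suc_obtain) (elim exE conjE, rule differentiableI_vector, erule spec)

definition test_fun :: "(real \<Rightarrow> real) \<Rightarrow> bool" where
  "test_fun h \<longleftrightarrow> (\<forall>n. Ck n h) \<and> (\<exists>R. \<forall>t. R < \<bar>t\<bar> \<longrightarrow> h t = 0)"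

lemma test_fun_shift:
  assumes "test_fun h"
  shows "test_fun (\<lambda>t. h (t - c))"
proof -
  obtain R where R: "\<And>t. R < \<bar>t\<bar> \<Longrightarrow> h t = 0" using assms by (auto simp: test_fun_def)
  have "Ck n (\<lambda>t. h (1 * t + - c))" for n
    using assms by (intro Ck_affine) (simp add: test_fun_def)
  moreover have "h (t - c) = 0" if "R + \<bar>c\<bar> < \<bar>t\<bar>" for t
    using that by (intro R) linarith
  ultimately show ?thesis unfolding test_fun_def by auto
qed

lemma test_fun_schwartz:
  assumes "test_fun h"
  shows "(\<lambda>t. complex_of_real (h t)) \<in> schwartz"
proof -
  let ?g = "\<lambda>t. complex_of_real (h t)"
  obtain R where R: "\<And>t. R < \<bar>t\<bar> \<Longrightarrow> h t = 0" using assms by (auto simp: test_fun_def)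
  have Ck: "Ck n (iter_partial bs ?g)" if "set bs \<subseteq> Basis" for bs n
    using assms that by (intro Ck_iter_partial Ck_of_real) (auto simp: test_fun_def)
  have diff: "iter_partial bs ?g differentiable at x" if "set bs \<subseteq> Basis" for bs x
    using Ck[OF that] by (rule Ck_imp_differentiable)
  have vanish: "iter_partial bs ?g t = 0" if "set bs \<subseteq> Basis" "R < \<bar>t\<bar>" for bs t
    using that
  proof (induction bs arbitrary: t)
    case Nil
    then show ?case using R by simp
  next
    case (Cons b bs)
    have "open {t. R < \<bar>t::real\<bar>}"
      by (intro open_Collect_less continuous_intros)
    moreover have "((\<lambda>_. 0) has_derivative (\<lambda>_. 0 :: complex)) (at t)" by simp
    ultimately have "(iter_partial bs ?g has_derivative (\<lambda>_. 0)) (at t)"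
      using Cons by (elim has_derivative_transform_within_open) (auto simp: Cons.IH)
    then have "(\<lambda>_. 0) = frechet_derivative (iter_partial bs ?g) (at t)"
      by (rule frechet_derivative_at)
    then show ?case by (simp add: fun_eq_iff)
  qed
  show ?thesis
    unfolding schwartz_def smooth_def mem_Collect_eq
  proof (intro conjI allI impI diff)
    fix bs :: "real list" and N :: nat assume bs: "set bs \<subseteq> Basis"
    let ?F = "\<lambda>x. (1 + norm x) ^ N * norm (iter_partial bs ?g x)"
    have "continuous_on {-\<bar>R\<bar>..\<bar>R\<bar>} (iter_partial bs ?g)"
      using diff[OF bs] by (simp add: continuous_at_imp_continuous_on differentiable_imp_continuous_within)
    then have "continuous_on {-\<bar>R\<bar>..\<bar>R\<bar>} ?F" by (intro continuous_intros)
    then have "\<exists>u\<in>{-\<bar>R\<bar>..\<bar>R\<bar>}. \<forall>x\<in>{-\<bar>R\<bar>..\<bar>R\<bar>}. ?F x \<le> ?F u"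
      by (intro continuous_attains_sup) auto
    then obtain u where "\<And>x. x \<in> {-\<bar>R\<bar>..\<bar>R\<bar>} \<Longrightarrow> ?F x \<le> ?F u"
      by blast
    moreover have "?F x \<le> ?F u" if "x \<notin> {-\<bar>R\<bar>..\<bar>R\<bar>}" for x
      using that vanish[OF bs, of x] by auto
    ultimately show "\<exists>C. \<forall>x. ?F x \<le> C" by blast
  qed
qed

lemma test_fun_measurable [measurable_dest]: "test_fun h \<Longrightarrow> h \<in> borel_measurable borel"
proof -
  assume "test_fun h"
  then have "Ck (Suc 0) h" by (simp only: test_fun_def)
  then have "h differentiable at x" for x by (rule Ck_imp_differentiable)
  then show ?thesis
    by (intro borel_measurable_continuous_onI)
      (simp add: continuous_at_imp_continuous_on differentiable_imp_continuous_within)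
qed

section \<open>Kernels of tensor product symbols\<close>

definition tensor_symbol :: "(real \<Rightarrow> real) \<Rightarrow> 'a::euclidean_space \<Rightarrow> 'a \<Rightarrow> real" where
  "tensor_symbol h k \<xi> = (\<Prod>b\<in>Basis. h (\<xi> \<bullet> b - k \<bullet> b))"

definition tensor_kernel :: "(real \<Rightarrow> real) \<Rightarrow> 'a::euclidean_space \<Rightarrow> 'a \<Rightarrow> complex" where
  "tensor_kernel h k = inv_fourier (\<lambda>\<xi>. complex_of_real (tensor_symbol h k \<xi>))"

lemma fourier_inv_fourier_schwartz:
  fixes g :: "'a::euclidean_space \<Rightarrow> complex"
  assumes "g \<in> schwartz"
  shows "fourier (inv_fourier g) \<xi> = g \<xi>"
proof -
  note [measurable] = schwartz_measurable[OF assms]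
  have "fourier (inv_fourier g) \<xi> = (\<integral>x. expi (\<xi> \<bullet> (0 - x)) * fourier g (0 - x) \<partial>lborel)"
    unfolding fourier_expi[of "inv_fourier g"] inv_fourier_eq_fourier by (simp add: inner_commute)
  also have "\<dots> = inv_fourier (fourier g) \<xi>"
    unfolding inv_fourier_expi
    by (rule integral_lborel_reflect[where f = "\<lambda>x. expi (\<xi> \<bullet> x) * fourier g x"]) measurable
  finally show ?thesis using fourier_inversion_schwartz[OF assms] by simp
qed

lemma fourier_tensor:
  fixes g :: "'a::euclidean_space \<Rightarrow> real \<Rightarrow> complex"
  assumes "\<And>b. b \<in> Basis \<Longrightarrow> integrable lborel (g b)"
  shows "fourier (\<lambda>x. \<Prod>b\<in>Basis. g b (x \<bullet> b)) \<xi> = (\<Prod>b\<in>Basis. fourier (g b) (\<xi> \<bullet> b))"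
proof -
  have "fourier (\<lambda>x. \<Prod>b\<in>Basis. g b (x \<bullet> b)) \<xi>
      = (\<integral>x. (\<Prod>b\<in>Basis. expi (- ((x \<bullet> b) * (\<xi> \<bullet> b))) * g b (x \<bullet> b)) \<partial>lborel)"
    unfolding fourier_expi prod.distrib expi_sum[symmetric]
    by (subst euclidean_inner) (simp add: sum_negf)
  also have "\<dots> = (\<Prod>b\<in>Basis. \<integral>t. expi (- (t * (\<xi> \<bullet> b))) * g b t \<partial>lborel)"
    using assms by (intro integral_lborel_tensor[where h = "\<lambda>b t. expi (- (t * (\<xi> \<bullet> b))) * g b t"] integrable_expi_mult) auto
  finally show ?thesis by (simp add: fourier_expi)
qed

lemma inv_fourier_tensor:
  fixes g :: "'a::euclidean_space \<Rightarrow> real \<Rightarrow> complex"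
  assumes "\<And>b. b \<in> Basis \<Longrightarrow> integrable lborel (g b)"
  shows "inv_fourier (\<lambda>x. \<Prod>b\<in>Basis. g b (x \<bullet> b)) z = (\<Prod>b\<in>Basis. inv_fourier (g b) (z \<bullet> b))"
  using fourier_tensor[OF assms, where \<xi> = "- z"] by (simp add: inv_fourier_eq_fourier)

text \<open>
  Shifting a symbol only modulates its kernel, which is why all kernel estimates are uniform in
  the lattice point.
\<close>

lemma norm_inv_fourier_shift:
  fixes h :: "real \<Rightarrow> real"
  assumes [measurable]: "h \<in> borel_measurable borel"
  shows "norm (inv_fourier (\<lambda>t. complex_of_real (h (t - c))) z) = norm (inv_fourier (\<lambda>t. complex_of_real (h t)) z)"
proof -
  have "inv_fourier (\<lambda>t. complex_of_real (h (t - c))) z = (\<integral>t. expi (z * (c + 1 * t)) * h (c + 1 * t - c) \<partial>lborel)"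
    unfolding inv_fourier_expi by (subst lborel_integral_real_affine[where c=1 and t=c]) auto
  also have "\<dots> = expi (z * c) * inv_fourier (\<lambda>t. complex_of_real (h t)) z"
    unfolding inv_fourier_expi by (simp add: distrib_left expi_add mult.assoc flip: integral_mult_right_zero)
  finally show ?thesis by (simp add: norm_mult)
qed

context
  fixes h :: "real \<Rightarrow> real"
  assumes h: "test_fun h"
begin

lemma shifted_schwartz: "(\<lambda>t. complex_of_real (h (t - c))) \<in> schwartz"
  by (intro test_fun_schwartz test_fun_shift h)

lemma tensor_kernel_tensor:
  "tensor_kernel h k z = (\<Prod>b\<in>Basis. inv_fourier (\<lambda>t. complex_of_real (h (t - k \<bullet> b))) (z \<bullet> b))"
  unfolding tensor_kernel_def tensor_symbol_def of_real_prod
  by (rule inv_fourier_tensor[where g = "\<lambda>b t. complex_of_real (h (t - k \<bullet> b))"])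
    (intro schwartz_integrable shifted_schwartz)

lemma integrable_tensor_symbol: "integrable lborel (\<lambda>\<xi>. complex_of_real (tensor_symbol h k \<xi>))"
  unfolding tensor_symbol_def of_real_prod
  by (rule integrable_lborel_tensor[where h = "\<lambda>b t. complex_of_real (h (t - k \<bullet> b))"])
    (intro schwartz_integrable shifted_schwartz)

lemma measurable_tensor_symbol [measurable]: "tensor_symbol h k \<in> borel_measurable borel"
proof -
  note [measurable] = test_fun_measurable[OF h]
  show ?thesis unfolding tensor_symbol_def by measurable
qed

lemma measurable_tensor_kernel [measurable]: "tensor_kernel h k \<in> borel_measurable borel"
  unfolding tensor_kernel_def by measurable

text \<open>
  Both sides are tensor products, so one-dimensional inversion is enough.
\<close>

lemma fourier_tensor_kernel: "fourier (tensor_kernel h k) \<xi> = complex_of_real (tensor_symbol h k \<xi>)"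
proof -
  have "inv_fourier (\<lambda>t. complex_of_real (h (t - c))) = (\<lambda>z. fourier (\<lambda>t. complex_of_real (h (t - c))) (0 + (-1) *\<^sub>R z))" for c
    by (simp add: inv_fourier_eq_fourier fun_eq_iff)
  then have int: "integrable lborel (inv_fourier (\<lambda>t. complex_of_real (h (t - c))))" for c
    using integrable_lborel_affine[of "-1" "fourier (\<lambda>t. complex_of_real (h (t - c)))" 0]
      fourier_schwartz_integrable[OF shifted_schwartz[of c]] by simp
  show ?thesis
    unfolding tensor_kernel_tensor[abs_def]
    by (subst fourier_tensor[OF int])
      (simp add: fourier_inv_fourier_schwartz[OF shifted_schwartz] tensor_symbol_def)
qed

lemma tensor_kernel_decay:
  "\<exists>C>0. \<forall>(k::'a::euclidean_space) z. norm (tensor_kernel h k z) \<le> C * wt z powr - real N"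
proof -
  note [measurable] = test_fun_measurable[OF h]
  obtain C where C: "0 \<le> C" "\<And>t. wt t ^ N * norm (fourier (\<lambda>t. complex_of_real (h t)) t) \<le> C"
    using fourier_schwartz_decay[OF test_fun_schwartz[OF h], of N] by blast
  have 1: "norm (inv_fourier (\<lambda>t. complex_of_real (h t)) t) \<le> (C + 1) * (1 + \<bar>t\<bar>) powr - real N" for t
  proof (rule powr_neg_bound)
    show "(1 + \<bar>t\<bar>) powr real N * norm (inv_fourier (\<lambda>t. complex_of_real (h t)) t) \<le> C + 1"
      using C(2)[of "-t"] by (simp add: inv_fourier_eq_fourier powr_realpow wt_def)
  qed simp
  have "norm (tensor_kernel h k z) \<le> (C + 1) ^ DIM('a) * wt z powr - real N" for k z :: 'a
  proof -
    have "norm (tensor_kernel h k z) \<le> (\<Prod>b\<in>(Basis::'a set). (C + 1) * (1 + \<bar>z \<bullet> b\<bar>) powr - real N)"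
      unfolding tensor_kernel_tensor prod_norm[symmetric]
      by (intro prod_mono) (auto simp: norm_inv_fourier_shift 1)
    then show ?thesis by (simp add: prod.distrib wt_powr_tensor)
  qed
  then show ?thesis using C(1) by (intro exI[of _ "(C + 1) ^ DIM('a)"]) auto
qed

end

section \<open>The integer lattice\<close>

definition of_coords :: "('a::euclidean_space \<Rightarrow> real) \<Rightarrow> 'a" where
  "of_coords f = (\<Sum>b\<in>Basis. f b *\<^sub>R b)"

lemma of_coords_inner [simp]: "b \<in> Basis \<Longrightarrow> of_coords f \<bullet> b = f b"
  by (simp add: of_coords_def)

lemma bij_betw_of_coords:
  "bij_betw of_coords (PiE Basis J) {m::'a::euclidean_space. \<forall>b\<in>Basis. m \<bullet> b \<in> J b}"
proof (rule bij_betwI[where g = "\<lambda>m. \<lambda>b\<in>Basis. m \<bullet> b"])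
  show "of_coords \<in> PiE Basis J \<rightarrow> {m::'a. \<forall>b\<in>Basis. m \<bullet> b \<in> J b}"
    by auto
  show "(\<lambda>b\<in>Basis. of_coords f \<bullet> b) = f" if "f \<in> PiE Basis J" for f :: "'a \<Rightarrow> real"
    using that by (intro extensionalityI[where A = Basis]) (auto simp: PiE_def)
  show "of_coords (\<lambda>b\<in>Basis. m \<bullet> b) = m" for m :: 'a
    by (rule euclidean_eqI) simp
qed auto

lemma int_lattice_eq: "int_lattice = {m::'a::euclidean_space. \<forall>b\<in>Basis. m \<bullet> b \<in> \<int>}"
  by (simp add: int_lattice_def)

lemma countable_int_lattice: "countable (int_lattice :: 'a::euclidean_space set)"
proof -
  have "\<int> = (of_int ` UNIV :: real set)"
    by (simp add: Ints_def)
  then have "countable (\<int> :: real set)"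
    using countable_image[OF countableI_type, of real_of_int UNIV] by (simp only:)
  then have "countable (PiE (Basis :: 'a set) (\<lambda>_. \<int> :: real set))"
    by (intro countable_PiE finite_Basis)
  then have "countable (of_coords ` PiE (Basis :: 'a set) (\<lambda>_. \<int>))"
    by (rule countable_image)
  then show ?thesis
    unfolding int_lattice_eq bij_betw_imp_surj_on[OF bij_betw_of_coords[of "\<lambda>_. \<int>"]] .
qed

lemma finite_coord_box:
  fixes J :: "'a::euclidean_space \<Rightarrow> real set"
  assumes "\<And>b. b \<in> Basis \<Longrightarrow> finite (J b)"
  shows "finite {m::'a. \<forall>b\<in>Basis. m \<bullet> b \<in> J b}"
  using bij_betw_finite[OF bij_betw_of_coords[of J]] assms by (simp add: finite_PiE)

text \<open>
  The distributive law, transported from choice functions on the basis to lattice points.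
\<close>

lemma sum_coord_box_tensor:
  fixes J :: "'a::euclidean_space \<Rightarrow> real set" and g :: "'a \<Rightarrow> real \<Rightarrow> real"
  assumes "\<And>b. b \<in> Basis \<Longrightarrow> finite (J b)"
  shows "(\<Sum>m | \<forall>b\<in>Basis. m \<bullet> b \<in> J b. \<Prod>b\<in>Basis. g b (m \<bullet> b)) = (\<Prod>b\<in>Basis. \<Sum>j\<in>J b. g b j)"
proof -
  have "(\<Sum>m | \<forall>b\<in>Basis. m \<bullet> b \<in> J b. \<Prod>b\<in>Basis. g b (m \<bullet> b))
      = (\<Sum>f\<in>PiE Basis J. \<Prod>b\<in>Basis. g b (of_coords f \<bullet> b))"
    by (rule sum.reindex_bij_betw[OF bij_betw_of_coords, symmetric])
  also have "\<dots> = (\<Prod>b\<in>Basis. \<Sum>j\<in>J b. g b j)"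
    using assms by (subst prod_sum_PiE) auto
  finally show ?thesis .
qed

lemma int_lattice_Pair: "(x, y) \<in> int_lattice \<longleftrightarrow> x \<in> int_lattice \<and> y \<in> int_lattice"
  unfolding int_lattice_def Basis_prod_def by (simp add: ball_Un)

section \<open>The symbols of the frequency-uniform decomposition\<close>

definition unit_near :: "real \<Rightarrow> real set" where
  "unit_near t = {j \<in> \<int>. \<bar>t - j\<bar> < 1}"

lemma finite_unit_near [simp]: "finite (unit_near t)"
proof -
  have "unit_near t \<subseteq> of_int ` {\<lfloor>t\<rfloor> - 1..\<lceil>t\<rceil> + 1}"
  proof
    fix j assume "j \<in> unit_near t"
    then obtain i where "j = of_int i" "\<bar>t - of_int i\<bar> < 1"
      by (auto simp: unit_near_def elim: Ints_cases)
    moreover from this have "i \<in> {\<lfloor>t\<rfloor> - 1..\<lceil>t\<rceil> + 1}" by (simp add: abs_less_iff) linarith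
    ultimately show "j \<in> of_int ` {\<lfloor>t\<rfloor> - 1..\<lceil>t\<rceil> + 1}" by blast
  qed
  then show ?thesis by (rule finite_subset) simp
qed

definition lattice_near :: "'a::euclidean_space \<Rightarrow> 'a set" where
  "lattice_near \<xi> = {m. \<forall>b\<in>Basis. m \<bullet> b \<in> unit_near (\<xi> \<bullet> b)}"

lemma finite_lattice_near: "finite (lattice_near \<xi>)"
  unfolding lattice_near_def by (rule finite_coord_box) simp

lemma lattice_near_subset: "lattice_near \<xi> \<subseteq> int_lattice"
  by (auto simp: lattice_near_def int_lattice_def unit_near_def)

definition periodized :: "(real \<Rightarrow> real) \<Rightarrow> real \<Rightarrow> real" where
  "periodized \<eta> t = (\<Sum>j\<in>unit_near t. \<eta> (2 * (t - j)))"

text \<open>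
  The normalising sum over the lattice factors into one-dimensional periodised sums, so
  \<open>\<phi>\<^sub>k\<close> is the tensor product of the translates of this function.
\<close>

definition profile :: "(real \<Rightarrow> real) \<Rightarrow> real \<Rightarrow> real" where
  "profile \<eta> t = \<eta> (2 * t) / periodized \<eta> t"

context
  fixes \<eta> :: "real \<Rightarrow> real"
  assumes \<eta>: "cutoff \<eta>"
begin

lemma cutoff_nonneg: "0 \<le> \<eta> t"
proof -
  have "\<eta> t \<in> range \<eta>" by simp
  then show ?thesis using \<eta> unfolding cutoff_def by (meson atLeastAtMost_iff subsetD)
qed

lemma cutoff_le_1: "\<eta> t \<le> 1"
proof -
  have "\<eta> t \<in> range \<eta>" by simp
  then show ?thesis using \<eta> unfolding cutoff_def by (meson atLeastAtMost_iff subsetD)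
qed

lemma cutoff_eq_1: "\<bar>t\<bar> \<le> 1 \<Longrightarrow> \<eta> t = 1"
  using \<eta> by (simp add: cutoff_def)

lemma cutoff_eq_0: "2 \<le> \<bar>t\<bar> \<Longrightarrow> \<eta> t = 0"
  using \<eta> by (simp add: cutoff_def)

lemma cutoff_Ck: "Ck n \<eta>"
  using \<eta> by (simp add: cutoff_def smooth_imp_Ck)

lemma cutoff_test_fun: "test_fun \<eta>"
  unfolding test_fun_def
  by (intro conjI allI exI[of _ 2] impI cutoff_Ck cutoff_eq_0) simp

lemma periodized_ge_1: "1 \<le> periodized \<eta> t"
proof -
  define j :: real where "j = of_int (round t)"
  have j: "\<bar>t - j\<bar> \<le> 1 / 2"
    unfolding j_def using of_int_round_abs_le[of t] by (simp add: abs_minus_commute)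
  then have "j \<in> unit_near t" by (simp add: unit_near_def j_def)
  moreover have "\<eta> (2 * (t - j)) = 1" using j by (intro cutoff_eq_1) (subst abs_mult, simp)
  ultimately show ?thesis
    unfolding periodized_def using member_le_sum[of j "unit_near t" "\<lambda>j. \<eta> (2 * (t - j))"]
    by (simp add: cutoff_nonneg)
qed

lemma periodized_shift:
  assumes "k \<in> \<int>"
  shows "periodized \<eta> (t - k) = periodized \<eta> t"
  unfolding periodized_def
  by (rule sum.reindex_bij_witness[where i = "\<lambda>j. j - k" and j = "\<lambda>j. j + k"])
    (use assms in \<open>auto simp: unit_near_def algebra_simps\<close>)

lemma profile_eq_0: "1 \<le> \<bar>t\<bar> \<Longrightarrow> profile \<eta> t = 0"
  by (simp add: profile_def cutoff_eq_0)

text \<open>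
  The index set of the periodised sum varies with the point.  On \<open>[-1, 1]\<close>, outside of which the
  numerator vanishes, the sum of five fixed translates of \<open>\<eta>(2 \<cdot>)\<close> can replace it; adding \<open>1 - \<eta>\<close>,
  which is 0 there, yields a smooth denominator that is positive on the whole line.
\<close>

lemma profile_test_fun: "test_fun (profile \<eta>)"
proof -
  let ?J = "{-2, -1, 0, 1, 2 :: real}"
  define D where "D t = (\<Sum>j\<in>?J. \<eta> (2 * (t - j))) + (1 - \<eta> t)" for t
  have "Ck n (\<lambda>t. \<eta> (2 * (t - j)))" for n j
    using Ck_affine[OF cutoff_Ck, of n 2 "- 2 * j"] by (simp add: algebra_simps)
  note Ck_term = this
  have Ck_sum: "Ck n (\<lambda>t. \<Sum>j\<in>J. \<eta> (2 * (t - j)))" if "finite J" for n J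
    using that
  proof (induction J rule: finite_induct)
    case empty
    then show ?case by (simp add: Ck_const)
  next
    case (insert j J)
    then show ?case by (simp only: sum.insert not_False_eq_True) (rule Ck_add[OF Ck_term])
  qed
  have 1: "Ck n (\<lambda>t. \<Sum>j\<in>?J. \<eta> (2 * (t - j)))" for n
    by (rule Ck_sum) (intro finite.intros)
  have 2: "Ck n (\<lambda>t. 1 + (-1) * \<eta> t)" for n
    by (rule Ck_add[OF Ck_const Ck_mult[OF Ck_const cutoff_Ck]])
  have "D = (\<lambda>t. (\<Sum>j\<in>?J. \<eta> (2 * (t - j))) + (1 + (-1) * \<eta> t))"
    unfolding D_def by (intro ext) simp
  then have Ck_D: "Ck n D" for n
    using Ck_add[OF 1 2] by (simp only:)
  have D_pos: "0 < D t" for t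
  proof (cases "\<bar>t\<bar> \<le> 2")
    case True
    define j :: real where "j = of_int (round t)"
    have j: "\<bar>t - j\<bar> \<le> 1 / 2"
      unfolding j_def using of_int_round_abs_le[of t] by (simp add: abs_minus_commute)
    have "\<bar>round t\<bar> \<le> 2" using j True unfolding j_def by linarith
    then have "round t \<in> {-2, -1, 0, 1, 2}" by auto
    then have "j \<in> ?J" unfolding j_def by auto
    then have "\<eta> (2 * (t - j)) \<le> (\<Sum>j\<in>?J. \<eta> (2 * (t - j)))"
      by (intro member_le_sum) (auto simp: cutoff_nonneg)
    moreover have "\<eta> (2 * (t - j)) = 1" using j by (intro cutoff_eq_1) (subst abs_mult, simp)
    ultimately show ?thesis unfolding D_def using cutoff_le_1[of t] by linarith
  next
    case False
    then have "\<eta> t = 0" by (intro cutoff_eq_0) simp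
    moreover have "0 \<le> (\<Sum>j\<in>?J. \<eta> (2 * (t - j)))"
      by (intro sum_nonneg cutoff_nonneg)
    ultimately show ?thesis unfolding D_def by linarith
  qed
  have eq: "profile \<eta> t = \<eta> (2 * t + 0) * inverse (D t)" for t
  proof (cases "\<bar>t\<bar> \<le> 1")
    case True
    have "periodized \<eta> t = (\<Sum>j\<in>?J. \<eta> (2 * (t - j)))"
      unfolding periodized_def
    proof (rule sum.mono_neutral_left)
      show "unit_near t \<subseteq> ?J"
      proof
        fix j assume "j \<in> unit_near t"
        then obtain i where i: "j = of_int i" "\<bar>t - of_int i\<bar> < 1"
          by (auto simp: unit_near_def elim: Ints_cases)
        then have "\<bar>i\<bar> \<le> 1" using True by linarith
        then have "i \<in> {-1, 0, 1}" by auto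
        then show "j \<in> ?J" using i by auto
      qed
      show "\<forall>j\<in>?J - unit_near t. \<eta> (2 * (t - j)) = 0"
      proof
        fix j assume j: "j \<in> ?J - unit_near t"
        then have "j \<in> \<int>" by auto
        then show "\<eta> (2 * (t - j)) = 0" using j by (intro cutoff_eq_0) (auto simp: unit_near_def)
      qed
    qed simp
    then show ?thesis using True by (simp add: profile_def D_def cutoff_eq_1 field_simps)
  next
    case False
    then show ?thesis by (simp add: profile_def cutoff_eq_0)
  qed
  have "Ck n (profile \<eta>)" for n
  proof -
    have "D t \<noteq> 0" for t using D_pos[of t] by simp
    then have "Ck n (\<lambda>t. \<eta> (2 * t + 0) * inverse (D t))"
      by (rule Ck_mult[OF Ck_affine[OF cutoff_Ck] Ck_inverse[OF _ Ck_D]])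
    moreover have "profile \<eta> = (\<lambda>t. \<eta> (2 * t + 0) * inverse (D t))"
      by (intro ext eq)
    ultimately show ?thesis by (simp only:)
  qed
  then show ?thesis
    unfolding test_fun_def by (intro conjI allI exI[of _ 1] impI profile_eq_0) simp_all
qed

lemma tensor_bump_eq_0:
  assumes "m \<in> int_lattice" "m \<notin> lattice_near \<xi>"
  shows "tensor_bump \<eta> m \<xi> = 0"
proof -
  obtain b where "b \<in> Basis" "1 \<le> \<bar>\<xi> \<bullet> b - m \<bullet> b\<bar>"
    using assms by (force simp: lattice_near_def int_lattice_def unit_near_def)
  then show ?thesis
    unfolding tensor_bump_def by (auto intro!: bexI[of _ b] cutoff_eq_0)
qed

lemma infsum_tensor_bump:
  "(\<Sum>\<^sub>\<infinity>m\<in>int_lattice. tensor_bump \<eta> m \<xi>) = (\<Sum>m\<in>lattice_near \<xi>. tensor_bump \<eta> m \<xi>)"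
  using lattice_near_subset[of \<xi>]
  by (subst infsum_finite[OF finite_lattice_near, symmetric])
    (auto intro!: infsum_cong_neutral tensor_bump_eq_0)

text \<open>
  At a fixed frequency only a finite box of lattice points contributes, and over a box the sum of a
  tensor product is the product of the sums.
\<close>

lemma infsum_tensor_bump_prod:
  "(\<Sum>\<^sub>\<infinity>m\<in>int_lattice. tensor_bump \<eta> m \<xi>) = (\<Prod>b\<in>Basis. periodized \<eta> (\<xi> \<bullet> b))"
proof -
  have "(\<Sum>m\<in>lattice_near \<xi>. tensor_bump \<eta> m \<xi>) =
      (\<Sum>m | \<forall>b\<in>Basis. m \<bullet> b \<in> unit_near (\<xi> \<bullet> b). \<Prod>b\<in>Basis. \<eta> (2 * (\<xi> \<bullet> b - m \<bullet> b)))"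
    by (simp only: lattice_near_def tensor_bump_def)
  also have "\<dots> = (\<Prod>b\<in>Basis. \<Sum>j\<in>unit_near (\<xi> \<bullet> b). \<eta> (2 * (\<xi> \<bullet> b - j)))"
    by (rule sum_coord_box_tensor) (rule finite_unit_near)
  finally show ?thesis by (simp only: infsum_tensor_bump periodized_def)
qed

lemma uniform_symbol_eq:
  assumes "k \<in> int_lattice"
  shows "uniform_symbol \<eta> k \<xi> = tensor_symbol (profile \<eta>) k \<xi>"
proof -
  have "uniform_symbol \<eta> k \<xi> =
      (\<Prod>b\<in>Basis. \<eta> (2 * (\<xi> \<bullet> b - k \<bullet> b)) / periodized \<eta> (\<xi> \<bullet> b))"
    unfolding uniform_symbol_def infsum_tensor_bump_prod
    by (simp only: tensor_bump_def prod_dividef)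
  also have "\<dots> = tensor_symbol (profile \<eta>) k \<xi>"
    unfolding tensor_symbol_def profile_def
    using assms by (intro prod.cong refl) (simp add: int_lattice_def periodized_shift)
  finally show ?thesis .
qed

lemma uniform_symbol_nonneg: "0 \<le> uniform_symbol \<eta> k \<xi>"
proof -
  have "0 \<le> tensor_bump \<eta> k \<xi>"
    unfolding tensor_bump_def by (intro prod_nonneg) (simp add: cutoff_nonneg)
  moreover have "0 \<le> (\<Prod>b\<in>Basis. periodized \<eta> (\<xi> \<bullet> b))"
    by (intro prod_nonneg ballI order_trans[OF zero_le_one periodized_ge_1])
  ultimately show ?thesis
    unfolding uniform_symbol_def infsum_tensor_bump_prod by (rule divide_nonneg_nonneg)
qed

lemma uniform_symbol_eq_0:
  "m \<in> int_lattice \<Longrightarrow> m \<notin> lattice_near \<xi> \<Longrightarrow> uniform_symbol \<eta> m \<xi> = 0"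
  by (simp add: uniform_symbol_def tensor_bump_eq_0)

lemma sum_uniform_symbol_eq_1:
  assumes "finite A" "A \<subseteq> int_lattice" "lattice_near \<xi> \<subseteq> A"
  shows "(\<Sum>l\<in>A. uniform_symbol \<eta> l \<xi>) = 1"
proof -
  have "(\<Sum>l\<in>A. uniform_symbol \<eta> l \<xi>) = (\<Sum>l\<in>lattice_near \<xi>. uniform_symbol \<eta> l \<xi>)"
    using assms by (intro sum.mono_neutral_right) (auto intro: uniform_symbol_eq_0)
  also have "\<dots> = (\<Sum>l\<in>lattice_near \<xi>. tensor_bump \<eta> l \<xi>) / (\<Sum>\<^sub>\<infinity>m\<in>int_lattice. tensor_bump \<eta> m \<xi>)"
    by (simp add: uniform_symbol_def sum_divide_distrib)
  also have "\<dots> = 1"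
  proof -
    have "(1::real) \<le> (\<Prod>b\<in>Basis. periodized \<eta> (\<xi> \<bullet> b))"
      by (intro prod_ge_1 periodized_ge_1)
    then have "(\<Sum>\<^sub>\<infinity>m\<in>int_lattice. tensor_bump \<eta> m \<xi>) \<noteq> 0"
      unfolding infsum_tensor_bump_prod by linarith
    then show ?thesis unfolding infsum_tensor_bump by (rule divide_self)
  qed
  finally show ?thesis .
qed

lemma sum_uniform_symbol_le_1:
  assumes "finite A" "A \<subseteq> int_lattice"
  shows "(\<Sum>l\<in>A. uniform_symbol \<eta> l \<xi>) \<le> 1"
proof -
  have "(\<Sum>l\<in>A. uniform_symbol \<eta> l \<xi>) \<le> (\<Sum>l\<in>A \<union> lattice_near \<xi>. uniform_symbol \<eta> l \<xi>)"
    using assms finite_lattice_near by (intro sum_mono2 uniform_symbol_nonneg) auto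
  also have "\<dots> = 1"
    using assms finite_lattice_near lattice_near_subset by (intro sum_uniform_symbol_eq_1) auto
  finally show ?thesis .
qed

end

section \<open>Frequency pieces of a function and of its trace\<close>

text \<open>
  Convolution in \<open>y\<close> acts as a Fourier multiplier.  With \<open>\<pi>\<close> the identity this gives the reproducing
  formula for \<open>\<box>\<^sub>l f\<close>; with \<open>\<pi> = fst\<close> it describes convolution on the hyperplane of a function
  given by a Fourier integral over the whole space.
\<close>

lemma fourier_multiplier_conv:
  fixes g :: "'x::euclidean_space \<Rightarrow> complex" and \<psi> :: "'e::euclidean_space \<Rightarrow> complex" and \<pi> :: "'x \<Rightarrow> 'e"
  assumes g: "integrable lborel g" and \<psi>: "integrable lborel \<psi>" and [measurable]: "\<pi> \<in> borel_measurable borel"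
  shows "(\<integral>y. (\<integral>\<xi>. expi (y \<bullet> \<pi> \<xi>) * g \<xi> \<partial>lborel) * \<psi> (x - y) \<partial>lborel)
       = (\<integral>\<xi>. expi (x \<bullet> \<pi> \<xi>) * (g \<xi> * fourier \<psi> (\<pi> \<xi>)) \<partial>lborel)"
proof -
  have [measurable]: "g \<in> borel_measurable borel" "\<psi> \<in> borel_measurable borel"
    using g \<psi> by auto
  have \<psi>': "integrable lborel (\<lambda>y. \<psi> (x - y))"
    using integrable_lborel_affine[of "-1" \<psi> x] \<psi> by simp
  have int: "integrable (lborel \<Otimes>\<^sub>M lborel) (\<lambda>(\<xi>, y). expi (y \<bullet> \<pi> \<xi>) * (g \<xi> * \<psi> (x - y)))"
    by (intro integrable_lborel_pair_mult g \<psi>') measurable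
  have inner: "(\<integral>y. expi (y \<bullet> \<pi> \<xi>) * \<psi> (x - y) \<partial>lborel) = expi (x \<bullet> \<pi> \<xi>) * fourier \<psi> (\<pi> \<xi>)" for \<xi>
  proof -
    have "(\<integral>y. expi (y \<bullet> \<pi> \<xi>) * \<psi> (x - y) \<partial>lborel) = (\<integral>y. expi ((x - (x - y)) \<bullet> \<pi> \<xi>) * \<psi> (x - y) \<partial>lborel)"
      by simp
    also have "\<dots> = (\<integral>y. expi ((x - y) \<bullet> \<pi> \<xi>) * \<psi> y \<partial>lborel)"
      by (rule integral_lborel_reflect[where f = "\<lambda>y. expi ((x - y) \<bullet> \<pi> \<xi>) * \<psi> y"]) measurable
    also have "\<dots> = expi (x \<bullet> \<pi> \<xi>) * fourier \<psi> (\<pi> \<xi>)"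
      unfolding fourier_expi by (simp add: inner_diff_left expi_diff mult.assoc)
    finally show ?thesis .
  qed
  have "(\<integral>y. (\<integral>\<xi>. expi (y \<bullet> \<pi> \<xi>) * g \<xi> \<partial>lborel) * \<psi> (x - y) \<partial>lborel)
      = (\<integral>y. \<integral>\<xi>. expi (y \<bullet> \<pi> \<xi>) * (g \<xi> * \<psi> (x - y)) \<partial>lborel \<partial>lborel)"
    by (simp add: mult.assoc flip: integral_mult_left_zero)
  also have "\<dots> = (\<integral>\<xi>. \<integral>y. expi (y \<bullet> \<pi> \<xi>) * (g \<xi> * \<psi> (x - y)) \<partial>lborel \<partial>lborel)"
    using lborel_pair.Fubini_integral[OF int] by simp
  also have "\<dots> = (\<integral>\<xi>. g \<xi> * (\<integral>y. expi (y \<bullet> \<pi> \<xi>) * \<psi> (x - y) \<partial>lborel) \<partial>lborel)"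
    by (simp add: mult.left_commute flip: integral_mult_right_zero)
  also have "\<dots> = (\<integral>\<xi>. expi (x \<bullet> \<pi> \<xi>) * (g \<xi> * fourier \<psi> (\<pi> \<xi>)) \<partial>lborel)"
    unfolding inner by (simp add: mult.left_commute)
  finally show ?thesis .
qed

lemma inv_fourier_mult_fourier:
  fixes F \<Phi> :: "'e::euclidean_space \<Rightarrow> complex"
  assumes F: "integrable lborel F" and \<Phi>: "integrable lborel \<Phi>"
  shows "inv_fourier (\<lambda>\<xi>. \<Phi> \<xi> * fourier F \<xi>) x = (\<integral>y. F y * inv_fourier \<Phi> (x - y) \<partial>lborel)"
proof -
  have [measurable]: "F \<in> borel_measurable borel" "\<Phi> \<in> borel_measurable borel"
    using F \<Phi> by auto
  have int: "integrable (lborel \<Otimes>\<^sub>M lborel) (\<lambda>(\<xi>, y). expi ((x - y) \<bullet> \<xi>) * (\<Phi> \<xi> * F y))"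
    by (intro integrable_lborel_pair_mult F \<Phi>) measurable
  have "inv_fourier (\<lambda>\<xi>. \<Phi> \<xi> * fourier F \<xi>) x = (\<integral>\<xi>. \<integral>y. expi ((x - y) \<bullet> \<xi>) * (\<Phi> \<xi> * F y) \<partial>lborel \<partial>lborel)"
    unfolding inv_fourier_expi fourier_expi
    by (simp add: inner_diff_left expi_diff mult_ac flip: integral_mult_right_zero)
  also have "\<dots> = (\<integral>y. \<integral>\<xi>. expi ((x - y) \<bullet> \<xi>) * (\<Phi> \<xi> * F y) \<partial>lborel \<partial>lborel)"
    using lborel_pair.Fubini_integral[OF int] by simp
  also have "\<dots> = (\<integral>y. F y * inv_fourier \<Phi> (x - y) \<partial>lborel)"
    unfolding inv_fourier_expi by (simp add: mult_ac flip: integral_mult_right_zero)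
  finally show ?thesis .
qed

lemma tensor_kernel_decay_powr:
  assumes h: "test_fun h"
  shows "\<exists>C>0. \<forall>(k::'a::euclidean_space) z. norm (tensor_kernel h k z) \<le> C * wt z powr - a"
proof -
  obtain N where N: "a \<le> real N" using real_arch_simple by blast
  obtain C where C: "0 < C" "\<And>(k::'a) z. norm (tensor_kernel h k z) \<le> C * wt z powr - real N"
    using tensor_kernel_decay[OF h] by blast
  have "norm (tensor_kernel h k z) \<le> C * wt z powr - a" for k z :: 'a
  proof -
    have "C * wt z powr - real N \<le> C * wt z powr - a"
      using C N wt_ge_1 by (intro mult_left_mono powr_mono) auto
    then show ?thesis using C(2)[of k z] by linarith
  qed
  then show ?thesis using C(1) by blast
qed

lemma integrable_tensor_kernel:
  fixes k :: "'a::euclidean_space"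
  assumes h: "test_fun h"
  shows "integrable lborel (tensor_kernel h k)"
proof -
  obtain C where "\<And>(k::'a) z. norm (tensor_kernel h k z) \<le> C * wt z powr - 2"
    using tensor_kernel_decay_powr[OF h, of 2] by blast
  then show ?thesis
    by (intro integrable_wt_bound[of _ C 2] measurable_tensor_kernel h) auto
qed

lemma sum_le_nn_integral_count_space:
  assumes "finite A" "A \<subseteq> B"
  shows "(\<Sum>x\<in>A. h x) \<le> (\<integral>\<^sup>+x. h x \<partial>count_space B)"
proof -
  have "(\<Sum>x\<in>A. h x) = (\<Sum>x\<in>A. h x * emeasure (count_space B) {x})"
    using assms by (intro sum.cong) auto
  also have "\<dots> = (\<integral>\<^sup>+x. h x * indicator A x \<partial>count_space B)"
    using assms by (intro nn_integral_indicator_finite[symmetric]) auto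
  also have "\<dots> \<le> (\<integral>\<^sup>+x. h x \<partial>count_space B)"
    by (intro nn_integral_mono) (auto simp: indicator_def)
  finally show ?thesis .
qed

text \<open>
  The contribution of \<open>\<box>\<^sub>l f\<close> to \<open>\<box>\<^sub>k\<close> of the trace, written as a Fourier integral over the whole
  space.
\<close>

definition trace_piece :: "(real \<Rightarrow> real) \<Rightarrow> 'a \<Rightarrow> 'a \<times> real \<Rightarrow> ('a::euclidean_space \<times> real \<Rightarrow> complex) \<Rightarrow> 'a \<Rightarrow> complex" where
  "trace_piece \<eta> k l f x = (\<integral>\<xi>. expi (x \<bullet> fst \<xi>) *
     (complex_of_real (uniform_symbol \<eta> l \<xi>) * fourier f \<xi> * complex_of_real (uniform_symbol \<eta> k (fst \<xi>))) \<partial>lborel)"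

context
  fixes \<eta> :: "real \<Rightarrow> real"
  assumes \<eta>: "cutoff \<eta>"
begin

lemma measurable_uniform_symbol:
  assumes "l \<in> int_lattice"
  shows "uniform_symbol \<eta> l \<in> borel_measurable borel"
  using measurable_tensor_symbol[OF profile_test_fun[OF \<eta>], of l]
  by (simp add: uniform_symbol_eq[OF \<eta> assms, abs_def] cong: measurable_cong)

lemma norm_uniform_symbol_le_1:
  assumes "l \<in> int_lattice"
  shows "norm (complex_of_real (uniform_symbol \<eta> l \<xi>)) \<le> 1"
  using sum_uniform_symbol_le_1[OF \<eta>, of "{l}" \<xi>] uniform_symbol_nonneg[OF \<eta>, of l \<xi>] assms by simp

lemma integrable_symbol_mult:
  assumes l: "l \<in> int_lattice" and g: "integrable lborel g"
  shows "integrable lborel (\<lambda>\<xi>. complex_of_real (uniform_symbol \<eta> l \<xi>) * g \<xi>)"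
proof (rule Bochner_Integration.integrable_bound[OF g])
  have [measurable]: "g \<in> borel_measurable borel" using g by auto
  note [measurable] = measurable_uniform_symbol[OF l]
  show "(\<lambda>\<xi>. complex_of_real (uniform_symbol \<eta> l \<xi>) * g \<xi>) \<in> borel_measurable lborel"
    by measurable
  show "AE \<xi> in lborel. norm (complex_of_real (uniform_symbol \<eta> l \<xi>) * g \<xi>) \<le> norm (g \<xi>)"
    unfolding norm_mult using norm_uniform_symbol_le_1[OF l]
    by (intro AE_I2 mult_left_le_one_le) auto
qed

lemma box_op_expi:
  "box_op \<eta> l f x = (\<integral>\<xi>. expi (x \<bullet> \<xi>) * (complex_of_real (uniform_symbol \<eta> l \<xi>) * fourier f \<xi>) \<partial>lborel)"
  by (simp add: box_op_def inv_fourier_expi)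

lemma integrable_box_symbol:
  assumes "l \<in> int_lattice" "f \<in> schwartz"
  shows "integrable lborel (\<lambda>\<xi>. complex_of_real (uniform_symbol \<eta> l \<xi>) * fourier f \<xi>)"
  using assms by (intro integrable_symbol_mult fourier_schwartz_integrable)

lemma measurable_box_op:
  assumes "l \<in> int_lattice" "f \<in> schwartz"
  shows "box_op \<eta> l f \<in> borel_measurable borel"
proof -
  have [measurable]: "(\<lambda>\<xi>. complex_of_real (uniform_symbol \<eta> l \<xi>) * fourier f \<xi>) \<in> borel_measurable borel"
    using integrable_box_symbol[OF assms] by auto
  show ?thesis unfolding box_op_def by measurable
qed

lemma box_op_bounded:
  assumes "l \<in> int_lattice" "f \<in> schwartz"
  obtains B where "\<And>x. norm (box_op \<eta> l f x) \<le> B"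
  unfolding box_op_def inv_fourier_eq_fourier
  using norm_fourier_le[OF integrable_box_symbol[OF assms]] by blast

text \<open>
  \<open>\<eta>(\<xi> - l)\<close>, taken in every coordinate without the dilation by 2, equals 1 on the support of
  \<open>\<phi>\<^sub>l\<close>, so multiplying by it, which is convolution with its kernel, changes nothing.
\<close>

lemma box_op_reproducing:
  assumes l: "l \<in> int_lattice" and f: "f \<in> schwartz"
  shows "box_op \<eta> l f x = (\<integral>y. box_op \<eta> l f y * tensor_kernel \<eta> l (x - y) \<partial>lborel)"
proof -
  note t = cutoff_test_fun[OF \<eta>]
  have sym: "uniform_symbol \<eta> l \<xi> * tensor_symbol \<eta> l \<xi> = uniform_symbol \<eta> l \<xi>" for \<xi>
  proof (cases "l \<in> lattice_near \<xi>")
    case True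
    then have "tensor_symbol \<eta> l \<xi> = 1"
      unfolding tensor_symbol_def
      by (intro prod.neutral ballI cutoff_eq_1[OF \<eta>]) (auto simp: lattice_near_def unit_near_def)
    then show ?thesis by simp
  next
    case False
    then show ?thesis using uniform_symbol_eq_0[OF \<eta> l] by simp
  qed
  have "(\<integral>y. box_op \<eta> l f y * tensor_kernel \<eta> l (x - y) \<partial>lborel) =
      (\<integral>\<xi>. expi (x \<bullet> \<xi>) * (complex_of_real (uniform_symbol \<eta> l \<xi>) * fourier f \<xi> * fourier (tensor_kernel \<eta> l) \<xi>) \<partial>lborel)"
    unfolding box_op_expi
    by (rule fourier_multiplier_conv[OF integrable_box_symbol[OF l f] integrable_tensor_kernel[OF t]]) simp
  also have "\<dots> = box_op \<eta> l f x"
  proof -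
    have "complex_of_real (uniform_symbol \<eta> l \<xi>) * fourier f \<xi> * complex_of_real (tensor_symbol \<eta> l \<xi>)
        = complex_of_real (uniform_symbol \<eta> l \<xi> * tensor_symbol \<eta> l \<xi>) * fourier f \<xi>" for \<xi>
      by (simp only: of_real_mult mult_ac)
    then show ?thesis by (simp only: fourier_tensor_kernel[OF t] box_op_expi sym)
  qed
  finally show ?thesis ..
qed

lemma box_op_self_bound:
  "\<exists>K>0. \<forall>l\<in>int_lattice. \<forall>f\<in>schwartz. \<forall>x::'a::euclidean_space.
     ennreal (norm (box_op \<eta> l f x))
       \<le> ennreal K * (\<integral>\<^sup>+y. ennreal (norm (box_op \<eta> l f y) * wt (x - y) powr - a) \<partial>lborel)"
proof -
  obtain C where C: "0 < C" "\<And>(k::'a) z. norm (tensor_kernel \<eta> k z) \<le> C * wt z powr - a"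
    using tensor_kernel_decay_powr[OF cutoff_test_fun[OF \<eta>], of a] by blast
  have "ennreal (norm (box_op \<eta> l f x))
       \<le> ennreal C * (\<integral>\<^sup>+y. ennreal (norm (box_op \<eta> l f y) * wt (x - y) powr - a) \<partial>lborel)"
    if l: "l \<in> int_lattice" and f: "f \<in> schwartz" for l x :: 'a and f
  proof -
    note [measurable] = measurable_box_op[OF l f]
    have "ennreal (norm (box_op \<eta> l f x)) \<le> (\<integral>\<^sup>+y. ennreal (norm (box_op \<eta> l f y * tensor_kernel \<eta> l (x - y))) \<partial>lborel)"
      by (subst box_op_reproducing[OF l f]) (rule norm_integral_le)
    also have "\<dots> \<le> (\<integral>\<^sup>+y. ennreal C * ennreal (norm (box_op \<eta> l f y) * wt (x - y) powr - a) \<partial>lborel)"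
    proof (intro nn_integral_mono)
      fix y
      have "norm (box_op \<eta> l f y) * norm (tensor_kernel \<eta> l (x - y)) \<le> norm (box_op \<eta> l f y) * (C * wt (x - y) powr - a)"
        by (intro mult_left_mono C) auto
      then show "ennreal (norm (box_op \<eta> l f y * tensor_kernel \<eta> l (x - y)))
          \<le> ennreal C * ennreal (norm (box_op \<eta> l f y) * wt (x - y) powr - a)"
        using C(1) by (simp add: norm_mult mult_ac ennreal_leI flip: ennreal_mult)
    qed
    finally show ?thesis by (subst (asm) nn_integral_cmult) auto
  qed
  then show ?thesis using C(1) by blast
qed

lemma trace_piece_conv:
  fixes f :: "'a::euclidean_space \<times> real \<Rightarrow> complex"
  assumes k: "k \<in> int_lattice" and l: "l \<in> int_lattice" and f: "f \<in> schwartz"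
  shows "trace_piece \<eta> k l f x = (\<integral>y. box_op \<eta> l f (y, 0) * tensor_kernel (profile \<eta>) k (x - y) \<partial>lborel)"
proof -
  note t = profile_test_fun[OF \<eta>]
  have "(\<integral>y. box_op \<eta> l f (y, 0) * tensor_kernel (profile \<eta>) k (x - y) \<partial>lborel)
     = (\<integral>y. (\<integral>\<xi>. expi (y \<bullet> fst \<xi>) * (complex_of_real (uniform_symbol \<eta> l \<xi>) * fourier f \<xi>) \<partial>lborel)
          * tensor_kernel (profile \<eta>) k (x - y) \<partial>lborel)"
    unfolding box_op_expi by (simp add: inner_prod_def)
  also have "\<dots> = (\<integral>\<xi>. expi (x \<bullet> fst \<xi>) * (complex_of_real (uniform_symbol \<eta> l \<xi>) * fourier f \<xi> *
      fourier (tensor_kernel (profile \<eta>) k) (fst \<xi>)) \<partial>lborel)"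
    by (rule fourier_multiplier_conv[OF integrable_box_symbol[OF l f] integrable_tensor_kernel[OF t]])
      (simp add: borel_prod[symmetric])
  finally show ?thesis
    unfolding trace_piece_def fourier_tensor_kernel[OF t] uniform_symbol_eq[OF \<eta> k] by simp
qed

lemma trace_op_integrable:
  fixes f :: "'a::euclidean_space \<times> real \<Rightarrow> complex"
  assumes f: "f \<in> schwartz"
  shows "integrable lborel (trace_op f)"
proof -
  note [measurable] = schwartz_measurable[OF f]
  obtain C where C: "\<And>x. norm (f x) \<le> C * wt x powr - real 2"
    using schwartz_wt_decay[OF f, where N=2] by metis
  have "trace_op f \<in> borel_measurable borel"
    unfolding trace_op_def by (rule measurable_compose[OF _ schwartz_measurable[OF f]]) (simp add: borel_prod[symmetric])
  moreover have "norm (trace_op f x) \<le> C * wt x powr - 2" for x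
    using C[of "(x, 0)"] by (simp add: trace_op_def wt_Pair)
  ultimately show ?thesis by (intro integrable_wt_bound[of _ C 2]) auto
qed

lemma box_op_trace:
  fixes f :: "'a::euclidean_space \<times> real \<Rightarrow> complex"
  assumes k: "k \<in> int_lattice" and f: "f \<in> schwartz"
  shows "box_op \<eta> k (trace_op f) x = (\<integral>\<xi>. expi (x \<bullet> fst \<xi>) * (fourier f \<xi> * complex_of_real (uniform_symbol \<eta> k (fst \<xi>))) \<partial>lborel)"
proof -
  note t = profile_test_fun[OF \<eta>]
  have "box_op \<eta> k (trace_op f) x = (\<integral>y. trace_op f y * tensor_kernel (profile \<eta>) k (x - y) \<partial>lborel)"
    unfolding box_op_def tensor_kernel_def uniform_symbol_eq[OF \<eta> k]
    by (rule inv_fourier_mult_fourier[OF trace_op_integrable[OF f] integrable_tensor_symbol[OF t]])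
  also have "\<dots> = (\<integral>y. (\<integral>\<xi>. expi (y \<bullet> fst \<xi>) * fourier f \<xi> \<partial>lborel) * tensor_kernel (profile \<eta>) k (x - y) \<partial>lborel)"
  proof -
    have "trace_op f y = (\<integral>\<xi>. expi (y \<bullet> fst \<xi>) * fourier f \<xi> \<partial>lborel)" for y
      using fourier_inversion_schwartz[OF f, of "(y, 0)"]
      by (simp add: trace_op_def inv_fourier_expi inner_prod_def)
    then show ?thesis by simp
  qed
  also have "\<dots> = (\<integral>\<xi>. expi (x \<bullet> fst \<xi>) * (fourier f \<xi> * fourier (tensor_kernel (profile \<eta>) k) (fst \<xi>)) \<partial>lborel)"
    by (rule fourier_multiplier_conv[OF fourier_schwartz_integrable[OF f] integrable_tensor_kernel[OF t]])
      (simp add: borel_prod[symmetric])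
  finally show ?thesis
    unfolding fourier_tensor_kernel[OF t] uniform_symbol_eq[OF \<eta> k] .
qed

text \<open>
  A frequency at which neither \<open>\<phi>\<^sub>l\<close> nor \<open>\<phi>\<^sub>k\<close> vanishes is within less than 1 of \<open>l\<close> and of \<open>k\<close> in each
  of the first coordinates, so these integers differ by less than 2, hence by at most 1.
\<close>

lemma trace_piece_eq_0:
  fixes f :: "'a::euclidean_space \<times> real \<Rightarrow> complex"
  assumes k: "k \<in> int_lattice" and l: "l \<in> int_lattice" and b: "b \<in> Basis" "1 < \<bar>fst l \<bullet> b - k \<bullet> b\<bar>"
  shows "trace_piece \<eta> k l f x = 0"
proof -
  have "fst l \<bullet> b \<in> \<int>" "k \<bullet> b \<in> \<int>"
    using k l b int_lattice_Pair[of "fst l" "snd l"] by (auto simp: int_lattice_def)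
  then obtain i where i: "fst l \<bullet> b - k \<bullet> b = of_int i"
    by (metis Ints_cases Ints_diff)
  have "1 < \<bar>i\<bar>" using b(2) unfolding i by linarith
  then have "2 \<le> \<bar>fst l \<bullet> b - k \<bullet> b\<bar>" unfolding i by linarith
  have "uniform_symbol \<eta> l \<xi> = 0 \<or> uniform_symbol \<eta> k (fst \<xi>) = 0" for \<xi>
  proof (rule ccontr)
    assume "\<not> (uniform_symbol \<eta> l \<xi> = 0 \<or> uniform_symbol \<eta> k (fst \<xi>) = 0)"
    then have "l \<in> lattice_near \<xi>" "k \<in> lattice_near (fst \<xi>)"
      using uniform_symbol_eq_0[OF \<eta> l, of \<xi>] uniform_symbol_eq_0[OF \<eta> k, of "fst \<xi>"] by auto
    moreover have "(b, 0) \<in> Basis" using b by (simp add: Basis_prod_def)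
    ultimately have "\<bar>\<xi> \<bullet> (b, 0) - l \<bullet> (b, 0)\<bar> < 1" "\<bar>fst \<xi> \<bullet> b - k \<bullet> b\<bar> < 1"
      using b by (auto simp: lattice_near_def unit_near_def)
    then show False using \<open>2 \<le> \<bar>fst l \<bullet> b - k \<bullet> b\<bar>\<close> by (simp add: inner_prod_def)
  qed
  then have eq: "expi (x \<bullet> fst \<xi>) * (complex_of_real (uniform_symbol \<eta> l \<xi>) * fourier f \<xi> * complex_of_real (uniform_symbol \<eta> k (fst \<xi>))) = 0" for \<xi>
    by (metis mult_zero_left mult_zero_right of_real_0)
  show ?thesis unfolding trace_piece_def eq by simp
qed

text \<open>
  Insert the partition of unity \<open>\<Sum>\<^sub>l \<phi>\<^sub>l = 1\<close> into the Fourier integral of \<open>\<box>\<^sub>k (T f)\<close>.  Partial sums over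
  growing boxes are bounded by 1 and are eventually equal to 1 at each frequency.
\<close>

lemma box_op_trace_le:
  fixes f :: "'a::euclidean_space \<times> real \<Rightarrow> complex"
  assumes k: "k \<in> int_lattice" and f: "f \<in> schwartz"
  shows "ennreal (norm (box_op \<eta> k (trace_op f) x)) \<le> (\<integral>\<^sup>+l. ennreal (norm (trace_piece \<eta> k l f x)) \<partial>count_space int_lattice)"
    (is "_ \<le> ?R")
proof -
  define A :: "nat \<Rightarrow> ('a \<times> real) set" where "A n = {m. \<forall>b\<in>Basis. m \<bullet> b \<in> real_of_int ` {- int n..int n}}" for n
  have A: "finite (A n)" for n unfolding A_def by (intro finite_coord_box) auto
  have A_sub: "A n \<subseteq> int_lattice" for n by (auto simp: A_def int_lattice_def)
  note [measurable] = measurable_uniform_symbol[OF k] schwartz_measurable[OF f]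
  have [measurable]: "(\<lambda>\<xi>. uniform_symbol \<eta> k (fst \<xi>)) \<in> borel_measurable (borel :: ('a \<times> real) measure)"
    by (rule measurable_compose[OF _ measurable_uniform_symbol[OF k]]) (simp add: borel_prod[symmetric])
  have [measurable]: "(\<lambda>\<xi>. x \<bullet> fst \<xi>) \<in> borel_measurable (borel :: ('a \<times> real) measure)"
    by (intro borel_measurable_continuous_onI continuous_intros)
  define G where "G = (\<lambda>\<xi>. fourier f \<xi> * complex_of_real (uniform_symbol \<eta> k (fst \<xi>)))"
  have [measurable]: "G \<in> borel_measurable borel" unfolding G_def by measurable
  have G_le: "norm (G \<xi>) \<le> norm (fourier f \<xi>)" for \<xi>
    unfolding G_def norm_mult using norm_uniform_symbol_le_1[OF k] by (intro mult_right_le_one_le) auto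
  have intG: "integrable lborel G"
    by (rule Bochner_Integration.integrable_bound[OF fourier_schwartz_integrable[OF f]]) (use G_le in auto)
  have piece: "trace_piece \<eta> k l f x = (\<integral>\<xi>. expi (x \<bullet> fst \<xi>) * (complex_of_real (uniform_symbol \<eta> l \<xi>) * G \<xi>) \<partial>lborel)" for l
    by (simp add: trace_piece_def G_def mult.assoc)
  have part: "(\<Sum>l\<in>A n. trace_piece \<eta> k l f x) =
      (\<integral>\<xi>. expi (x \<bullet> fst \<xi>) * (complex_of_real (\<Sum>l\<in>A n. uniform_symbol \<eta> l \<xi>) * G \<xi>) \<partial>lborel)" for n
  proof -
    have "(\<Sum>l\<in>A n. trace_piece \<eta> k l f x) =
        (\<integral>\<xi>. (\<Sum>l\<in>A n. expi (x \<bullet> fst \<xi>) * (complex_of_real (uniform_symbol \<eta> l \<xi>) * G \<xi>)) \<partial>lborel)"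
      unfolding piece
      by (rule Bochner_Integration.integral_sum[symmetric])
        (use A_sub in \<open>auto intro!: integrable_expi_mult integrable_symbol_mult intG\<close>)
    then show ?thesis by (simp add: sum_distrib_left sum_distrib_right of_real_sum)
  qed
  have "(\<lambda>n. \<integral>\<xi>. expi (x \<bullet> fst \<xi>) * (complex_of_real (\<Sum>l\<in>A n. uniform_symbol \<eta> l \<xi>) * G \<xi>) \<partial>lborel)
      \<longlonglongrightarrow> (\<integral>\<xi>. expi (x \<bullet> fst \<xi>) * G \<xi> \<partial>lborel)"
  proof (rule integral_dominated_convergence)
    show "integrable lborel (\<lambda>\<xi>. norm (G \<xi>))" using intG by simp
    have "(\<lambda>\<xi>. \<Sum>l\<in>A n. uniform_symbol \<eta> l \<xi>) \<in> borel_measurable borel" for n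
      using A_sub measurable_uniform_symbol by (intro borel_measurable_sum) auto
    then show "(\<lambda>\<xi>. expi (x \<bullet> fst \<xi>) * (complex_of_real (\<Sum>l\<in>A n. uniform_symbol \<eta> l \<xi>) * G \<xi>)) \<in> borel_measurable lborel" for n
      by measurable
    show "(\<lambda>\<xi>. expi (x \<bullet> fst \<xi>) * G \<xi>) \<in> borel_measurable lborel" by measurable
    show "AE \<xi> in lborel. norm (expi (x \<bullet> fst \<xi>) * (complex_of_real (\<Sum>l\<in>A n. uniform_symbol \<eta> l \<xi>) * G \<xi>)) \<le> norm (G \<xi>)" for n
    proof (intro AE_I2)
      fix \<xi>
      have "\<bar>\<Sum>l\<in>A n. uniform_symbol \<eta> l \<xi>\<bar> \<le> 1"
        using sum_uniform_symbol_le_1[OF \<eta> A[of n] A_sub[of n], of \<xi>] sum_nonneg[of "A n" "\<lambda>l. uniform_symbol \<eta> l \<xi>"]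
        by (simp add: uniform_symbol_nonneg[OF \<eta>])
      then show "norm (expi (x \<bullet> fst \<xi>) * (complex_of_real (\<Sum>l\<in>A n. uniform_symbol \<eta> l \<xi>) * G \<xi>)) \<le> norm (G \<xi>)"
        unfolding norm_mult norm_of_real norm_expi by (simp add: mult_left_le_one_le)
    qed
    show "AE \<xi> in lborel. (\<lambda>n. expi (x \<bullet> fst \<xi>) * (complex_of_real (\<Sum>l\<in>A n. uniform_symbol \<eta> l \<xi>) * G \<xi>)) \<longlonglongrightarrow> expi (x \<bullet> fst \<xi>) * G \<xi>"
    proof (intro AE_I2 tendsto_eventually)
      fix \<xi> :: "'a \<times> real"
      obtain n where n: "norm \<xi> + 1 \<le> real n" using real_arch_simple by blast
      have "lattice_near \<xi> \<subseteq> A m" if "n \<le> m" for m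
      proof
        fix l assume l: "l \<in> lattice_near \<xi>"
        show "l \<in> A m"
          unfolding A_def mem_Collect_eq
        proof
          fix b :: "'a \<times> real" assume b: "b \<in> Basis"
          then obtain i where i: "l \<bullet> b = of_int i" "\<bar>\<xi> \<bullet> b - of_int i\<bar> < 1"
            using l by (auto simp: lattice_near_def unit_near_def elim!: Ints_cases)
          have "\<bar>real_of_int i\<bar> \<le> real m"
            using i(2) n that Basis_le_norm[OF b, of \<xi>] by linarith
          then have "i \<in> {- int m..int m}" by (simp add: abs_le_iff)
          then show "l \<bullet> b \<in> real_of_int ` {- int m..int m}" using i(1) by blast
        qed
      qed
      then show "\<forall>\<^sub>F m in sequentially. expi (x \<bullet> fst \<xi>) * (complex_of_real (\<Sum>l\<in>A m. uniform_symbol \<eta> l \<xi>) * G \<xi>) = expi (x \<bullet> fst \<xi>) * G \<xi>"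
        by (intro eventually_sequentiallyI[of n]) (simp add: sum_uniform_symbol_eq_1[OF \<eta> A A_sub])
    qed
  qed
  then have lim: "(\<lambda>n. \<Sum>l\<in>A n. trace_piece \<eta> k l f x) \<longlonglongrightarrow> box_op \<eta> k (trace_op f) x"
    unfolding part box_op_trace[OF k f] G_def .
  have le: "ennreal (norm (\<Sum>l\<in>A n. trace_piece \<eta> k l f x)) \<le> ?R" for n
  proof -
    have "ennreal (norm (\<Sum>l\<in>A n. trace_piece \<eta> k l f x)) \<le> ennreal (\<Sum>l\<in>A n. norm (trace_piece \<eta> k l f x))"
      by (intro ennreal_leI norm_sum)
    also have "\<dots> = (\<Sum>l\<in>A n. ennreal (norm (trace_piece \<eta> k l f x)))"
      by (simp add: sum_ennreal)
    also have "\<dots> \<le> ?R"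
      by (intro sum_le_nn_integral_count_space A A_sub)
    finally show ?thesis .
  qed
  have "(\<lambda>n. ennreal (norm (\<Sum>l\<in>A n. trace_piece \<eta> k l f x))) \<longlonglongrightarrow> ennreal (norm (box_op \<eta> k (trace_op f) x))"
    by (intro tendsto_ennrealI tendsto_norm lim)
  then show ?thesis
    by (rule LIMSEQ_le_const2) (use le in blast)
qed

text \<open>
  Peetre's inequality for \<open>u = |\<box>\<^sub>l f|\<close>.  The maximal function at \<open>(x, 0)\<close> dominates \<open>\<box>\<^sub>l f\<close> on the whole
  hyperplane up to powers of the weight, and these are absorbed by the kernel of \<open>\<box>\<^sub>k\<close>, so the
  same average controls \<open>\<box>\<^sub>k\<close> of the restriction.
\<close>

lemma box_op_trace_piece_bound:
  fixes q b :: real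
  assumes q: "0 < q" and b: "2 \<le> b"
  shows "\<exists>C>0. \<forall>l\<in>int_lattice. \<forall>f\<in>schwartz.
     (\<forall>x. ennreal (norm (box_op \<eta> l f x) powr q)
        \<le> ennreal C * (\<integral>\<^sup>+z. ennreal (norm (box_op \<eta> l f z) powr q * wt (x - z) powr - b) \<partial>lborel)) \<and>
     (\<forall>k\<in>int_lattice. \<forall>x::'a::euclidean_space. ennreal (norm (trace_piece \<eta> k l f x) powr q)
        \<le> ennreal C * (\<integral>\<^sup>+z. ennreal (norm (box_op \<eta> l f z) powr q * wt ((x, 0) - z) powr - b) \<partial>lborel))"
proof -
  define a where "a = b * max 1 (1 / q)"
  have a: "0 \<le> a" using b by (simp add: a_def)
  obtain K where K: "0 < K"
    "\<And>l f x. l \<in> int_lattice \<Longrightarrow> f \<in> schwartz \<Longrightarrow> ennreal (norm (box_op \<eta> l f (x::'a \<times> real)))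
       \<le> ennreal K * (\<integral>\<^sup>+y. ennreal (norm (box_op \<eta> l f y) * wt (x - y) powr - a) \<partial>lborel)"
    using box_op_self_bound[where 'a="'a \<times> real", of a] by blast
  obtain C where C: "0 < C"
    "\<And>(u::'a \<times> real \<Rightarrow> real) B x y. u \<in> borel_measurable borel \<Longrightarrow> (\<And>x. 0 \<le> u x \<and> u x \<le> B) \<Longrightarrow>
      (\<And>x. ennreal (u x) \<le> ennreal K * (\<integral>\<^sup>+z. ennreal (u z * wt (x - z) powr - a) \<partial>lborel)) \<Longrightarrow>
      ennreal ((u y * wt (x - y) powr - a) powr q)
       \<le> ennreal C * (\<integral>\<^sup>+z. ennreal (u z powr q * wt (x - z) powr - b) \<partial>lborel)"
    using Peetre_maximal[OF q b K(1), where 'a="'a \<times> real"] unfolding a_def[symmetric] by meson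
  obtain D where D: "0 < D" "\<And>(k::'a) z. norm (tensor_kernel (profile \<eta>) k z) \<le> D * wt z powr - (a + 2)"
    using tensor_kernel_decay_powr[OF profile_test_fun[OF \<eta>], of "a + 2"] by blast
  define J where "J = wt_mass TYPE('a)"
  have J: "0 < J" unfolding J_def by (rule wt_mass_pos)
  define C' where "C' = max C ((D * J) powr q * C)"
  have C': "0 < C'" unfolding C'_def using C(1) by (simp add: less_max_iff_disj)
  have max: "ennreal ((norm (box_op \<eta> l f y) * wt (x - y) powr - a) powr q)
       \<le> ennreal C * (\<integral>\<^sup>+z. ennreal (norm (box_op \<eta> l f z) powr q * wt (x - z) powr - b) \<partial>lborel)"
    if l: "l \<in> int_lattice" and f: "f \<in> schwartz" for l x y :: "'a \<times> real" and f
  proof -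
    note [measurable] = measurable_box_op[OF l f]
    obtain B where "\<And>x. norm (box_op \<eta> l f x) \<le> B" using box_op_bounded[OF l f] by blast
    then show ?thesis
      by (intro C(2)[where B = B] K(2) l f) auto
  qed
  have "ennreal (norm (box_op \<eta> l f x) powr q)
        \<le> ennreal C' * (\<integral>\<^sup>+z. ennreal (norm (box_op \<eta> l f z) powr q * wt (x - z) powr - b) \<partial>lborel)"
    if l: "l \<in> int_lattice" and f: "f \<in> schwartz" for l x :: "'a \<times> real" and f
  proof -
    have "ennreal (norm (box_op \<eta> l f x) powr q)
        \<le> ennreal C * (\<integral>\<^sup>+z. ennreal (norm (box_op \<eta> l f z) powr q * wt (x - z) powr - b) \<partial>lborel)"
      using max[OF l f, of x x] by simp
    also have "\<dots> \<le> ennreal C' * (\<integral>\<^sup>+z. ennreal (norm (box_op \<eta> l f z) powr q * wt (x - z) powr - b) \<partial>lborel)"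
      unfolding C'_def by (intro mult_right_mono ennreal_leI) auto
    finally show ?thesis .
  qed
  moreover have "ennreal (norm (trace_piece \<eta> k l f x) powr q)
        \<le> ennreal C' * (\<integral>\<^sup>+z. ennreal (norm (box_op \<eta> l f z) powr q * wt ((x, 0) - z) powr - b) \<partial>lborel)"
    if l: "l \<in> int_lattice" and f: "f \<in> schwartz" and k: "k \<in> int_lattice" for k x :: 'a and l and f
  proof (cases "\<integral>\<^sup>+z. ennreal (norm (box_op \<eta> l f z) powr q * wt ((x, 0) - z) powr - b) \<partial>lborel")
    case top
    then show ?thesis using C' by (simp add: ennreal_mult_top)
  next
    case (real i)
    define v where "v = (C * i) powr (1 / q)"
    have v: "norm (box_op \<eta> l f (y, 0)) * wt (x - y) powr - a \<le> v" for y
    proof -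
      have "ennreal ((norm (box_op \<eta> l f (y, 0)) * wt ((x, 0::real) - (y, 0)) powr - a) powr q) \<le> ennreal (C * i)"
        using max[OF l f, of "(y, 0)" "(x, 0)"] C(1) real by (simp add: ennreal_mult)
      then have "(norm (box_op \<eta> l f (y, 0)) * wt (x - y) powr - a) powr q \<le> C * i"
        using C(1) real by (simp add: wt_Pair)
      then have "((norm (box_op \<eta> l f (y, 0)) * wt (x - y) powr - a) powr q) powr (1 / q) \<le> v"
        unfolding v_def using q by (intro powr_mono2) auto
      then show ?thesis using q by (simp add: powr_powr)
    qed
    have v0: "0 \<le> v" by (simp add: v_def)
    have "ennreal (norm (trace_piece \<eta> k l f x))
        \<le> (\<integral>\<^sup>+y. ennreal (norm (box_op \<eta> l f (y, 0) * tensor_kernel (profile \<eta>) k (x - y))) \<partial>lborel)"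
      by (subst trace_piece_conv[OF k l f]) (rule norm_integral_le)
    also have "\<dots> \<le> (\<integral>\<^sup>+y. ennreal (v * D) * ennreal (wt (x - y) powr - 2) \<partial>lborel)"
    proof (intro nn_integral_mono)
      fix y
      have "norm (box_op \<eta> l f (y, 0)) * norm (tensor_kernel (profile \<eta>) k (x - y))
          \<le> norm (box_op \<eta> l f (y, 0)) * (D * wt (x - y) powr - (a + 2))"
        by (intro mult_left_mono D) auto
      also have "\<dots> = (norm (box_op \<eta> l f (y, 0)) * wt (x - y) powr - a) * (D * wt (x - y) powr - 2)"
        by (simp add: powr_add[of _ "-a" "-2", simplified])
      also have "\<dots> \<le> v * (D * wt (x - y) powr - 2)"
        using D by (intro mult_right_mono v) auto
      finally show "ennreal (norm (box_op \<eta> l f (y, 0) * tensor_kernel (profile \<eta>) k (x - y)))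
          \<le> ennreal (v * D) * ennreal (wt (x - y) powr - 2)"
        using v0 D(1) by (simp add: norm_mult mult.assoc ennreal_leI flip: ennreal_mult)
    qed
    also have "\<dots> = ennreal (v * D) * (\<integral>\<^sup>+y. ennreal (wt (x - y) powr - 2) \<partial>lborel)"
      by (rule nn_integral_cmult) measurable
    also have "\<dots> \<le> ennreal (v * D) * ennreal J"
      unfolding J_def by (intro mult_left_mono nn_integral_wt) auto
    also have "\<dots> = ennreal (v * D * J)"
      using v0 D J by (simp add: ennreal_mult)
    finally have "norm (trace_piece \<eta> k l f x) \<le> v * D * J"
      using v0 D J by simp
    then have "norm (trace_piece \<eta> k l f x) powr q \<le> (v * D * J) powr q"
      using q by (intro powr_mono2) auto
    also have "\<dots> = (D * J) powr q * C * i"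
      using v0 D J C(1) q real by (simp add: v_def powr_mult powr_powr)
    also have "\<dots> \<le> C' * i"
      unfolding C'_def using real by (intro mult_right_mono) auto
    finally show ?thesis
      using real C(1) by (simp add: ennreal_leI C'_def flip: ennreal_mult)
  qed
  ultimately show ?thesis using C' by (intro exI[of _ C'] conjI ballI allI) auto
qed

end

section \<open>Sums over the lattice\<close>

lemma nn_integral_count_space_leI:
  assumes "countable B" and le: "\<And>A. finite A \<Longrightarrow> A \<subseteq> B \<Longrightarrow> (\<Sum>x\<in>A. h x) \<le> (R :: ennreal)"
  shows "(\<integral>\<^sup>+x. h x \<partial>count_space B) \<le> R"
proof (cases "finite B")
  case True
  then show ?thesis using le[of B] by (simp add: nn_integral_count_space_finite)
next
  case False
  note bij = bij_betw_from_nat_into[OF assms(1) False]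
  have "(\<integral>\<^sup>+x. h x \<partial>count_space B) = (\<Sum>n. h (from_nat_into B n))"
    using nn_integral_bij_count_space[OF bij, of h] by (simp add: nn_integral_count_space_nat)
  also have "\<dots> = (SUP n. \<Sum>i<n. h (from_nat_into B i))"
    by (rule suminf_eq_SUP)
  also have "\<dots> \<le> R"
  proof (rule SUP_least)
    fix n
    have inj: "inj_on (from_nat_into B) {..<n}"
      using bij by (auto simp: bij_betw_def intro: inj_on_subset)
    have "(\<Sum>i<n. h (from_nat_into B i)) = (\<Sum>x\<in>from_nat_into B ` {..<n}. h x)"
      by (simp add: sum.reindex[OF inj])
    also have "\<dots> \<le> R"
      using bij by (intro le) (auto simp: bij_betw_def)
    finally show "(\<Sum>i<n. h (from_nat_into B i)) \<le> R" .
  qed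
  finally show ?thesis .
qed

lemma ennpowr_le_imp:
  assumes "0 < t" "ennpowr x t \<le> y"
  shows "x \<le> ennpowr y (1 / t)"
proof -
  have "ennpowr (ennpowr x t) (1 / t) \<le> ennpowr y (1 / t)"
    using assms by (intro ennpowr_mono) auto
  then show ?thesis using assms(1) by (simp add: ennpowr_ennpowr)
qed

lemma ennpowr_add_le:
  assumes "0 < q" "q \<le> 1"
  shows "ennpowr (x + y) q \<le> ennpowr x q + ennpowr y q"
proof (cases x; cases y)
  fix r s assume rs: "x = ennreal r" "0 \<le> r" "y = ennreal s" "0 \<le> s"
  have "(r + s) powr q \<le> r powr q + s powr q"
  proof (cases "r + s = 0")
    case True
    then show ?thesis using rs assms by simp
  next
    case False
    then have pos: "0 < r + s" using rs by simp
    have frac: "w \<le> w powr q" if "0 \<le> w" "w \<le> 1" for w :: real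
    proof (cases "w = 0")
      case False
      then show ?thesis using that assms powr_mono'[of q 1 w] by simp
    qed simp
    have "1 = r / (r + s) + s / (r + s)"
      using pos by (simp flip: add_divide_distrib)
    also have "\<dots> \<le> (r / (r + s)) powr q + (s / (r + s)) powr q"
      using rs pos by (intro add_mono frac) auto
    also have "\<dots> = (r powr q + s powr q) / (r + s) powr q"
      using rs pos by (simp add: powr_divide add_divide_distrib)
    finally show ?thesis using pos by (simp add: field_simps)
  qed
  then show ?thesis using rs by (simp add: ennpowr_ennreal ennreal_leI flip: ennreal_plus)
qed auto

lemma ennpowr_sum_le:
  assumes "0 < q" "q \<le> 1"
  shows "ennpowr (\<Sum>i\<in>A. h i) q \<le> (\<Sum>i\<in>A. ennpowr (h i) q)"
proof (induction A rule: infinite_finite_induct)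
  case (insert i A)
  have "ennpowr (h i + (\<Sum>i\<in>A. h i)) q \<le> ennpowr (h i) q + ennpowr (\<Sum>i\<in>A. h i) q"
    by (rule ennpowr_add_le[OF assms])
  also have "\<dots> \<le> ennpowr (h i) q + (\<Sum>i\<in>A. ennpowr (h i) q)"
    by (intro add_left_mono insert.IH)
  finally show ?case using insert.hyps by simp
qed auto

lemma ennpowr_nn_integral_count_space_le:
  assumes q: "0 < q" "q \<le> 1" and B: "countable B"
  shows "ennpowr (\<integral>\<^sup>+x. h x \<partial>count_space B) q \<le> (\<integral>\<^sup>+x. ennpowr (h x) q \<partial>count_space B)"
    (is "_ \<le> ?R")
proof -
  have "(\<integral>\<^sup>+x. h x \<partial>count_space B) \<le> ennpowr ?R (1 / q)"
  proof (rule nn_integral_count_space_leI[OF B])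
    fix A assume A: "finite A" "A \<subseteq> B"
    have "ennpowr (\<Sum>x\<in>A. h x) q \<le> (\<Sum>x\<in>A. ennpowr (h x) q)"
      by (rule ennpowr_sum_le[OF q])
    also have "\<dots> \<le> ?R" by (rule sum_le_nn_integral_count_space[OF A])
    finally show "(\<Sum>x\<in>A. h x) \<le> ennpowr ?R (1 / q)"
      by (rule ennpowr_le_imp[OF q(1)])
  qed
  then have "ennpowr (\<integral>\<^sup>+x. h x \<partial>count_space B) q \<le> ennpowr (ennpowr ?R (1 / q)) q"
    using q by (intro ennpowr_mono) auto
  then show ?thesis using q by (simp add: ennpowr_ennpowr)
qed

lemma japanese_ge_1: "1 \<le> japanese k"
  unfolding japanese_def by simp

lemma japanese_pos: "0 < japanese k"
  using japanese_ge_1[of k] by linarith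

lemma norm_le_japanese: "norm k \<le> japanese k"
  unfolding japanese_def by (rule real_le_rsqrt) simp

lemma japanese_le: "japanese k \<le> 1 + norm k"
  unfolding japanese_def by (rule real_le_lsqrt) (auto simp: power2_eq_square algebra_simps)

text \<open>
  The lattice points \<open>l\<close> for which \<open>\<box>\<^sub>l f\<close> can contribute to \<open>\<box>\<^sub>k (T f)\<close>; the last coordinate of \<open>l\<close>
  is free.
\<close>

definition freq_near :: "'a::euclidean_space \<Rightarrow> 'a \<times> real \<Rightarrow> bool" where
  "freq_near k l \<longleftrightarrow> (\<forall>b\<in>Basis. \<bar>fst l \<bullet> b - k \<bullet> b\<bar> \<le> 1)"

lemma japanese_near:
  fixes k :: "'a::euclidean_space"
  assumes "freq_near k l"
  shows "japanese k \<le> (2 + real DIM('a)) * japanese l"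
proof -
  have "norm (k - fst l) \<le> (\<Sum>b\<in>(Basis::'a set). \<bar>(k - fst l) \<bullet> b\<bar>)"
    by (rule norm_le_l1)
  also have "\<dots> \<le> (\<Sum>b\<in>(Basis::'a set). 1)"
    using assms by (intro sum_mono) (auto simp: freq_near_def inner_diff_left abs_minus_commute)
  finally have "norm (k - fst l) \<le> real DIM('a)" by simp
  moreover have "norm k \<le> norm (fst l) + norm (k - fst l)"
    using norm_triangle_ineq[of "fst l" "k - fst l"] by simp
  moreover have "norm (fst l) \<le> norm l"
    using norm_fst_le[of "fst l" "snd l"] by simp
  ultimately have "japanese k \<le> 1 + (japanese l + real DIM('a))"
    using japanese_le[of k] norm_le_japanese[of l] by linarith
  also have "\<dots> \<le> japanese l + (japanese l + real DIM('a) * japanese l)"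
    using japanese_ge_1[of l] by (intro add_mono order_refl) (auto simp: mult_le_cancel_left1)
  finally show ?thesis by (simp add: algebra_simps)
qed

definition unit_offsets :: "'a::euclidean_space set" where
  "unit_offsets = {m. \<forall>b\<in>Basis. m \<bullet> b \<in> {-1, 0, 1}}"

lemma finite_unit_offsets: "finite (unit_offsets :: 'a::euclidean_space set)"
  unfolding unit_offsets_def by (rule finite_coord_box) simp

lemma freq_near_offset:
  assumes "k \<in> int_lattice" "l \<in> int_lattice" "freq_near k l"
  shows "fst l - k \<in> unit_offsets"
  unfolding unit_offsets_def mem_Collect_eq
proof
  fix b :: 'a assume b: "b \<in> Basis"
  have "fst l \<bullet> b \<in> \<int>" "k \<bullet> b \<in> \<int>"
    using assms b int_lattice_Pair[of "fst l" "snd l"] by (auto simp: int_lattice_def)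
  then obtain i where i: "(fst l - k) \<bullet> b = of_int i"
    by (metis Ints_cases Ints_diff inner_diff_left)
  have "\<bar>of_int i :: real\<bar> \<le> 1"
    using assms(3) b i by (auto simp: freq_near_def inner_diff_left)
  then have "\<bar>i\<bar> \<le> 1" by linarith
  then have "i \<in> {-1, 0, 1}" by auto
  then show "(fst l - k) \<bullet> b \<in> {-1, 0, 1}" using i by auto
qed

lemma count_freq_near:
  fixes l :: "'a::euclidean_space \<times> real"
  assumes l: "l \<in> int_lattice"
  shows "(\<integral>\<^sup>+k. indicator {k. freq_near k l} k \<partial>count_space int_lattice)
    \<le> ennreal (real (card (unit_offsets :: 'a set)))"
proof -
  let ?S = "(\<lambda>m. fst l - m) ` (unit_offsets :: 'a set)"
  have "{k \<in> int_lattice. freq_near k l} \<subseteq> ?S"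
  proof
    fix k assume "k \<in> {k \<in> int_lattice. freq_near k l}"
    then have "fst l - k \<in> unit_offsets" using freq_near_offset[of k l] l by auto
    then show "k \<in> ?S" by (intro image_eqI[of _ _ "fst l - k"]) auto
  qed
  then have sub: "int_lattice \<inter> {k. freq_near k l} \<subseteq> ?S" by auto
  have "(\<integral>\<^sup>+k. indicator {k. freq_near k l} k \<partial>count_space int_lattice)
      = (\<integral>\<^sup>+k. indicator (int_lattice \<inter> {k. freq_near k l}) k \<partial>count_space int_lattice)"
    by (rule nn_integral_cong) (simp add: indicator_def)
  also have "\<dots> = emeasure (count_space int_lattice) (int_lattice \<inter> {k. freq_near k l})"
    by (rule nn_integral_indicator) simp
  also have "\<dots> = ennreal (real (card (int_lattice \<inter> {k. freq_near k l})))"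
    using finite_subset[OF sub finite_imageI[OF finite_unit_offsets]]
    by (simp add: emeasure_count_space_finite ennreal_of_nat_eq_real_of_nat)
  also have "card (int_lattice \<inter> {k. freq_near k l}) \<le> card (unit_offsets :: 'a set)"
    using card_mono[OF finite_imageI[OF finite_unit_offsets] sub] card_image_le[OF finite_unit_offsets]
    by (meson order_trans)
  finally show ?thesis by (simp add: ennreal_leI)
qed

lemma sum_integers_powr:
  assumes r: "1 < r"
  shows "\<exists>M>0. (\<integral>\<^sup>+j. ennreal ((1 + \<bar>j\<bar>) powr - r) \<partial>count_space (\<int> :: real set)) \<le> ennreal M"
proof -
  let ?f = "\<lambda>j::real. ennreal ((1 + \<bar>j\<bar>) powr - r)"
  have sm: "summable (\<lambda>n. (1 + real n) powr - r)"
    using r summable_real_powr_iff[of "- r"] summable_Suc_iff[of "\<lambda>n. real n powr - r"] by (simp add: add.commute)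
  define M where "M = (\<Sum>n. (1 + real n) powr - r)"
  have M0: "0 \<le> M" unfolding M_def by (intro suminf_nonneg sm) auto
  have half: "(\<integral>\<^sup>+j. ?f j \<partial>count_space (range g)) = ennreal M"
    if g: "inj g" "\<And>n. \<bar>g n\<bar> = real n" for g :: "nat \<Rightarrow> real"
  proof -
    have "(\<integral>\<^sup>+j. ?f j \<partial>count_space (range g)) = (\<integral>\<^sup>+n. ?f (g n) \<partial>count_space UNIV)"
      using g(1) by (intro nn_integral_bij_count_space[symmetric] inj_on_imp_bij_betw)
    also have "\<dots> = (\<Sum>n. ennreal ((1 + real n) powr - r))"
      by (simp add: nn_integral_count_space_nat g(2))
    also have "\<dots> = ennreal M"
      unfolding M_def by (intro suminf_ennreal2 sm) auto
    finally show ?thesis .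
  qed
  have Ints: "(\<int> :: real set) \<subseteq> range real \<union> range (\<lambda>n. - real n)"
  proof
    fix x :: real assume "x \<in> \<int>"
    then obtain i where i: "x = of_int i" by (elim Ints_cases)
    show "x \<in> range real \<union> range (\<lambda>n. - real n)"
    proof (cases "0 \<le> i")
      case True
      then have "x = real (nat i)" using i by simp
      then show ?thesis by blast
    next
      case False
      then have "x = - real (nat (- i))" using i by simp
      then show ?thesis by blast
    qed
  qed
  have "(\<integral>\<^sup>+j. ?f j \<partial>count_space \<int>) = (\<integral>\<^sup>+j. ?f j * indicator \<int> j \<partial>count_space UNIV)"
    by (rule nn_integral_count_space_indicator) simp
  also have "\<dots> \<le> (\<integral>\<^sup>+j. ?f j * indicator (range real) j + ?f j * indicator (range (\<lambda>n. - real n)) j \<partial>count_space UNIV)"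
    using Ints by (intro nn_integral_mono) (auto simp: indicator_def)
  also have "\<dots> = (\<integral>\<^sup>+j. ?f j \<partial>count_space (range real)) + (\<integral>\<^sup>+j. ?f j \<partial>count_space (range (\<lambda>n. - real n)))"
    by (simp add: nn_integral_add nn_integral_count_space_indicator)
  also have "\<dots> = ennreal (M + M)"
    using half[of real] half[of "\<lambda>n. - real n"] M0 by (simp add: inj_def flip: ennreal_plus)
  also have "\<dots> \<le> ennreal (M + M + 1)"
    by (intro ennreal_leI) simp
  finally show ?thesis using M0 by (intro exI[of _ "M + M + 1"]) auto
qed

lemma int_lattice_eq_Ints: "int_lattice = (\<int> :: real set)"
  by (simp add: int_lattice_def)

lemma sum_freq_near_powr:
  assumes r: "1 < r"
  shows "\<exists>M>0. \<forall>k\<in>(int_lattice :: 'a::euclidean_space set).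
    (\<integral>\<^sup>+l. ennreal (indicator {l. freq_near k l} l * (1 + \<bar>snd l\<bar>) powr - r) \<partial>count_space int_lattice) \<le> ennreal M"
proof -
  let ?N = "unit_offsets :: 'a set"
  let ?f = "\<lambda>j::real. ennreal ((1 + \<bar>j\<bar>) powr - r)"
  obtain M where M: "0 < M" "(\<integral>\<^sup>+j. ?f j \<partial>count_space \<int>) \<le> ennreal M"
    using sum_integers_powr[OF r] by blast
  have fiber: "(\<integral>\<^sup>+l. indicator {v} (fst l) * ?f (snd l) \<partial>count_space int_lattice) \<le> ennreal M" for v :: 'a
  proof -
    let ?L = "{l \<in> int_lattice. fst l = v} :: ('a \<times> real) set"
    have "(\<integral>\<^sup>+l. indicator {v} (fst l) * ?f (snd l) \<partial>count_space int_lattice) =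
        (\<integral>\<^sup>+l. ?f (snd l) \<partial>count_space ?L)"
      by (simp add: nn_integral_count_space_indicator)
        (auto intro!: nn_integral_cong simp: indicator_def)
    also have "\<dots> \<le> (\<integral>\<^sup>+j. ?f j \<partial>count_space \<int>)"
    proof (cases "?L = {}")
      case False
      then have v: "v \<in> int_lattice" using int_lattice_Pair by force
      have "bij_betw (Pair v) \<int> ?L"
        by (rule bij_betwI[where g = snd]) (use v in \<open>auto simp: int_lattice_Pair int_lattice_eq_Ints\<close>)
      from nn_integral_bij_count_space[OF this, of "\<lambda>l. ?f (snd l)"] show ?thesis by simp
    next
      case True
      show ?thesis unfolding True by (simp add: nn_integral_empty)
    qed
    finally show ?thesis using M(2) by (rule order_trans)
  qed
  have "(\<integral>\<^sup>+l. ennreal (indicator {l. freq_near k l} l * (1 + \<bar>snd l\<bar>) powr - r) \<partial>count_space int_lattice)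
      \<le> ennreal (real (card ?N) * M + 1)" if k: "k \<in> int_lattice" for k :: 'a
  proof -
    have "(\<integral>\<^sup>+l. ennreal (indicator {l. freq_near k l} l * (1 + \<bar>snd l\<bar>) powr - r) \<partial>count_space int_lattice)
        \<le> (\<integral>\<^sup>+l. (\<Sum>m\<in>?N. indicator {k + m} (fst l) * ?f (snd l)) \<partial>count_space int_lattice)"
    proof (rule nn_integral_mono)
      fix l :: "'a \<times> real" assume l: "l \<in> space (count_space int_lattice)"
      show "ennreal (indicator {l. freq_near k l} l * (1 + \<bar>snd l\<bar>) powr - r)
          \<le> (\<Sum>m\<in>?N. indicator {k + m} (fst l) * ?f (snd l))"
      proof (cases "freq_near k l")
        case True
        then have "fst l - k \<in> ?N" using freq_near_offset[of k l] k l by auto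
        then have "indicator {k + (fst l - k)} (fst l) * ?f (snd l) \<le> (\<Sum>m\<in>?N. indicator {k + m} (fst l) * ?f (snd l))"
          by (rule member_le_sum[OF _ _ finite_unit_offsets]) simp
        then show ?thesis using True by simp
      qed simp
    qed
    also have "\<dots> = (\<Sum>m\<in>?N. \<integral>\<^sup>+l. indicator {k + m} (fst l) * ?f (snd l) \<partial>count_space int_lattice)"
      by (rule nn_integral_sum) simp
    also have "\<dots> \<le> (\<Sum>m\<in>?N. ennreal M)"
      by (intro sum_mono fiber)
    also have "\<dots> = ennreal (real (card ?N) * M)"
      using M(1) by (simp add: ennreal_mult ennreal_of_nat_eq_real_of_nat)
    also have "\<dots> \<le> ennreal (real (card ?N) * M + 1)"
      by (intro ennreal_leI) simp
    finally show ?thesis .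
  qed
  moreover have "0 < real (card ?N) * M + 1"
    using M(1) by (simp add: add_nonneg_pos)
  ultimately show ?thesis by blast
qed

text \<open>
  Here the loss of smoothness arises.  For \<open>q \<le> 1\<close> the \<open>q\<close>-th power is subadditive.  For
  \<open>q > 1\<close> Hoelder's inequality is applied with the summable weight \<open>(1 + |j|)\<^sup>-\<^sup>r\<close> in the last coordinate
  \<open>j\<close>, at the cost of the factor \<open>(1 + |j|)\<close> to the power \<open>r (q - 1)\<close>.  That this power be \<open>\<kappa>\<close> means
  \<open>r = 1 + \<epsilon> q / (q - 1)\<close>, so summability is where \<open>\<epsilon> > 0\<close> is used.
\<close>

lemma freq_near_sum_powr_le:
  fixes q \<epsilon> :: real
  assumes q: "0 < q" and e: "0 < \<epsilon>"
  defines "\<kappa> \<equiv> (1 / min 1 q - 1 / q + \<epsilon>) * q"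
  shows "\<exists>C>0. \<forall>k\<in>(int_lattice :: 'a::euclidean_space set). \<forall>h :: 'a \<times> real \<Rightarrow> real.
    (\<forall>l\<in>int_lattice. 0 \<le> h l) \<longrightarrow> (\<forall>l\<in>int_lattice. \<not> freq_near k l \<longrightarrow> h l = 0) \<longrightarrow>
    ennpowr (\<integral>\<^sup>+l. ennreal (h l) \<partial>count_space int_lattice) q
      \<le> ennreal C * (\<integral>\<^sup>+l. indicator {l. freq_near k l} l * ennreal (japanese l powr \<kappa> * h l powr q) \<partial>count_space int_lattice)"
proof (cases "q \<le> 1")
  case True
  then have \<kappa>: "0 \<le> \<kappa>" using q e by (simp add: \<kappa>_def min_def)
  have "ennpowr (\<integral>\<^sup>+l. ennreal (h l) \<partial>count_space int_lattice) q
      \<le> ennreal 1 * (\<integral>\<^sup>+l. indicator {l. freq_near k l} l * ennreal (japanese l powr \<kappa> * h l powr q) \<partial>count_space int_lattice)"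
    if nn: "\<forall>l\<in>int_lattice. 0 \<le> h l" and z: "\<forall>l\<in>int_lattice. \<not> freq_near k l \<longrightarrow> h l = 0"
    for k :: 'a and h :: "'a \<times> real \<Rightarrow> real"
  proof -
    have "ennpowr (\<integral>\<^sup>+l. ennreal (h l) \<partial>count_space int_lattice) q
        \<le> (\<integral>\<^sup>+l. ennpowr (ennreal (h l)) q \<partial>count_space int_lattice)"
      by (rule ennpowr_nn_integral_count_space_le[OF q True countable_int_lattice])
    also have "\<dots> \<le> (\<integral>\<^sup>+l. indicator {l. freq_near k l} l * ennreal (japanese l powr \<kappa> * h l powr q) \<partial>count_space int_lattice)"
    proof (rule nn_integral_mono)
      fix l :: "'a \<times> real" assume "l \<in> space (count_space int_lattice)"
      then have l: "l \<in> int_lattice" by simp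
      have "1 * h l powr q \<le> japanese l powr \<kappa> * h l powr q"
        using \<kappa> japanese_ge_1[of l] by (intro mult_right_mono ge_one_powr_ge_zero) auto
      then show "ennpowr (ennreal (h l)) q \<le> indicator {l. freq_near k l} l * ennreal (japanese l powr \<kappa> * h l powr q)"
        using nn z l by (cases "freq_near k l") (auto simp: ennpowr_ennreal ennreal_leI)
    qed
    finally show ?thesis by simp
  qed
  then show ?thesis by (intro exI[of _ 1]) auto
next
  case False
  then have q1: "1 < q" by simp
  have \<kappa>: "\<kappa> = q - 1 + \<epsilon> * q" using q1 by (simp add: \<kappa>_def min_def field_simps)
  define r where "r = \<kappa> / (q - 1)"
  have r: "1 < r" unfolding r_def \<kappa> using q1 e by (simp add: field_simps)
  have r\<kappa>: "r * (q - 1) = \<kappa>" unfolding r_def using q1 by simp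
  have \<kappa>0: "0 \<le> \<kappa>" unfolding \<kappa> using q1 e by simp
  obtain M where M: "0 < M" "\<And>k. k \<in> (int_lattice :: 'a set) \<Longrightarrow>
      (\<integral>\<^sup>+l. ennreal (indicator {l. freq_near k l} l * (1 + \<bar>snd l\<bar>) powr - r) \<partial>count_space int_lattice) \<le> ennreal M"
    using sum_freq_near_powr[OF r, where 'a='a] by blast
  have "ennpowr (\<integral>\<^sup>+l. ennreal (h l) \<partial>count_space int_lattice) q
      \<le> ennreal (M powr (q - 1) * 2 powr \<kappa>) * (\<integral>\<^sup>+l. indicator {l. freq_near k l} l * ennreal (japanese l powr \<kappa> * h l powr q) \<partial>count_space int_lattice)"
    if k: "k \<in> int_lattice" and nn: "\<forall>l\<in>int_lattice. 0 \<le> h l" and z: "\<forall>l\<in>int_lattice. \<not> freq_near k l \<longrightarrow> h l = 0"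
    for k :: 'a and h :: "'a \<times> real \<Rightarrow> real"
  proof -
    define m where "m = (\<lambda>l::'a \<times> real. indicator {l. freq_near k l} l * (1 + \<bar>snd l\<bar>) powr - r :: real)"
    define v where "v = (\<lambda>l. \<bar>h l\<bar> * (1 + \<bar>snd l\<bar>) powr r)"
    have "ennpowr (\<integral>\<^sup>+l. ennreal (h l) \<partial>count_space int_lattice) q =
        ennpowr (\<integral>\<^sup>+l. ennreal (v l * m l) \<partial>count_space int_lattice) q"
    proof (intro arg_cong2[where f = ennpowr] nn_integral_cong refl)
      fix l :: "'a \<times> real" assume "l \<in> space (count_space int_lattice)"
      then have l: "l \<in> int_lattice" by simp
      have "(1 + \<bar>snd l\<bar>) powr r * (1 + \<bar>snd l\<bar>) powr - r = 1"
        by (simp flip: powr_add)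
      then have "v l * m l = h l"
        using nn z l by (cases "freq_near k l") (simp_all add: v_def m_def mult.assoc)
      then show "ennreal (h l) = ennreal (v l * m l)" by simp
    qed
    also have "\<dots> \<le> ennreal (M powr (q - 1)) * (\<integral>\<^sup>+l. ennreal (v l powr q * m l) \<partial>count_space int_lattice)"
      using q1 M(1) M(2)[OF k] by (intro nn_integral_powr_Jensen) (auto simp: v_def m_def)
    also have "\<dots> \<le> ennreal (M powr (q - 1)) * (\<integral>\<^sup>+l. ennreal (2 powr \<kappa>) * (indicator {l. freq_near k l} l * ennreal (japanese l powr \<kappa> * h l powr q)) \<partial>count_space int_lattice)"
    proof (intro mult_left_mono nn_integral_mono)
      fix l :: "'a \<times> real" assume "l \<in> space (count_space int_lattice)"
      then have l: "l \<in> int_lattice" by simp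
      have "\<bar>snd l\<bar> \<le> norm l" using norm_snd_le[of "snd l" "fst l"] by simp
      then have "1 + \<bar>snd l\<bar> \<le> 2 * japanese l"
        using japanese_ge_1[of l] norm_le_japanese[of l] by linarith
      then have "(1 + \<bar>snd l\<bar>) powr \<kappa> \<le> (2 * japanese l) powr \<kappa>"
        using \<kappa>0 by (intro powr_mono2) auto
      then have "h l powr q * (1 + \<bar>snd l\<bar>) powr \<kappa> \<le> h l powr q * (2 * japanese l) powr \<kappa>"
        by (rule mult_left_mono) simp
      moreover have "((1 + \<bar>snd l\<bar>) powr r) powr q * (1 + \<bar>snd l\<bar>) powr - r = (1 + \<bar>snd l\<bar>) powr \<kappa>"
        using r\<kappa> by (simp add: powr_powr algebra_simps flip: powr_add)
      then have "v l powr q * (1 + \<bar>snd l\<bar>) powr - r = h l powr q * (1 + \<bar>snd l\<bar>) powr \<kappa>"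
        using nn l by (simp add: v_def powr_mult mult.assoc)
      ultimately have "v l powr q * (1 + \<bar>snd l\<bar>) powr - r \<le> 2 powr \<kappa> * (japanese l powr \<kappa> * h l powr q)"
        using japanese_pos[of l] by (simp add: powr_mult mult_ac)
      then show "ennreal (v l powr q * m l) \<le> ennreal (2 powr \<kappa>) * (indicator {l. freq_near k l} l * ennreal (japanese l powr \<kappa> * h l powr q))"
        by (cases "freq_near k l") (auto simp: m_def ennreal_leI simp flip: ennreal_mult)
    qed simp
    also have "\<dots> = ennreal (M powr (q - 1) * 2 powr \<kappa>) * (\<integral>\<^sup>+l. indicator {l. freq_near k l} l * ennreal (japanese l powr \<kappa> * h l powr q) \<partial>count_space int_lattice)"
      by (subst nn_integral_cmult) (auto simp: ennreal_mult mult.assoc)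
    finally show ?thesis .
  qed
  moreover have "0 < M powr (q - 1) * 2 powr \<kappa>" using M(1) by simp
  ultimately show ?thesis by blast
qed

section \<open>The trace estimate\<close>

context
  fixes \<eta> :: "real \<Rightarrow> real"
  assumes \<eta>: "cutoff \<eta>"
begin

text \<open>
  Summing the averaged inequality for \<open>|\<box>\<^sub>l f|\<^sup>q\<close> over a finite set of \<open>l\<close> with weights \<open>c l\<close> gives the
  hypothesis of \<open>Peetre_maximal\<close> for the sum, now with exponent \<open>p / q\<close>.  The maximal bound is
  integrated against \<open>wt\<^sup>-\<^sup>2\<close>, whence the exponent \<open>a + 2\<close>.  Finite sets keep the sum bounded, and
  the constant does not depend on them, so the estimate passes to the full lattice.
\<close>

lemma square_function_bound:
  fixes p q :: real
  assumes p: "0 < p" and q: "0 < q"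
  defines "a \<equiv> 2 * max 1 (1 / (p / q))"
  shows "\<exists>C>0. \<forall>f\<in>schwartz. \<forall>c. (\<forall>l. 0 \<le> c l) \<longrightarrow> (\<forall>x :: 'a::euclidean_space \<times> real.
    ennpowr (\<integral>\<^sup>+l. \<integral>\<^sup>+z. ennreal (c l * norm (box_op \<eta> l f z) powr q * wt (x - z) powr - (a + 2)) \<partial>lborel \<partial>count_space int_lattice) (p / q)
      \<le> ennreal C * (\<integral>\<^sup>+z. ennpowr (\<integral>\<^sup>+l. ennreal (c l * norm (box_op \<eta> l f z) powr q) \<partial>count_space int_lattice) (p / q)
            * ennreal (wt (x - z) powr - 2) \<partial>lborel))"
proof -
  define t where "t = p / q"
  have t: "0 < t" using p q by (simp add: t_def)
  have a: "0 \<le> a" by (simp add: a_def)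
  have a_eq: "a = 2 * max 1 (1 / t)" by (simp only: a_def t_def)
  obtain C1 where C1: "0 < C1" "\<And>l f x. l \<in> int_lattice \<Longrightarrow> f \<in> schwartz \<Longrightarrow>
      ennreal (norm (box_op \<eta> l f (x :: 'a \<times> real)) powr q)
        \<le> ennreal C1 * (\<integral>\<^sup>+z. ennreal (norm (box_op \<eta> l f z) powr q * wt (x - z) powr - (a + 2)) \<partial>lborel)"
    using box_op_trace_piece_bound[OF \<eta> q, of "a + 2", where 'a='a] a by auto
  obtain C2 where C2: "0 < C2"
    "\<And>(u::'a \<times> real \<Rightarrow> real) B x y. u \<in> borel_measurable borel \<Longrightarrow> (\<And>x. 0 \<le> u x \<and> u x \<le> B) \<Longrightarrow>
      (\<And>x. ennreal (u x) \<le> ennreal C1 * (\<integral>\<^sup>+z. ennreal (u z * wt (x - z) powr - a) \<partial>lborel)) \<Longrightarrow>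
      ennreal ((u y * wt (x - y) powr - a) powr t)
       \<le> ennreal C2 * (\<integral>\<^sup>+z. ennreal (u z powr t * wt (x - z) powr - 2) \<partial>lborel)"
    using Peetre_maximal[OF t order_refl C1(1), where 'a="'a \<times> real"] unfolding a_eq[symmetric] by meson
  define J where "J = wt_mass TYPE('a \<times> real)"
  have J: "0 < J" unfolding J_def by (rule wt_mass_pos)
  have "ennpowr (\<integral>\<^sup>+l. \<integral>\<^sup>+z. ennreal (c l * norm (box_op \<eta> l f z) powr q * wt (x - z) powr - (a + 2)) \<partial>lborel \<partial>count_space int_lattice) t
      \<le> ennreal (J powr t * C2) * (\<integral>\<^sup>+z. ennpowr (\<integral>\<^sup>+l. ennreal (c l * norm (box_op \<eta> l f z) powr q) \<partial>count_space int_lattice) t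
            * ennreal (wt (x - z) powr - 2) \<partial>lborel)" (is "ennpowr ?L t \<le> ?R")
    if f: "f \<in> schwartz" and c: "\<forall>l. 0 \<le> c l" for f and c :: "'a \<times> real \<Rightarrow> real" and x
  proof -
    have c0: "0 \<le> c l" for l using c by (rule spec)
    have "?L \<le> ennpowr ?R (1 / t)"
    proof (rule nn_integral_count_space_leI[OF countable_int_lattice])
      fix A :: "('a \<times> real) set" assume A: "finite A" "A \<subseteq> int_lattice"
      have meas: "l \<in> A \<Longrightarrow> box_op \<eta> l f \<in> borel_measurable borel" for l
        using measurable_box_op[OF \<eta> _ f, of l] A by auto
      have [measurable]: "l \<in> A \<Longrightarrow> (\<lambda>z. norm (box_op \<eta> l f z) powr q) \<in> borel_measurable borel" for l
        using meas[of l] by measurable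
      define u where "u = (\<lambda>z. \<Sum>l\<in>A. c l * norm (box_op \<eta> l f z) powr q)"
      have [measurable]: "u \<in> borel_measurable borel" unfolding u_def by measurable
      have u0: "0 \<le> u z" for z unfolding u_def by (intro sum_nonneg mult_nonneg_nonneg c0) simp
      obtain B where B: "\<And>l z. l \<in> A \<Longrightarrow> norm (box_op \<eta> l f z) \<le> B l"
      proof -
        have "\<exists>B. \<forall>z. norm (box_op \<eta> l f z) \<le> B" if "l \<in> A" for l
          using box_op_bounded[OF \<eta> _ f, of l] A that by blast
        then have "\<exists>B. \<forall>l\<in>A. \<forall>z. norm (box_op \<eta> l f z) \<le> B l" by (intro bchoice) blast
        then show thesis using that by blast
      qed
      have uB: "u z \<le> (\<Sum>l\<in>A. c l * B l powr q)" for z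
        unfolding u_def using q B by (intro sum_mono mult_left_mono powr_mono2 c0) auto
      have sum_int: "(\<integral>\<^sup>+z. ennreal (u z * w z) \<partial>lborel)
          = (\<Sum>l\<in>A. \<integral>\<^sup>+z. ennreal (c l * norm (box_op \<eta> l f z) powr q * w z) \<partial>lborel)"
        if [measurable]: "w \<in> borel_measurable borel" and w: "\<And>z. 0 \<le> w z" for w
      proof -
        have "(\<integral>\<^sup>+z. ennreal (u z * w z) \<partial>lborel) = (\<integral>\<^sup>+z. (\<Sum>l\<in>A. ennreal (c l * norm (box_op \<eta> l f z) powr q * w z)) \<partial>lborel)"
          unfolding u_def sum_distrib_right
          by (intro nn_integral_cong sum_ennreal[symmetric] mult_nonneg_nonneg c0 w powr_ge_zero)
        also have "\<dots> = (\<Sum>l\<in>A. \<integral>\<^sup>+z. ennreal (c l * norm (box_op \<eta> l f z) powr q * w z) \<partial>lborel)"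
          by (rule nn_integral_sum) measurable
        finally show ?thesis .
      qed
      have self: "ennreal (u y) \<le> ennreal C1 * (\<integral>\<^sup>+z. ennreal (u z * wt (y - z) powr - a) \<partial>lborel)" for y
      proof -
        have "ennreal (u y) = (\<Sum>l\<in>A. ennreal (c l) * ennreal (norm (box_op \<eta> l f y) powr q))"
          unfolding u_def by (simp add: c0 sum_ennreal flip: ennreal_mult)
        also have "\<dots> \<le> (\<Sum>l\<in>A. ennreal (c l) * (ennreal C1 * (\<integral>\<^sup>+z. ennreal (norm (box_op \<eta> l f z) powr q * wt (y - z) powr - (a + 2)) \<partial>lborel)))"
          using A by (intro sum_mono mult_left_mono C1 f) auto
        also have "\<dots> = ennreal C1 * (\<Sum>l\<in>A. \<integral>\<^sup>+z. ennreal (c l * norm (box_op \<eta> l f z) powr q * wt (y - z) powr - (a + 2)) \<partial>lborel)"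
          unfolding sum_distrib_left
        proof (rule sum.cong[OF refl])
          fix l assume "l \<in> A"
          then have [measurable]: "(\<lambda>z. norm (box_op \<eta> l f z) powr q) \<in> borel_measurable borel" by measurable
          have "(\<integral>\<^sup>+z. ennreal (c l * norm (box_op \<eta> l f z) powr q * wt (y - z) powr - (a + 2)) \<partial>lborel)
              = ennreal (c l) * (\<integral>\<^sup>+z. ennreal (norm (box_op \<eta> l f z) powr q * wt (y - z) powr - (a + 2)) \<partial>lborel)"
            by (subst nn_integral_cmult[symmetric]) (auto simp: c0 ennreal_mult mult.assoc)
          then show "ennreal (c l) * (ennreal C1 * (\<integral>\<^sup>+z. ennreal (norm (box_op \<eta> l f z) powr q * wt (y - z) powr - (a + 2)) \<partial>lborel))
              = ennreal C1 * (\<integral>\<^sup>+z. ennreal (c l * norm (box_op \<eta> l f z) powr q * wt (y - z) powr - (a + 2)) \<partial>lborel)"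
            by (simp only: mult.left_commute)
        qed
        also have "\<dots> = ennreal C1 * (\<integral>\<^sup>+z. ennreal (u z * wt (y - z) powr - (a + 2)) \<partial>lborel)"
          by (subst sum_int) auto
        also have "\<dots> \<le> ennreal C1 * (\<integral>\<^sup>+z. ennreal (u z * wt (y - z) powr - a) \<partial>lborel)"
          using u0 by (intro mult_left_mono nn_integral_mono ennreal_leI powr_mono wt_ge_1) auto
        finally show ?thesis .
      qed
      have le_U: "ennreal (u z powr t) \<le> ennpowr (\<integral>\<^sup>+l. ennreal (c l * norm (box_op \<eta> l f z) powr q) \<partial>count_space int_lattice) t" for z
      proof -
        have "ennreal (u z) = (\<Sum>l\<in>A. ennreal (c l * norm (box_op \<eta> l f z) powr q))"
          unfolding u_def by (simp add: c0 sum_ennreal)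
        also have "\<dots> \<le> (\<integral>\<^sup>+l. ennreal (c l * norm (box_op \<eta> l f z) powr q) \<partial>count_space int_lattice)"
          by (rule sum_le_nn_integral_count_space[OF A])
        finally have "ennpowr (ennreal (u z)) t \<le> ennpowr (\<integral>\<^sup>+l. ennreal (c l * norm (box_op \<eta> l f z) powr q) \<partial>count_space int_lattice) t"
          using t by (intro ennpowr_mono) auto
        then show ?thesis using u0 by (simp add: ennpowr_ennreal)
      qed
      have "ennpowr (\<integral>\<^sup>+z. ennreal (u z * wt (x - z) powr - (a + 2)) \<partial>lborel) t
          \<le> ennreal (J powr t * C2) * (\<integral>\<^sup>+z. ennreal (u z powr t * wt (x - z) powr - 2) \<partial>lborel)"
      proof (cases "\<integral>\<^sup>+z. ennreal (u z powr t * wt (x - z) powr - 2) \<partial>lborel")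
        case top
        then show ?thesis using J C2(1) by (simp add: ennreal_mult_top)
      next
        case (real i)
        define v where "v = (C2 * i) powr (1 / t)"
        have v0: "0 \<le> v" by (simp add: v_def)
        have v: "u y * wt (x - y) powr - a \<le> v" for y
        proof -
          have "ennreal ((u y * wt (x - y) powr - a) powr t) \<le> ennreal (C2 * i)"
            using C2(2)[of u "\<Sum>l\<in>A. c l * B l powr q" y x] u0 uB self C2(1) real by (simp add: ennreal_mult)
          then have "(u y * wt (x - y) powr - a) powr t \<le> C2 * i"
            using C2(1) real by simp
          then have "((u y * wt (x - y) powr - a) powr t) powr (1 / t) \<le> v"
            unfolding v_def using t by (intro powr_mono2) auto
          then show ?thesis using t u0 by (simp add: powr_powr)
        qed
        have "(\<integral>\<^sup>+y. ennreal (u y * wt (x - y) powr - (a + 2)) \<partial>lborel)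
            \<le> (\<integral>\<^sup>+y. ennreal v * ennreal (wt (x - y) powr - 2) \<partial>lborel)"
        proof (intro nn_integral_mono)
          fix y
          have "u y * wt (x - y) powr - (a + 2) = (u y * wt (x - y) powr - a) * wt (x - y) powr - 2"
            by (simp add: powr_add[of _ "-a" "-2", simplified])
          also have "\<dots> \<le> v * wt (x - y) powr - 2"
            by (intro mult_right_mono v) auto
          finally show "ennreal (u y * wt (x - y) powr - (a + 2)) \<le> ennreal v * ennreal (wt (x - y) powr - 2)"
            using v0 by (simp add: ennreal_leI flip: ennreal_mult)
        qed
        also have "\<dots> \<le> ennreal v * ennreal J"
          unfolding J_def by (subst nn_integral_cmult) (auto intro!: mult_left_mono nn_integral_wt)
        finally have "ennpowr (\<integral>\<^sup>+y. ennreal (u y * wt (x - y) powr - (a + 2)) \<partial>lborel) t \<le> ennpowr (ennreal v * ennreal J) t"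
          using t by (intro ennpowr_mono) auto
        also have "\<dots> = ennreal (v powr t * J powr t)"
          using v0 J by (simp add: ennpowr_mult ennpowr_ennreal ennreal_mult)
        also have "v powr t * J powr t = J powr t * C2 * i"
          using t C2(1) real by (simp add: v_def powr_powr)
        finally show ?thesis using real C2(1) by (simp add: ennreal_mult)
      qed
      also have "\<dots> \<le> ?R"
      proof (intro mult_left_mono nn_integral_mono)
        fix z
        have "ennreal (u z powr t * wt (x - z) powr - 2) = ennreal (u z powr t) * ennreal (wt (x - z) powr - 2)"
          by (simp add: ennreal_mult)
        also have "\<dots> \<le> ennpowr (\<integral>\<^sup>+l. ennreal (c l * norm (box_op \<eta> l f z) powr q) \<partial>count_space int_lattice) t
            * ennreal (wt (x - z) powr - 2)"
          by (intro mult_right_mono le_U) auto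
        finally show "ennreal (u z powr t * wt (x - z) powr - 2) \<le> ennpowr (\<integral>\<^sup>+l. ennreal (c l * norm (box_op \<eta> l f z) powr q) \<partial>count_space int_lattice) t
            * ennreal (wt (x - z) powr - 2)" .
      qed simp
      finally show "(\<Sum>l\<in>A. \<integral>\<^sup>+z. ennreal (c l * norm (box_op \<eta> l f z) powr q * wt (x - z) powr - (a + 2)) \<partial>lborel) \<le> ennpowr ?R (1 / t)"
        by (subst (asm) sum_int) (auto intro: ennpowr_le_imp[OF t])
    qed
    then have "ennpowr ?L t \<le> ennpowr (ennpowr ?R (1 / t)) t"
      using t by (intro ennpowr_mono) auto
    then show ?thesis using t by (simp add: ennpowr_ennpowr)
  qed
  moreover have "0 < J powr t * C2" using J C2(1) by simp
  ultimately show ?thesis unfolding t_def by blast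
qed

text \<open>
  Each \<open>l\<close> is near boundedly many \<open>k\<close>, with comparable brackets, so after exchanging the sums
  the sum over \<open>k\<close> only contributes a constant.
\<close>

lemma trace_sequence_bound:
  fixes q s \<epsilon> b :: real
  assumes q: "0 < q" and s: "0 \<le> s" and e: "0 < \<epsilon>" and b: "2 \<le> b"
  defines "\<sigma> \<equiv> s + 1 / min 1 q - 1 / q + \<epsilon>"
  shows "\<exists>C>0. \<forall>f\<in>schwartz. \<forall>x :: 'a::euclidean_space.
    (\<integral>\<^sup>+k. ennreal (japanese k powr (s * q) * norm (box_op \<eta> k (trace_op f) x) powr q) \<partial>count_space int_lattice)
     \<le> ennreal C * (\<integral>\<^sup>+l. \<integral>\<^sup>+z. ennreal (japanese l powr (\<sigma> * q) * norm (box_op \<eta> l f z) powr q * wt ((x, 0) - z) powr - b) \<partial>lborel \<partial>count_space int_lattice)"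
proof -
  define \<kappa> where "\<kappa> = (1 / min 1 q - 1 / q + \<epsilon>) * q"
  have \<sigma>: "\<sigma> * q = s * q + \<kappa>" by (simp add: \<sigma>_def \<kappa>_def algebra_simps)
  define D where "D = (2 + real DIM('a)) powr (s * q)"
  have D: "0 < D" unfolding D_def by simp
  define N where "N = real (card (unit_offsets :: 'a set))"
  obtain C1 where C1: "0 < C1" "\<And>l f k x. l \<in> int_lattice \<Longrightarrow> f \<in> schwartz \<Longrightarrow> k \<in> int_lattice \<Longrightarrow>
      ennreal (norm (trace_piece \<eta> k l f (x :: 'a)) powr q)
        \<le> ennreal C1 * (\<integral>\<^sup>+z. ennreal (norm (box_op \<eta> l f z) powr q * wt ((x, 0) - z) powr - b) \<partial>lborel)"
    using box_op_trace_piece_bound[OF \<eta> q b, where 'a='a] by blast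
  obtain C2 where C2: "0 < C2" "\<And>k h. k \<in> (int_lattice :: 'a set) \<Longrightarrow>
    (\<forall>l\<in>int_lattice. 0 \<le> h l) \<Longrightarrow> (\<forall>l\<in>int_lattice. \<not> freq_near k l \<longrightarrow> h l = 0) \<Longrightarrow>
    ennpowr (\<integral>\<^sup>+l. ennreal (h l) \<partial>count_space int_lattice) q
      \<le> ennreal C2 * (\<integral>\<^sup>+l. indicator {l. freq_near k l} l * ennreal (japanese l powr \<kappa> * h l powr q) \<partial>count_space int_lattice)"
    using freq_near_sum_powr_le[OF q e, where 'a='a] unfolding \<kappa>_def by blast
  have "(\<integral>\<^sup>+k. ennreal (japanese k powr (s * q) * norm (box_op \<eta> k (trace_op f) x) powr q) \<partial>count_space int_lattice)
     \<le> ennreal (C2 * D * C1 * N + 1) * (\<integral>\<^sup>+l. \<integral>\<^sup>+z. ennreal (japanese l powr (\<sigma> * q) * norm (box_op \<eta> l f z) powr q * wt ((x, 0) - z) powr - b) \<partial>lborel \<partial>count_space int_lattice)"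
    if f: "f \<in> schwartz" for f and x :: 'a
  proof -
    define V where "V = (\<lambda>l. ennreal (japanese l powr (\<sigma> * q)) * (\<integral>\<^sup>+z. ennreal (norm (box_op \<eta> l f z) powr q * wt ((x, 0) - z) powr - b) \<partial>lborel))"
    have term_le: "ennreal (japanese k powr (s * q) * norm (box_op \<eta> k (trace_op f) x) powr q)
        \<le> (\<integral>\<^sup>+l. ennreal (C2 * D * C1) * (indicator {k. freq_near k l} k * V l) \<partial>count_space int_lattice)"
      if k: "k \<in> int_lattice" for k
    proof -
      have "ennreal (norm (box_op \<eta> k (trace_op f) x) powr q) = ennpowr (ennreal (norm (box_op \<eta> k (trace_op f) x))) q"
        by (simp add: ennpowr_ennreal)
      also have "\<dots> \<le> ennpowr (\<integral>\<^sup>+l. ennreal (norm (trace_piece \<eta> k l f x)) \<partial>count_space int_lattice) q"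
        using q by (intro ennpowr_mono box_op_trace_le \<eta> k f) auto
      also have "\<dots> \<le> ennreal C2 * (\<integral>\<^sup>+l. indicator {l. freq_near k l} l * ennreal (japanese l powr \<kappa> * norm (trace_piece \<eta> k l f x) powr q) \<partial>count_space int_lattice)"
        by (rule C2(2)[OF k]) (auto simp: freq_near_def not_le intro: trace_piece_eq_0[OF \<eta> k])
      finally have "ennreal (japanese k powr (s * q) * norm (box_op \<eta> k (trace_op f) x) powr q)
          \<le> ennreal (japanese k powr (s * q)) * (ennreal C2 * (\<integral>\<^sup>+l. indicator {l. freq_near k l} l * ennreal (japanese l powr \<kappa> * norm (trace_piece \<eta> k l f x) powr q) \<partial>count_space int_lattice))"
        by (simp add: ennreal_mult mult_left_mono)
      also have "\<dots> = (\<integral>\<^sup>+l. ennreal (japanese k powr (s * q)) * (ennreal C2 * (indicator {l. freq_near k l} l * ennreal (japanese l powr \<kappa> * norm (trace_piece \<eta> k l f x) powr q))) \<partial>count_space int_lattice)"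
        by (simp add: nn_integral_cmult)
      also have "\<dots> \<le> (\<integral>\<^sup>+l. ennreal (C2 * D * C1) * (indicator {k. freq_near k l} k * V l) \<partial>count_space int_lattice)"
      proof (rule nn_integral_mono)
        fix l :: "'a \<times> real" assume "l \<in> space (count_space int_lattice)"
        then have l: "l \<in> int_lattice" by simp
        show "ennreal (japanese k powr (s * q)) * (ennreal C2 * (indicator {l. freq_near k l} l * ennreal (japanese l powr \<kappa> * norm (trace_piece \<eta> k l f x) powr q)))
            \<le> ennreal (C2 * D * C1) * (indicator {k. freq_near k l} k * V l)"
        proof (cases "freq_near k l")
          case True
          have "japanese k powr (s * q) \<le> ((2 + real DIM('a)) * japanese l) powr (s * q)"
            using japanese_near[OF True] japanese_pos[of k] s q by (intro powr_mono2) auto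
          also have "\<dots> = D * japanese l powr (s * q)"
            using japanese_pos[of l] by (simp add: D_def powr_mult)
          finally have jk: "japanese k powr (s * q) \<le> D * japanese l powr (s * q)" .
          have "ennreal (japanese k powr (s * q)) * (ennreal C2 * ennreal (japanese l powr \<kappa> * norm (trace_piece \<eta> k l f x) powr q))
              = ennreal (japanese k powr (s * q)) * ennreal C2 * ennreal (japanese l powr \<kappa>) * ennreal (norm (trace_piece \<eta> k l f x) powr q)"
            by (simp add: ennreal_mult mult.assoc)
          also have "\<dots> \<le> ennreal (D * japanese l powr (s * q)) * ennreal C2 * ennreal (japanese l powr \<kappa>) *
              (ennreal C1 * (\<integral>\<^sup>+z. ennreal (norm (box_op \<eta> l f z) powr q * wt ((x, 0) - z) powr - b) \<partial>lborel))"
            by (intro mult_mono ennreal_leI jk C1(2) l f k) auto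
          also have "\<dots> = ennreal (C2 * D * C1) * V l"
            using C2(1) C1(1) D by (simp add: V_def \<sigma> powr_add ennreal_mult mult_ac)
          finally show ?thesis using True by simp
        qed simp
      qed
      finally show ?thesis .
    qed
    have "(\<integral>\<^sup>+k. ennreal (japanese k powr (s * q) * norm (box_op \<eta> k (trace_op f) x) powr q) \<partial>count_space int_lattice)
        \<le> (\<integral>\<^sup>+k. \<integral>\<^sup>+l. ennreal (C2 * D * C1) * (indicator {k. freq_near k l} k * V l) \<partial>count_space int_lattice \<partial>count_space int_lattice)"
      by (intro nn_integral_mono term_le) simp
    also have "\<dots> = (\<integral>\<^sup>+l. \<integral>\<^sup>+k. ennreal (C2 * D * C1) * (indicator {k. freq_near k l} k * V l) \<partial>count_space int_lattice \<partial>count_space int_lattice)"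
      by (rule nn_integral_count_space_nn_integral[OF countable_int_lattice]) simp
    also have "\<dots> = (\<integral>\<^sup>+l. ennreal (C2 * D * C1) * ((\<integral>\<^sup>+k. indicator {k. freq_near k l} k \<partial>count_space int_lattice) * V l) \<partial>count_space int_lattice)"
      by (simp add: nn_integral_cmult nn_integral_multc)
    also have "\<dots> \<le> (\<integral>\<^sup>+l. ennreal (C2 * D * C1) * (ennreal N * V l) \<partial>count_space int_lattice)"
      unfolding N_def by (intro nn_integral_mono mult_left_mono mult_right_mono count_freq_near) auto
    also have "\<dots> = ennreal (C2 * D * C1 * N) * (\<integral>\<^sup>+l. V l \<partial>count_space int_lattice)"
      using C2(1) C1(1) D by (simp add: nn_integral_cmult ennreal_mult N_def mult.assoc)
    also have "\<dots> \<le> ennreal (C2 * D * C1 * N + 1) * (\<integral>\<^sup>+l. V l \<partial>count_space int_lattice)"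
      by (intro mult_right_mono ennreal_leI) auto
    also have "(\<integral>\<^sup>+l. V l \<partial>count_space int_lattice) = (\<integral>\<^sup>+l. \<integral>\<^sup>+z. ennreal (japanese l powr (\<sigma> * q) * norm (box_op \<eta> l f z) powr q * wt ((x, 0) - z) powr - b) \<partial>lborel \<partial>count_space int_lattice)"
    proof (rule nn_integral_cong)
      fix l :: "'a \<times> real" assume "l \<in> space (count_space int_lattice)"
      then have [measurable]: "box_op \<eta> l f \<in> borel_measurable borel"
        using measurable_box_op[OF \<eta> _ f] by simp
      show "V l = (\<integral>\<^sup>+z. ennreal (japanese l powr (\<sigma> * q) * norm (box_op \<eta> l f z) powr q * wt ((x, 0) - z) powr - b) \<partial>lborel)"
        unfolding V_def by (subst nn_integral_cmult[symmetric]) (auto simp: ennreal_mult mult.assoc)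
    qed
    finally show ?thesis .
  qed
  moreover have "0 < C2 * D * C1 * N + 1"
    using C2(1) C1(1) D by (simp add: N_def add_nonneg_pos)
  ultimately show ?thesis by blast
qed

lemma wiener_qnorm_eq:
  fixes f :: "'b::euclidean_space \<Rightarrow> complex"
  assumes p: "0 < p" and q: "0 < q"
  shows "wiener_qnorm \<eta> p q s f =
    ennpowr (\<integral>\<^sup>+x. ennpowr (\<integral>\<^sup>+k. ennreal (japanese k powr (s * q) * norm (box_op \<eta> k f x) powr q) \<partial>count_space int_lattice) (p / q) \<partial>lborel) (1 / p)"
  unfolding wiener_qnorm_def Lp_qnorm_def
  by (simp add: ennpowr_ennreal ennpowr_ennpowr powr_mult powr_powr)

text \<open>
  The two preceding bounds combine to a pointwise inequality between the \<open>p\<close>-th powers, which is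
  integrated over the hyperplane by Tonelli's theorem.
\<close>

lemma trace_bounded_wiener:
  fixes p q s \<epsilon> :: real
  assumes p: "0 < p" and q: "0 < q" and s: "0 \<le> s" and e: "0 < \<epsilon>"
  shows "trace_bounded
    (wiener_qnorm \<eta> p q (s + 1 / min 1 q - 1 / q + \<epsilon>) :: ('a::euclidean_space \<times> real \<Rightarrow> complex) \<Rightarrow> ennreal)
    (wiener_qnorm \<eta> p q s :: ('a \<Rightarrow> complex) \<Rightarrow> ennreal)"
proof -
  define \<sigma> where "\<sigma> = s + 1 / min 1 q - 1 / q + \<epsilon>"
  define a where "a = 2 * max 1 (1 / (p / q))"
  have a: "2 \<le> a + 2" by (simp add: a_def)
  obtain C1 where C1: "0 < C1" "\<And>f c (x :: 'a \<times> real). f \<in> schwartz \<Longrightarrow> (\<forall>l. 0 \<le> c l) \<Longrightarrow>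
    ennpowr (\<integral>\<^sup>+l. \<integral>\<^sup>+z. ennreal (c l * norm (box_op \<eta> l f z) powr q * wt (x - z) powr - (a + 2)) \<partial>lborel \<partial>count_space int_lattice) (p / q)
      \<le> ennreal C1 * (\<integral>\<^sup>+z. ennpowr (\<integral>\<^sup>+l. ennreal (c l * norm (box_op \<eta> l f z) powr q) \<partial>count_space int_lattice) (p / q)
            * ennreal (wt (x - z) powr - 2) \<partial>lborel)"
    using square_function_bound[OF p q, where 'a='a] unfolding a_def by blast
  obtain C2 where C2: "0 < C2" "\<And>f (x :: 'a). f \<in> schwartz \<Longrightarrow>
    (\<integral>\<^sup>+k. ennreal (japanese k powr (s * q) * norm (box_op \<eta> k (trace_op f) x) powr q) \<partial>count_space int_lattice)
     \<le> ennreal C2 * (\<integral>\<^sup>+l. \<integral>\<^sup>+z. ennreal (japanese l powr (\<sigma> * q) * norm (box_op \<eta> l f z) powr q * wt ((x, 0) - z) powr - (a + 2)) \<partial>lborel \<partial>count_space int_lattice)"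
    using trace_sequence_bound[OF q s e a, where 'a='a] unfolding \<sigma>_def by blast
  define J where "J = wt_mass TYPE('a)"
  have J: "0 < J" unfolding J_def by (rule wt_mass_pos)
  define C where "C = C2 powr (p / q) * C1 * J"
  have C: "0 < C" unfolding C_def using C1(1) C2(1) J by simp
  have "wiener_qnorm \<eta> p q s (trace_op f) \<le> ennreal (C powr (1 / p)) * wiener_qnorm \<eta> p q \<sigma> f"
    if f: "f \<in> schwartz" for f :: "'a \<times> real \<Rightarrow> complex"
  proof -
    define G where "G = (\<lambda>z. ennpowr (\<integral>\<^sup>+l. ennreal (japanese l powr (\<sigma> * q) * norm (box_op \<eta> l f z) powr q) \<partial>count_space int_lattice) (p / q))"
    have G_meas [measurable]: "G \<in> borel_measurable borel"
    proof -
      interpret sigma_finite_measure "count_space (int_lattice :: ('a \<times> real) set)"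
        by (rule sigma_finite_measure_count_space_countable[OF countable_int_lattice])
      have "(\<lambda>(l, z). ennreal (japanese l powr (\<sigma> * q) * norm (box_op \<eta> l f z) powr q)) \<in> borel_measurable (count_space int_lattice \<Otimes>\<^sub>M borel)"
      proof (rule measurable_pair_measure_countable1[OF countable_int_lattice])
        fix l :: "'a \<times> real" assume "l \<in> int_lattice"
        note [measurable] = measurable_box_op[OF \<eta> this f]
        show "(\<lambda>z. case (l, z) of (l, z) \<Rightarrow> ennreal (japanese l powr (\<sigma> * q) * norm (box_op \<eta> l f z) powr q)) \<in> borel_measurable borel"
          by simp
      qed
      from measurable_pair_swap[OF this]
      have "(\<lambda>(z, l). ennreal (japanese l powr (\<sigma> * q) * norm (box_op \<eta> l f z) powr q)) \<in> borel_measurable (borel \<Otimes>\<^sub>M count_space int_lattice)"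
        by simp
      then have "(\<lambda>z. \<integral>\<^sup>+l. ennreal (japanese l powr (\<sigma> * q) * norm (box_op \<eta> l f z) powr q) \<partial>count_space int_lattice) \<in> borel_measurable borel"
        by (rule borel_measurable_nn_integral)
      then show ?thesis unfolding G_def by (rule measurable_ennpowr)
    qed
    have pointwise: "ennpowr (\<integral>\<^sup>+k. ennreal (japanese k powr (s * q) * norm (box_op \<eta> k (trace_op f) x) powr q) \<partial>count_space int_lattice) (p / q)
        \<le> ennreal (C2 powr (p / q) * C1) * (\<integral>\<^sup>+z. G z * ennreal (wt ((x, 0) - z) powr - 2) \<partial>lborel)" for x
    proof -
      have "ennpowr (\<integral>\<^sup>+k. ennreal (japanese k powr (s * q) * norm (box_op \<eta> k (trace_op f) x) powr q) \<partial>count_space int_lattice) (p / q)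
          \<le> ennpowr (ennreal C2 * (\<integral>\<^sup>+l. \<integral>\<^sup>+z. ennreal (japanese l powr (\<sigma> * q) * norm (box_op \<eta> l f z) powr q * wt ((x, 0) - z) powr - (a + 2)) \<partial>lborel \<partial>count_space int_lattice)) (p / q)"
        using p q by (intro ennpowr_mono C2(2) f) auto
      also have "\<dots> = ennreal (C2 powr (p / q)) * ennpowr (\<integral>\<^sup>+l. \<integral>\<^sup>+z. ennreal (japanese l powr (\<sigma> * q) * norm (box_op \<eta> l f z) powr q * wt ((x, 0) - z) powr - (a + 2)) \<partial>lborel \<partial>count_space int_lattice) (p / q)"
        using C2(1) by (simp add: ennpowr_mult ennpowr_ennreal)
      also have "\<dots> \<le> ennreal (C2 powr (p / q)) * (ennreal C1 * (\<integral>\<^sup>+z. G z * ennreal (wt ((x, 0) - z) powr - 2) \<partial>lborel))"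
        unfolding G_def by (intro mult_left_mono C1(2) f) auto
      finally show ?thesis using C1(1) by (simp add: ennreal_mult mult.assoc)
    qed
    have fiber: "(\<integral>\<^sup>+x. ennreal (wt ((x, 0) - z) powr - 2) \<partial>lborel) \<le> ennreal J" for z :: "'a \<times> real"
    proof -
      have "wt ((x, 0) - z) powr - 2 \<le> wt (fst z - x) powr - 2" for x
      proof (rule powr_mono2')
        have "wt (fst z - x) * 1 \<le> wt (x - fst z) * wt (0 - snd z)"
          unfolding wt_minus_commute[of "fst z"] by (intro mult_left_mono wt_ge_1) (simp add: less_imp_le)
        also have "\<dots> = wt ((x, 0) - z)"
          by (cases z) (simp add: wt_Pair)
        finally show "wt (fst z - x) \<le> wt ((x, 0) - z)" by simp
      qed auto
      then have "(\<integral>\<^sup>+x. ennreal (wt ((x, 0) - z) powr - 2) \<partial>lborel) \<le> (\<integral>\<^sup>+x. ennreal (wt (fst z - x) powr - 2) \<partial>lborel)"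
        by (intro nn_integral_mono ennreal_leI)
      also have "\<dots> \<le> ennreal J" unfolding J_def by (rule nn_integral_wt) simp
      finally show ?thesis .
    qed
    have "(\<integral>\<^sup>+x. ennpowr (\<integral>\<^sup>+k. ennreal (japanese k powr (s * q) * norm (box_op \<eta> k (trace_op f) x) powr q) \<partial>count_space int_lattice) (p / q) \<partial>lborel)
        \<le> (\<integral>\<^sup>+x. ennreal (C2 powr (p / q) * C1) * (\<integral>\<^sup>+z. G z * ennreal (wt ((x, 0) - z) powr - 2) \<partial>lborel) \<partial>lborel)"
      by (intro nn_integral_mono pointwise)
    also have "\<dots> = ennreal (C2 powr (p / q) * C1) * (\<integral>\<^sup>+x. \<integral>\<^sup>+z. G z * ennreal (wt ((x, 0) - z) powr - 2) \<partial>lborel \<partial>lborel)"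
      by (rule nn_integral_cmult) measurable
    also have "(\<integral>\<^sup>+x. \<integral>\<^sup>+z. G z * ennreal (wt ((x, 0) - z) powr - 2) \<partial>lborel \<partial>lborel)
        = (\<integral>\<^sup>+z. \<integral>\<^sup>+x. G z * ennreal (wt ((x, 0) - z) powr - 2) \<partial>lborel \<partial>lborel)"
      by (rule lborel_pair.Fubini'[symmetric]) measurable
    also have "\<dots> = (\<integral>\<^sup>+z. G z * (\<integral>\<^sup>+x. ennreal (wt ((x, 0) - z) powr - 2) \<partial>lborel) \<partial>lborel)"
      by (intro nn_integral_cong nn_integral_cmult) measurable
    also have "\<dots> \<le> (\<integral>\<^sup>+z. G z * ennreal J \<partial>lborel)"
      by (intro nn_integral_mono mult_left_mono fiber) auto
    also have "\<dots> = (\<integral>\<^sup>+z. G z \<partial>lborel) * ennreal J"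
      by (rule nn_integral_multc) measurable
    also have "ennreal (C2 powr (p / q) * C1) * ((\<integral>\<^sup>+z. G z \<partial>lborel) * ennreal J) = ennreal C * (\<integral>\<^sup>+z. G z \<partial>lborel)"
      using C1(1) C2(1) J by (simp add: C_def ennreal_mult mult_ac)
    finally have main: "(\<integral>\<^sup>+x. ennpowr (\<integral>\<^sup>+k. ennreal (japanese k powr (s * q) * norm (box_op \<eta> k (trace_op f) x) powr q) \<partial>count_space int_lattice) (p / q) \<partial>lborel)
        \<le> ennreal C * (\<integral>\<^sup>+z. G z \<partial>lborel)"
      by (simp add: mult_left_mono)
    have "wiener_qnorm \<eta> p q s (trace_op f) \<le> ennpowr (ennreal C * (\<integral>\<^sup>+z. G z \<partial>lborel)) (1 / p)"
      unfolding wiener_qnorm_eq[OF p q] using p by (intro ennpowr_mono main) auto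
    also have "\<dots> = ennreal (C powr (1 / p)) * wiener_qnorm \<eta> p q \<sigma> f"
      unfolding wiener_qnorm_eq[OF p q] G_def using C by (simp add: ennpowr_mult ennpowr_ennreal)
    finally show ?thesis .
  qed
  moreover have "0 < C powr (1 / p)" using C by simp
  ultimately show ?thesis unfolding trace_bounded_def \<sigma>_def by blast
qed

end

theorem corollary1p1:
  fixes \<eta> :: "real \<Rightarrow> real" and p q s \<epsilon> :: real
  assumes "cutoff \<eta>" and "0 < p" and "0 < q" and "0 \<le> s" and "0 < \<epsilon>"
  shows "trace_bounded
    (wiener_qnorm \<eta> p q (s + 1 / min 1 q - 1 / q + \<epsilon>) :: ((real ^ 'm) \<times> real \<Rightarrow> complex) \<Rightarrow> ennreal)
    (wiener_qnorm \<eta> p q s :: (real ^ 'm \<Rightarrow> complex) \<Rightarrow> ennreal)"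
  using assms by (rule trace_bounded_wiener)

end
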